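(* Let $\Omega,\widetilde{\Omega}\subset\mathbb{R}^n$ be domains and let $n<p<\infty$. Let $\varphi:\Omega\to\widetilde{\Omega}$ be a homeomorphism that generates a bounded composition operator $$\varphi^{\ast}: L^1_p(\widetilde{\Omega})\to L^1_p(\Omega),\qquad \varphi^{\ast}(f)=f\circ\varphi.$$ Then there exists a constant $H_p^{1}<\infty$ such that $$\limsup_{r\to 0}\frac{L_{\varphi}^{p}(x_0,r)\,r^{n-p}}{|\varphi(B(x_0,r))|}\leq H_p^{1}\quad\text{for all } x_0\in\Omega,$$ where $L_{\varphi}(x_0,r)=\max_{|x_0-y|=r}|\varphi(x_0)-\varphi(y)|$.
   Context: $|E|$ denotes the $n$-dimensional Lebesgue measure of $E\subset\mathbb{R}^n$ and $B(x,r)$ the ball with center $x$ and radius $r$; only $r$ small enough that the relevant balls lie in $\Omega$ are considered. For $1\leq p\leq\infty$, $L^1_p(\Omega)$ is the homogeneous Sobolev space of locally integrable weakly differentiable functions $f:\Omega\to\mathbb{R}$ with finite seminorm $\|f\mid L^1_p(\Omega)\|=\|\nabla f\mid L_p(\Omega)\|$. Elements of Sobolev spaces with exponent $p$ are regarded as equivalence classes up to sets of $p$-capacity zero. A homeomorphism $\varphi:\Omega\to\widetilde{\Omega}$ generates a bounded composition operator $\varphi^{\ast}:L^1_p(\widetilde{\Omega})\to L^1_q(\Omega)$, $1\leq q\leq p\leq\infty$, by the rule $\varphi^\ast(f)=f\circ\varphi$, if for every $f\in L^1_p(\widetilde{\Omega})$ the composition $\varphi^{\ast}(f)\in L^1_q(\Omega)$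 is defined quasi-everywhere in $\Omega$ (i.e. outside a set of capacity zero) and there is a constant $K_{p,q}(\varphi;\Omega)<\infty$ such that $\|\varphi^{\ast}(f)\mid L^1_q(\Omega)\|\leq K_{p,q}(\varphi;\Omega)\|f\mid L^1_p(\widetilde{\Omega})\|$ for all such $f$. Here this is used with $q=p$. *)

theory Defs
  imports "HOL-Analysis.Analysis"
begin

section \<open>Weak gradients\<close>

text \<open>Being \<open>C\<^sup>k\<close> on the whole space, with all iterated directional derivatives required to exist
  everywhere.\<close>

primrec Ck :: "nat \<Rightarrow> ('a::euclidean_space \<Rightarrow> real) \<Rightarrow> bool" where
  "Ck 0 f \<longleftrightarrow> continuous_on UNIV f"
| "Ck (Suc k) f \<longleftrightarrow>
     (\<forall>x. f differentiable (at x)) \<and> (\<forall>v. Ck k (\<lambda>x. frechet_derivative f (at x) v))"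

definition test_function :: "'a::euclidean_space set \<Rightarrow> ('a \<Rightarrow> real) \<Rightarrow> bool" where
  "test_function \<Omega> \<psi> \<longleftrightarrow>
     (\<forall>k. Ck k \<psi>) \<and> (\<exists>K. compact K \<and> K \<subseteq> \<Omega> \<and> (\<forall>x. x \<notin> K \<longrightarrow> \<psi> x = 0))"

definition locally_integrable_on ::
    "('a::euclidean_space \<Rightarrow> 'b::euclidean_space) \<Rightarrow> 'a set \<Rightarrow> bool" where
  "locally_integrable_on f \<Omega> \<longleftrightarrow> (\<forall>K. compact K \<and> K \<subseteq> \<Omega> \<longrightarrow> f absolutely_integrable_on K)"

definition has_weak_gradient ::
    "'a::euclidean_space set \<Rightarrow> ('a \<Rightarrow> real) \<Rightarrow> ('a \<Rightarrow> 'a) \<Rightarrow> bool" where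
  "has_weak_gradient \<Omega> f g \<longleftrightarrow>
     locally_integrable_on f \<Omega> \<and> locally_integrable_on g \<Omega> \<and>
     (\<forall>\<psi> b. test_function \<Omega> \<psi> \<longrightarrow> b \<in> Basis \<longrightarrow>
        (LINT x:\<Omega>|lebesgue. f x * frechet_derivative \<psi> (at x) b)
          = - (LINT x:\<Omega>|lebesgue. (g x \<bullet> b) * \<psi> x))"

text \<open>The weak gradient is unique up to null sets, so the choice does not affect integrals.\<close>

definition weak_gradient :: "'a::euclidean_space set \<Rightarrow> ('a \<Rightarrow> real) \<Rightarrow> 'a \<Rightarrow> 'a" where
  "weak_gradient \<Omega> f = (SOME g. has_weak_gradient \<Omega> f g)"


section \<open>Capacity\<close>

text \<open>Sobolev \<open>p\<close>-capacity. The full \<open>W\<^sup>1\<^sub>p\<close> norm is used because the capacity built from the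
  gradient alone and taken relative to the whole space vanishes on all compact sets when
  \<open>p\<close> is at least the dimension. The null sets are those of the condenser capacity relative to
  bounded open sets.\<close>

definition sobolev_capacity :: "real \<Rightarrow> 'a::euclidean_space set \<Rightarrow> ennreal" where
  "sobolev_capacity p E =
     (INF (u, g) \<in> {(u, g). has_weak_gradient UNIV u g \<and>
                            (\<exists>U. open U \<and> E \<subseteq> U \<and> (\<forall>x\<in>U. 1 \<le> u x))}.
        \<integral>\<^sup>+ x. ennreal (\<bar>u x\<bar> powr p + norm (g x) powr p) \<partial>lebesgue)"

definition quasi_everywhere :: "real \<Rightarrow> 'a::euclidean_space set \<Rightarrow> ('a \<Rightarrow> bool) \<Rightarrow> bool" where
  "quasi_everywhere p \<Omega> P \<longleftrightarrow> sobolev_capacity p {x \<in> \<Omega>. \<not> P x} = 0"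

definition quasicontinuous_on ::
    "real \<Rightarrow> 'a::euclidean_space set \<Rightarrow> ('a \<Rightarrow> real) \<Rightarrow> bool" where
  "quasicontinuous_on p \<Omega> f \<longleftrightarrow>
     (\<forall>\<epsilon>>0. \<exists>U. open U \<and> sobolev_capacity p U < \<epsilon> \<and> continuous_on (\<Omega> - U) f)"


section \<open>The homogeneous Sobolev space and composition operators\<close>

text \<open>An element of \<open>L\<^sup>1\<^sub>p(\<Omega>)\<close> is a class of functions that agree outside a set of capacity zero.
  As usual for refined Sobolev functions, it is represented here by quasicontinuous functions, which
  are determined quasi-everywhere by their class modulo null sets; values outside \<open>\<Omega>\<close> are
  irrelevant.\<close>

definition L1p :: "real \<Rightarrow> 'a::euclidean_space set \<Rightarrow> ('a \<Rightarrow> real) set" where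
  "L1p p \<Omega> = {f. quasicontinuous_on p \<Omega> f \<and> (\<exists>g. has_weak_gradient \<Omega> f g) \<and>
                 (\<lambda>x. norm (weak_gradient \<Omega> f x) powr p) absolutely_integrable_on \<Omega>}"

definition L1p_seminorm :: "real \<Rightarrow> 'a::euclidean_space set \<Rightarrow> ('a \<Rightarrow> real) \<Rightarrow> real" where
  "L1p_seminorm p \<Omega> f =
     (LINT x:\<Omega>|lebesgue. norm (weak_gradient \<Omega> f x) powr p) powr (1 / p)"

text \<open>The first conjunct says that the composition is defined quasi-everywhere: representatives
  of the same class are sent to representatives of the same class.\<close>

definition bounded_composition_operator ::
    "real \<Rightarrow> real \<Rightarrow> 'a::euclidean_space set \<Rightarrow> 'a set \<Rightarrow> ('a \<Rightarrow> 'a) \<Rightarrow> bool" where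
  "bounded_composition_operator p q \<Omega> \<Omega>' \<phi> \<longleftrightarrow>
     (\<forall>f \<in> L1p p \<Omega>'. \<forall>g \<in> L1p p \<Omega>'.
        quasi_everywhere p \<Omega>' (\<lambda>y. f y = g y) \<longrightarrow>
        quasi_everywhere q \<Omega> (\<lambda>x. (f \<circ> \<phi>) x = (g \<circ> \<phi>) x)) \<and>
     (\<exists>K. \<forall>f \<in> L1p p \<Omega>'.
        f \<circ> \<phi> \<in> L1p q \<Omega> \<and> L1p_seminorm q \<Omega> (f \<circ> \<phi>) \<le> K * L1p_seminorm p \<Omega>' f)"

definition max_dilation :: "('a::euclidean_space \<Rightarrow> 'a) \<Rightarrow> 'a \<Rightarrow> real \<Rightarrow> real" where
  "max_dilation \<phi> x r = (SUP y \<in> sphere x r. norm (\<phi> x - \<phi> y))"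

end

theory Submission
  imports Defs
begin

text \<open>Fix a ball \<open>B = ball x0 r\<close> whose closure lies in \<open>\<Omega>\<close>, put \<open>A = \<phi> ` B\<close> and let \<open>n\<close> be the dimension.
  Because \<open>p > n\<close>, Morrey's inequality bounds the oscillation over \<open>B\<close> of a component \<open>\<phi> x \<bullet> i\<close> by
  \<open>r powr (1 - n / p)\<close> times the \<open>L\<^sub>p\<close> norm of its weak gradient over \<open>B\<close>. So the theorem
  follows from the local energy bound \<open>\<parallel>\<nabla>(\<phi> \<bullet> i)\<parallel> \<le> C |A| powr (1 / p)\<close> with norms taken over \<open>B\<close>: raised
  to the power \<open>p\<close>, it gives \<open>max_dilation \<phi> x0 r powr p \<le> C * r powr (p - n) * |A|\<close>.

  The hypothesis on \<open>\<phi>\<close> is global, and localising it is the main point. A coordinate \<open>y \<bullet> i\<close> cannot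
  be cut off inside \<open>A\<close> at controlled cost, since \<open>A\<close> may contain long thin parts in which every cut-off has
  a huge gradient. Instead the coordinate is folded: \<open>f y = \<zeta> (y \<bullet> i) * \<eta> y\<close>, where \<open>\<zeta>\<close> is a zigzag with
  slopes \<open>\<plusminus>1\<close> and tiny amplitude \<open>\<epsilon>\<close>, and \<open>\<eta>\<close> is supported in \<open>A\<close> and equals 1 near the image of a given
  compact part \<open>Q\<close> of \<open>B\<close>. The gradient of \<open>\<eta>\<close> is multiplied by \<open>\<zeta>\<close>, so for small \<open>\<epsilon>\<close> one has
  \<open>|\<nabla>f| \<le> 2\<close> on \<open>A\<close> and \<open>\<nabla>f = 0\<close> elsewhere, whence \<open>\<parallel>\<nabla>(f \<circ> \<phi>)\<parallel> \<le> 2 K |A| powr (1 / p)\<close>. On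
  the other hand \<open>f \<circ> \<phi>\<close> is locally \<open>\<plusminus>(\<phi> \<bullet> i)\<close> plus a constant on \<open>Q\<close> away from the kinks of the zigzag,
  and weak gradients are determined locally up to null sets (\<open>weak_gradient_locally_determined\<close>), so there
  \<open>|\<nabla>(f \<circ> \<phi>)| = |\<nabla>(\<phi> \<bullet> i)|\<close> almost everywhere. The set of points of \<open>Q\<close> mapped to kinks might have positive
  measure; two zigzags, shifted against each other by half the distance of consecutive kinks, have no kink in
  common and together cover all of \<open>Q\<close>. This is
  \<open>box_gradient_bound_component\<close>.

  Morrey's inequality (\<open>morrey_inequality\<close>) is needed for a continuous function \<open>u\<close> of which only the
  pairings \<open>\<integral> u * \<partial>\<^sub>j\<psi>\<close> with test functions supported in boxes are controlled. Averages of \<open>u\<close> against products of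
  one-dimensional bumps are compared along a chain of shrinking boxes that leads from the centre of the ball to a
  given point. Changing the bump in one coordinate changes the kernel by a partial derivative of a test function,
  because two bumps of equal mass differ by the derivative of a function supported in the hull of their supports; hence each
  change of the average is one of the controlled pairings, and for \<open>p > n\<close> the changes form a
  convergent geometric series.\<close>

section \<open>Smooth functions of one and several variables\<close>

lemma Ck_SucI:
  assumes "\<And>x. (f has_derivative f' x) (at x)" "\<And>v. Ck k (\<lambda>x. f' x v)"
  shows "Ck (Suc k) f"
proof -
  have "frechet_derivative f (at x) = f' x" for x
    using assms(1) frechet_derivative_at by metis
  then show ?thesis
    using assms by (auto simp: differentiable_def)
qed

lemma Ck_SucE:
  assumes "Ck (Suc k) f"
  obtains f' where "\<And>x. (f has_derivative f' x) (at x)" "\<And>v. Ck k (\<lambda>x. f' x v)"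
  using assms frechet_derivative_works by (metis Ck.simps(2))

lemma Ck_Suc_imp_Ck: "Ck (Suc k) f \<Longrightarrow> Ck k f"
proof (induction k arbitrary: f)
  case 0
  then show ?case
    by (auto simp: continuous_on_eq_continuous_at differentiable_imp_continuous_within)
next
  case (Suc k)
  then show ?case by (metis Ck.simps(2))
qed

lemma Ck_const: "Ck k (\<lambda>x. c)"
proof (induction k arbitrary: c)
  case (Suc k)
  show ?case
    by (rule Ck_SucI[where f' = "\<lambda>x v. 0"]) (auto intro: Suc)
qed simp

lemma Ck_add: "Ck k f \<Longrightarrow> Ck k g \<Longrightarrow> Ck k (\<lambda>x. f x + g x)"
proof (induction k arbitrary: f g)
  case (Suc k)
  obtain f' where f': "\<And>x. (f has_derivative f' x) (at x)" "\<And>v. Ck k (\<lambda>x. f' x v)"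
    using Suc.prems(1) Ck_SucE by blast
  obtain g' where g': "\<And>x. (g has_derivative g' x) (at x)" "\<And>v. Ck k (\<lambda>x. g' x v)"
    using Suc.prems(2) Ck_SucE by blast
  show ?case
    by (rule Ck_SucI[where f' = "\<lambda>x v. f' x v + g' x v"]) (auto intro: Suc.IH f' g' has_derivative_add)
qed (auto intro: continuous_intros)

lemma Ck_mult: "Ck k f \<Longrightarrow> Ck k g \<Longrightarrow> Ck k (\<lambda>x. f x * g x)"
proof (induction k arbitrary: f g)
  case (Suc k)
  obtain f' where f': "\<And>x. (f has_derivative f' x) (at x)" "\<And>v. Ck k (\<lambda>x. f' x v)"
    using Suc.prems(1) Ck_SucE by blast
  obtain g' where g': "\<And>x. (g has_derivative g' x) (at x)" "\<And>v. Ck k (\<lambda>x. g' x v)"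
    using Suc.prems(2) Ck_SucE by blast
  have "Ck k f" "Ck k g"
    using Suc.prems Ck_Suc_imp_Ck by auto
  then show ?case
    by (intro Ck_SucI[where f' = "\<lambda>x v. f x * g' x v + f' x v * g x"] Ck_add Suc.IH f' g'
        has_derivative_mult)
qed (auto intro: continuous_intros)

lemma Ck_uminus: "Ck k f \<Longrightarrow> Ck k (\<lambda>x. - f x)"
  using Ck_mult[OF Ck_const[of k "-1"]] by simp

lemma Ck_diff: "Ck k f \<Longrightarrow> Ck k g \<Longrightarrow> Ck k (\<lambda>x. f x - g x)"
  using Ck_add[OF _ Ck_uminus] by fastforce

lemma Ck_prod: "(\<And>i. i \<in> I \<Longrightarrow> Ck k (f i)) \<Longrightarrow> Ck k (\<lambda>x. \<Prod>i\<in>I. f i x)"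
  by (induction I rule: infinite_finite_induct) (auto intro: Ck_const Ck_mult)

text \<open>With sums and products, this is the only composition needed: all smooth functions below are polynomials in
  one-dimensional functions of single coordinates.\<close>

lemma Ck_compose_affine_coordinate:
  fixes b :: "'a::euclidean_space"
  shows "Ck k h \<Longrightarrow> Ck k (\<lambda>x. h (a * (x \<bullet> b) + c))"
proof (induction k arbitrary: h)
  case 0
  then have "continuous_on UNIV h" by simp
  then have "continuous_on UNIV (h \<circ> (\<lambda>x. a * (x \<bullet> b) + c))"
    by (intro continuous_on_compose continuous_intros) (auto intro: continuous_on_subset)
  then show ?case by (simp add: o_def)
next
  case (Suc k)
  obtain h' where h': "\<And>x. (h has_derivative h' x) (at x)" "\<And>v. Ck k (\<lambda>x. h' x v)"
    using Suc.prems Ck_SucE by blast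
  have lin: "h' t w = w * h' t 1" for t w
    using linear_scale[OF has_derivative_linear[OF h'(1)[of t]], of w 1] by simp
  have 1: "((\<lambda>x. h (a * (x \<bullet> b) + c)) has_derivative (\<lambda>v. h' (a * (x \<bullet> b) + c) (a * (v \<bullet> b)))) (at x)" for x
    by (rule has_derivative_compose[of "\<lambda>x. a * (x \<bullet> b) + c" _ _ UNIV h, OF _ h'(1)])
       (auto intro!: derivative_eq_intros)
  have 2: "Ck k (\<lambda>x. h' (a * (x \<bullet> b) + c) (a * (v \<bullet> b)))" for v
    by (subst lin) (intro Ck_mult Ck_const Suc.IH h'(2))
  show ?case by (rule Ck_SucI[OF 1 2])
qed

lemma Ck_SucI_real:
  fixes f :: "real \<Rightarrow> real"
  assumes "\<And>x. (f has_real_derivative f' x) (at x)" "Ck k f'"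
  shows "Ck (Suc k) f"
  by (rule Ck_SucI[OF assms(1)[unfolded has_field_derivative_def]]) (intro Ck_mult Ck_const assms(2))


text \<open>The functions \<open>P (1 / t) * exp (- 1 / t)\<close>, extended by zero to \<open>t \<le> 0\<close>. A polynomial factor is carried along
  because this makes the family closed under differentiation.\<close>

definition flat_exp :: "real poly \<Rightarrow> real \<Rightarrow> real" where
  "flat_exp P t = (if t > 0 then poly P (1 / t) * exp (- (1 / t)) else 0)"

lemma poly_times_exp_tendsto_0: "((\<lambda>s. poly P s * exp (- s)) \<longlongrightarrow> (0::real)) at_top"
proof -
  have "((\<lambda>s. \<Sum>i\<le>degree P. coeff P i * (s ^ i / exp s)) \<longlongrightarrow> (\<Sum>i\<le>degree P. coeff P i * 0)) at_top"
    by (intro tendsto_intros tendsto_power_div_exp_0)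
  moreover have "(\<Sum>i\<le>degree P. coeff P i * (s ^ i / exp s)) = poly P s * exp (- s)" for s :: real
    by (simp add: poly_altdef sum_distrib_right exp_minus field_simps sum_divide_distrib)
  ultimately show ?thesis by simp
qed

lemma flat_exp_tendsto_0: "(flat_exp P \<longlongrightarrow> 0) (at 0)"
proof -
  have "((\<lambda>t. poly P (inverse t) * exp (- (inverse t))) \<longlongrightarrow> 0) (at_right 0)"
    using filterlim_compose[OF poly_times_exp_tendsto_0 filterlim_inverse_at_top_right] .
  then have r: "(flat_exp P \<longlongrightarrow> 0) (at_right 0)"
    by (rule Lim_transform_eventually)
       (auto simp: flat_exp_def eventually_at_filter field_simps)
  have "(flat_exp P \<longlongrightarrow> 0) (at_left 0)"
    by (rule Lim_transform_eventually[OF tendsto_const])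
       (auto simp: flat_exp_def eventually_at_filter)
  then show ?thesis using r filterlim_split_at by blast
qed

lemma flat_exp_has_derivative:
  "(flat_exp P has_real_derivative flat_exp ([:0, 0, 1:] * (P - pderiv P)) t) (at t)"
proof -
  consider "t > 0" | "t < 0" | "t = 0" by linarith
  then show ?thesis
  proof cases
    case 1
    have "((\<lambda>t. poly P (1 / t) * exp (- (1 / t))) has_real_derivative
            flat_exp ([:0, 0, 1:] * (P - pderiv P)) t) (at t)"
      using 1
      by (auto intro!: derivative_eq_intros DERIV_chain2[OF poly_DERIV]
          simp: flat_exp_def field_simps power2_eq_square)
    then show ?thesis
      by (rule has_field_derivative_transform_within_open[where S = "{0<..}"])
         (use 1 in \<open>auto simp: flat_exp_def\<close>)
  next
    case 2
    have "((\<lambda>t. 0) has_real_derivative flat_exp ([:0, 0, 1:] * (P - pderiv P)) t) (at t)"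
      using 2 by (simp add: flat_exp_def)
    then show ?thesis
      by (rule has_field_derivative_transform_within_open[where S = "{..<0}"])
         (use 2 in \<open>auto simp: flat_exp_def\<close>)
  next
    case 3
    have "((\<lambda>h. (flat_exp P (0 + h) - flat_exp P 0) / h) \<longlongrightarrow> 0) (at 0)"
      using flat_exp_tendsto_0[of "[:0, 1:] * P"]
      by (rule Lim_transform_eventually) (auto simp: flat_exp_def eventually_at_filter)
    then show ?thesis
      using 3 by (simp add: DERIV_def flat_exp_def)
  qed
qed

lemma Ck_flat_exp: "Ck k (flat_exp P)"
proof (induction k arbitrary: P)
  case 0
  then show ?case
    using flat_exp_has_derivative DERIV_isCont by (simp add: continuous_on_eq_continuous_at) blast
next
  case (Suc k)
  show ?case by (rule Ck_SucI_real[OF flat_exp_has_derivative Suc])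
qed

text \<open>The step \<open>\<sigma>\<close> is the normalised primitive of the bump \<open>\<beta>\<close>, the product of two flat exponentials
  centred at the ends of \<open>[-1, 1]\<close>. Both the step and its derivative are needed later: steps build cut-offs, and
  differences of steps are the primitives that appear when one bump is exchanged for another.\<close>

lemma smooth_step_exists:
  obtains \<sigma> \<rho> :: "real \<Rightarrow> real" where
    "\<And>k. Ck k \<sigma>" "\<And>k. Ck k \<rho>" "\<And>t. (\<sigma> has_real_derivative \<rho> t) (at t)"
    "\<And>t. 0 \<le> \<rho> t" "\<And>t. 1 \<le> \<bar>t\<bar> \<Longrightarrow> \<rho> t = 0" "0 < \<rho> 0"
    "\<And>t. t \<le> -1 \<Longrightarrow> \<sigma> t = 0" "\<And>t. 1 \<le> t \<Longrightarrow> \<sigma> t = 1" "\<And>t. 0 \<le> \<sigma> t" "\<And>t. \<sigma> t \<le> 1"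
proof -
  define \<beta> where "\<beta> t = flat_exp [:1:] (1 * (t \<bullet> 1) + 1) * flat_exp [:1:] (- 1 * (t \<bullet> 1) + 1)" for t :: real
  have \<beta>_Ck: "Ck k \<beta>" for k
    unfolding \<beta>_def by (intro Ck_mult Ck_compose_affine_coordinate Ck_flat_exp)
  have \<beta>_nonneg: "0 \<le> \<beta> t" for t
    by (simp add: \<beta>_def flat_exp_def)
  have \<beta>_0: "\<beta> t = 0" if "1 \<le> \<bar>t\<bar>" for t
    using that by (auto simp: \<beta>_def flat_exp_def)
  have \<beta>_pos: "0 < \<beta> 0"
    by (simp add: \<beta>_def flat_exp_def)
  have cont: "continuous_on S \<beta>" for S
    using \<beta>_Ck[of 0] continuous_on_subset by auto
  \<comment> \<open>Starting the integral at -2, left of the support, makes the formula differentiable at -1 as well.\<close>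
  define B where "B t = integral {-2..t} \<beta>" for t
  have B_0: "B t = 0" if "t \<le> -1" for t
  proof -
    have "integral {-2..t} \<beta> = integral {-2..t} (\<lambda>_. 0)"
      using that by (intro integral_cong \<beta>_0) auto
    then show ?thesis by (simp add: B_def)
  qed
  have B_deriv: "(B has_real_derivative \<beta> t) (at t)" for t
  proof (cases "t < -1")
    case True
    have "((\<lambda>t. 0) has_real_derivative \<beta> t) (at t)"
      using True by (simp add: \<beta>_0)
    then show ?thesis
      by (rule has_field_derivative_transform_within_open[where S = "{..<-1}"])
         (use True in \<open>auto simp: B_0\<close>)
  next
    case False
    have "(B has_real_derivative \<beta> t) (at t within {-2..t + 1})"
      unfolding B_def using False by (intro integral_has_real_derivative cont) auto
    moreover have "at t within {-2..t + 1} = at t"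
      using False by (intro at_within_interior) auto
    ultimately show ?thesis by simp
  qed
  have B_mono: "B s \<le> B t" if "s \<le> t" for s t
    by (rule DERIV_nonneg_imp_nondecreasing[OF that]) (use B_deriv \<beta>_nonneg in blast)
  have B_const: "B t = B 1" if "1 \<le> t" for t
  proof (cases "t = 1")
    case False
    show ?thesis
    proof (rule DERIV_isconst2[of 1 t])
      show "continuous_on {1..t} B"
        using B_deriv by (meson DERIV_isCont continuous_at_imp_continuous_on)
      show "(B has_real_derivative 0) (at x)" if "1 < x" "x < t" for x
        using B_deriv[of x] \<beta>_0[of x] that by simp
    qed (use that False in auto)
  qed auto
  have B_pos: "0 < B 1"
  proof (rule ccontr)
    assume "\<not> 0 < B 1"
    then have *: "B t = 0" if "t \<le> 1" for t
      using B_mono[OF that] B_mono[of "min (-1) t" t] B_0[of "min (-1) t"] by auto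
    have "((\<lambda>t. 0) has_real_derivative \<beta> 0) (at 0)"
      by (rule has_field_derivative_transform_within_open[OF B_deriv, where S = "{..<1}"])
         (auto simp: *)
    then have "\<beta> 0 = 0"
      using DERIV_unique DERIV_const by blast
    then show False using \<beta>_pos by simp
  qed
  have B_Ck: "Ck k B" for k
    using Ck_SucI_real[OF B_deriv \<beta>_Ck] Ck_Suc_imp_Ck by blast
  show thesis
  proof (rule that[of "\<lambda>t. 1 / B 1 * B t" "\<lambda>t. 1 / B 1 * \<beta> t"])
    show "((\<lambda>t. 1 / B 1 * B t) has_real_derivative 1 / B 1 * \<beta> t) (at t)" for t
      by (intro DERIV_cmult B_deriv)
    show "0 \<le> 1 / B 1 * B t" for t
      using B_pos B_mono[of "min (-1) t" t] B_0[of "min (-1) t"] by auto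
    show "1 / B 1 * B t \<le> 1" for t
      using B_pos B_mono[of t "max 1 t"] B_const[of "max 1 t"] by auto
    show "1 / B 1 * B t = 1" if "1 \<le> t" for t
      using B_pos B_const[OF that] by simp
  qed (use B_Ck \<beta>_Ck \<beta>_nonneg \<beta>_0 \<beta>_pos B_0 B_pos in \<open>auto intro!: Ck_mult Ck_const simp del: times_divide_eq_left\<close>)
qed

lemma Ck_imp_has_derivative:
  assumes "Ck (Suc k) f"
  shows "(f has_derivative frechet_derivative f (at x)) (at x)"
  using assms frechet_derivative_works by auto

lemma Ck_imp_continuous_on:
  assumes "Ck k f"
  shows "continuous_on S f"
proof -
  have "Ck k f \<Longrightarrow> Ck 0 f" for k
    by (induction k) (simp_all add: Ck_Suc_imp_Ck del: Ck.simps)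
  then have "continuous_on UNIV f" using assms Ck.simps(1) by blast
  then show ?thesis
    by (rule continuous_on_subset) simp
qed

section \<open>Test functions and cut-offs\<close>

lemma test_functionE:
  assumes "test_function \<Omega> \<psi>"
  obtains K where "compact K" "K \<subseteq> \<Omega>" "\<And>x. x \<notin> K \<Longrightarrow> \<psi> x = 0"
    "\<And>x v. x \<notin> K \<Longrightarrow> frechet_derivative \<psi> (at x) v = 0"
proof -
  obtain K where K: "compact K" "K \<subseteq> \<Omega>" "\<And>x. x \<notin> K \<Longrightarrow> \<psi> x = 0"
    using assms by (auto simp: test_function_def)
  have "frechet_derivative \<psi> (at x) v = 0" if "x \<notin> K" for x v
  proof -
    have "((\<lambda>x. 0) has_derivative (\<lambda>_. 0)) (at x)" by simp
    then have "(\<psi> has_derivative (\<lambda>_. 0)) (at x)"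
      by (rule has_derivative_transform_within_open[where s = "- K"])
         (use K that compact_imp_closed in auto)
    then have "frechet_derivative \<psi> (at x) = (\<lambda>_. 0)"
      using frechet_derivative_at by metis
    then show ?thesis by simp
  qed
  with K show thesis using that by blast
qed

lemma test_function_has_derivative:
  assumes "test_function \<Omega> \<psi>"
  shows "(\<psi> has_derivative frechet_derivative \<psi> (at x)) (at x)"
  by (rule Ck_imp_has_derivative[of 0]) (use assms in \<open>simp add: test_function_def del: Ck.simps\<close>)

lemma test_function_continuous_on:
  assumes "test_function \<Omega> \<psi>"
  shows "continuous_on S \<psi>" "continuous_on S (\<lambda>x. frechet_derivative \<psi> (at x) v)"
proof -
  have "Ck 0 \<psi>" "Ck (Suc 0) \<psi>"
    using assms by (auto simp: test_function_def simp del: Ck.simps)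
  then show "continuous_on S \<psi>" "continuous_on S (\<lambda>x. frechet_derivative \<psi> (at x) v)"
    by (auto intro: continuous_on_subset)
qed

lemma test_function_mono: "test_function V \<psi> \<Longrightarrow> V \<subseteq> \<Omega> \<Longrightarrow> test_function \<Omega> \<psi>"
  unfolding test_function_def by blast

lemma test_function_mult:
  assumes "test_function \<Omega> \<eta>" "test_function \<Omega>' \<psi>"
  shows "test_function \<Omega>' (\<lambda>x. \<eta> x * \<psi> x)"
  using assms unfolding test_function_def by (auto intro: Ck_mult)

text \<open>The gradient of a test function as a vector, in contrast to the almost everywhere defined weak gradient.\<close>

definition classical_gradient :: "('a::euclidean_space \<Rightarrow> real) \<Rightarrow> 'a \<Rightarrow> 'a" where
  "classical_gradient \<psi> x = (\<Sum>b\<in>Basis. frechet_derivative \<psi> (at x) b *\<^sub>R b)"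

lemma classical_gradient_inner:
  assumes "test_function \<Omega> \<psi>"
  shows "classical_gradient \<psi> x \<bullet> v = frechet_derivative \<psi> (at x) v"
proof -
  have "linear (frechet_derivative \<psi> (at x))"
    using test_function_has_derivative[OF assms] has_derivative_linear by blast
  then have "frechet_derivative \<psi> (at x) v = (\<Sum>b\<in>Basis. (v \<bullet> b) * frechet_derivative \<psi> (at x) b)"
    by (subst (1) euclidean_representation[of v, symmetric])
       (simp only: linear_sum linear_scale o_def real_scaleR_def)
  then show ?thesis
    unfolding classical_gradient_def inner_sum_left by (simp add: inner_commute mult.commute)
qed

lemma continuous_on_classical_gradient:
  assumes "test_function \<Omega> \<psi>"
  shows "continuous_on S (classical_gradient \<psi>)"
  unfolding classical_gradient_def
  by (intro continuous_intros test_function_continuous_on(2)[OF assms])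

lemma test_function_bounded_gradient:
  assumes "test_function \<Omega> \<psi>"
  obtains C where "0 \<le> C" "\<And>x. norm (classical_gradient \<psi> x) \<le> C"
proof -
  obtain K where K: "compact K" "\<And>x v. x \<notin> K \<Longrightarrow> frechet_derivative \<psi> (at x) v = 0"
    using test_functionE[OF assms] by metis
  have "bounded (classical_gradient \<psi> ` K)"
    by (intro compact_imp_bounded compact_continuous_image K continuous_on_classical_gradient[OF assms])
  then obtain C where C: "\<And>x. x \<in> K \<Longrightarrow> norm (classical_gradient \<psi> x) \<le> C" "0 < C"
    by (auto simp: bounded_pos)
  have "norm (classical_gradient \<psi> x) \<le> C" for x
    using C K(2)[of x] by (cases "x \<in> K") (auto simp: classical_gradient_def)
  then show thesis using that[of C] C(2) by simp
qed

lemma test_function_bounded: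
  assumes "test_function \<Omega> \<psi>"
  obtains C where "0 \<le> C" "\<And>x. \<bar>\<psi> x\<bar> \<le> C"
proof -
  obtain K where K: "compact K" "\<And>x. x \<notin> K \<Longrightarrow> \<psi> x = 0"
    using test_functionE[OF assms] by metis
  have "bounded (\<psi> ` K)"
    by (intro compact_imp_bounded compact_continuous_image K test_function_continuous_on[OF assms])
  then obtain C where C: "\<And>x. x \<in> K \<Longrightarrow> \<bar>\<psi> x\<bar> \<le> C" "0 < C"
    by (auto simp: bounded_pos)
  have "\<bar>\<psi> x\<bar> \<le> C" for x
    using C K(2)[of x] by (cases "x \<in> K") auto
  then show thesis using that[of C] C(2) by simp
qed

lemma test_function_lipschitz:
  assumes "test_function \<Omega> \<psi>"
  obtains L where "0 \<le> L" "\<And>x y. \<bar>\<psi> x - \<psi> y\<bar> \<le> L * norm (x - y)"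
proof -
  obtain C where C: "0 \<le> C" "\<And>x. norm (classical_gradient \<psi> x) \<le> C"
    using test_function_bounded_gradient[OF assms] by metis
  have "onorm (frechet_derivative \<psi> (at x)) \<le> C" for x
  proof (rule onorm_le)
    fix v
    have "norm (frechet_derivative \<psi> (at x) v) \<le> norm (classical_gradient \<psi> x) * norm v"
      using Cauchy_Schwarz_ineq2[of "classical_gradient \<psi> x" v] classical_gradient_inner[OF assms]
      by simp
    also have "\<dots> \<le> C * norm v"
      by (intro mult_right_mono C) auto
    finally show "norm (frechet_derivative \<psi> (at x) v) \<le> C * norm v" .
  qed
  then have "norm (\<psi> x - \<psi> y) \<le> C * norm (x - y)" for x y
    by (intro differentiable_bound[of UNIV \<psi>]) (auto intro: test_function_has_derivative[OF assms])
  then show thesis using that[of C] C(1) by simp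
qed

lemma smooth_box_cutoff:
  fixes x :: "'a::euclidean_space"
  assumes "0 < \<delta>"
  obtains \<psi> where "\<And>k. Ck k \<psi>" "\<And>z. 0 \<le> \<psi> z" "\<And>z. \<psi> z \<le> 1"
    "\<And>z. norm (z - x) < \<delta> \<Longrightarrow> \<psi> z = 1"
    "\<And>z. \<psi> z \<noteq> 0 \<Longrightarrow> z \<in> cbox (x - (2 * \<delta>) *\<^sub>R One) (x + (2 * \<delta>) *\<^sub>R One)"
proof -
  obtain \<sigma> \<rho> :: "real \<Rightarrow> real" where \<sigma>: "\<And>k. Ck k \<sigma>" "\<And>t. t \<le> -1 \<Longrightarrow> \<sigma> t = 0"
    "\<And>t. 1 \<le> t \<Longrightarrow> \<sigma> t = 1" "\<And>t. 0 \<le> \<sigma> t" "\<And>t. \<sigma> t \<le> 1"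
    by (rule smooth_step_exists) blast
  \<comment> \<open>A smooth plateau in \<open>s = ((z - x) \<bullet> i) / \<delta>\<close>: \<open>2 * s + 3\<close> and \<open>3 - 2 * s\<close> are both at least 1 for \<open>|s| \<le> 1\<close>, and one of them is at most -1 for \<open>|s| \<ge> 2\<close>.\<close>
  define \<tau> where "\<tau> i z = \<sigma> (2 / \<delta> * (z \<bullet> i) + (3 - 2 / \<delta> * (x \<bullet> i)))
      * \<sigma> (- (2 / \<delta>) * (z \<bullet> i) + (3 + 2 / \<delta> * (x \<bullet> i)))" for i z
  have one: "\<tau> i z = 1" if "\<bar>(z - x) \<bullet> i\<bar> \<le> \<delta>" for i z
  proof -
    have "\<bar>2 / \<delta> * ((z - x) \<bullet> i)\<bar> \<le> 2 / \<delta> * \<delta>"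
      using that assms by (subst abs_mult) (intro mult_mono, auto)
    then have "\<bar>2 / \<delta> * ((z - x) \<bullet> i)\<bar> \<le> 2" using assms by simp
    moreover have "2 / \<delta> * ((z - x) \<bullet> i) = 2 / \<delta> * (z \<bullet> i) - 2 / \<delta> * (x \<bullet> i)"
      by (simp add: inner_diff_left right_diff_distrib)
    ultimately show ?thesis
      unfolding \<tau>_def by (subst \<sigma>(3), linarith, subst \<sigma>(3), linarith) simp
  qed
  have zero: "\<tau> i z = 0" if "\<not> \<bar>(z - x) \<bullet> i\<bar> \<le> 2 * \<delta>" for i z
  proof -
    have "2 / \<delta> * (2 * \<delta>) \<le> \<bar>2 / \<delta> * ((z - x) \<bullet> i)\<bar>"
      using that assms by (subst abs_mult) (intro mult_mono, auto)
    then have "4 \<le> \<bar>2 / \<delta> * ((z - x) \<bullet> i)\<bar>" using assms by simp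
    moreover have "2 / \<delta> * ((z - x) \<bullet> i) = 2 / \<delta> * (z \<bullet> i) - 2 / \<delta> * (x \<bullet> i)"
      by (simp add: inner_diff_left right_diff_distrib)
    ultimately have "2 / \<delta> * (z \<bullet> i) + (3 - 2 / \<delta> * (x \<bullet> i)) \<le> -1
        \<or> - (2 / \<delta>) * (z \<bullet> i) + (3 + 2 / \<delta> * (x \<bullet> i)) \<le> -1"
      by (smt (verit) mult_minus_left)
    then show ?thesis
      unfolding \<tau>_def using \<sigma>(2) by auto
  qed
  have bounds: "0 \<le> \<tau> i z" "\<tau> i z \<le> 1" for i z
    unfolding \<tau>_def by (simp_all add: \<sigma>(4,5) mult_le_one)
  show thesis
  proof (rule that[of "\<lambda>z. \<Prod>i\<in>Basis. \<tau> i z"])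
    show "Ck k (\<lambda>z. \<Prod>i\<in>Basis. \<tau> i z)" for k
      unfolding \<tau>_def by (intro Ck_prod Ck_mult Ck_compose_affine_coordinate \<sigma>(1))
    show "0 \<le> (\<Prod>i\<in>Basis. \<tau> i z)" "(\<Prod>i\<in>Basis. \<tau> i z) \<le> 1" for z
      by (auto intro!: prod_nonneg prod_le_1 simp: bounds)
    show "(\<Prod>i\<in>Basis. \<tau> i z) = 1" if "norm (z - x) < \<delta>" for z
      using that Basis_le_norm[of _ "z - x"] by (intro prod.neutral ballI one) fastforce
    show "z \<in> cbox (x - (2 * \<delta>) *\<^sub>R One) (x + (2 * \<delta>) *\<^sub>R One)"
      if "(\<Prod>i\<in>Basis. \<tau> i z) \<noteq> 0" for z
    proof -
      have "\<bar>(z - x) \<bullet> i\<bar> \<le> 2 * \<delta>" if "i \<in> Basis" for i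
        using \<open>(\<Prod>i\<in>Basis. \<tau> i z) \<noteq> 0\<close> zero that by (metis finite_Basis prod_zero_iff)
      then show ?thesis
        by (fastforce simp: mem_box inner_diff_left inner_add_left abs_le_iff)
    qed
  qed
qed

text \<open>Finitely many boxes inside \<open>U\<close> cover \<open>K\<close>; the function \<open>1 - (\<Prod>x. 1 - \<phi> x)\<close> formed from their cut-offs is 1
  wherever one of the \<open>\<phi> x\<close> is, and vanishes where all of them do. It is 1 even on a neighbourhood of \<open>K\<close>, which is what
  makes it invisible to weak gradients near \<open>K\<close>.\<close>

lemma smooth_cutoff:
  fixes K :: "'a::euclidean_space set"
  assumes "compact K" "open U" "K \<subseteq> U"
  obtains \<psi> W where "test_function U \<psi>" "\<And>z. 0 \<le> \<psi> z" "\<And>z. \<psi> z \<le> 1"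
    "open W" "K \<subseteq> W" "\<And>z. z \<in> W \<Longrightarrow> \<psi> z = 1"
proof -
  have "\<exists>d>0. cbox (x - (2 * d) *\<^sub>R One) (x + (2 * d) *\<^sub>R One) \<subseteq> U" if "x \<in> K" for x
  proof -
    obtain e where e: "e > 0" "ball x e \<subseteq> U"
      using assms \<open>x \<in> K\<close> open_contains_ball by blast
    define d where "d = e / (4 * DIM('a))"
    have d: "d > 0" using e by (simp add: d_def)
    have "z \<in> ball x e" if z: "z \<in> cbox (x - (2 * d) *\<^sub>R One) (x + (2 * d) *\<^sub>R One)" for z
    proof -
      have "norm (z - x) \<le> (\<Sum>i\<in>Basis. \<bar>(z - x) \<bullet> i\<bar>)"
        by (rule norm_le_l1)
      also have "\<dots> \<le> (\<Sum>i\<in>(Basis::'a set). 2 * d)"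
        using z by (intro sum_mono) (fastforce simp: mem_box inner_diff_left inner_add_left abs_le_iff)
      also have "\<dots> = e / 2" by (simp add: d_def)
      also have "\<dots> < e" using e by simp
      finally show ?thesis by (simp add: dist_norm norm_minus_commute)
    qed
    then show ?thesis using d e by blast
  qed
  then obtain d where d: "\<And>x. x \<in> K \<Longrightarrow> 0 < d x"
    "\<And>x. x \<in> K \<Longrightarrow> cbox (x - (2 * d x) *\<^sub>R One) (x + (2 * d x) *\<^sub>R One) \<subseteq> U"
    by metis
  have "\<exists>\<psi>. (\<forall>k. Ck k \<psi>) \<and> (\<forall>z. 0 \<le> \<psi> z \<and> \<psi> z \<le> 1) \<and> (\<forall>z\<in>ball x (d x). \<psi> z = 1) \<and>
      (\<forall>z. \<psi> z \<noteq> 0 \<longrightarrow> z \<in> cbox (x - (2 * d x) *\<^sub>R One) (x + (2 * d x) *\<^sub>R One))" if "x \<in> K" for x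
    by (rule smooth_box_cutoff[OF d(1)[OF that], of x])
       (metis dist_commute dist_norm mem_ball)
  then have "\<forall>x\<in>K. \<exists>\<psi>. (\<forall>k. Ck k \<psi>) \<and> (\<forall>z. 0 \<le> \<psi> z \<and> \<psi> z \<le> 1) \<and> (\<forall>z\<in>ball x (d x). \<psi> z = 1) \<and>
      (\<forall>z. \<psi> z \<noteq> 0 \<longrightarrow> z \<in> cbox (x - (2 * d x) *\<^sub>R One) (x + (2 * d x) *\<^sub>R One))" ..
  from bchoice[OF this]
  obtain \<phi> where *: "\<forall>x\<in>K. (\<forall>k. Ck k (\<phi> x)) \<and> (\<forall>z. 0 \<le> \<phi> x z \<and> \<phi> x z \<le> 1)
      \<and> (\<forall>z\<in>ball x (d x). \<phi> x z = 1)
      \<and> (\<forall>z. \<phi> x z \<noteq> 0 \<longrightarrow> z \<in> cbox (x - (2 * d x) *\<^sub>R One) (x + (2 * d x) *\<^sub>R One))" ..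
  have \<phi>: "\<And>x k. x \<in> K \<Longrightarrow> Ck k (\<phi> x)"
    "\<And>x z. x \<in> K \<Longrightarrow> 0 \<le> \<phi> x z" "\<And>x z. x \<in> K \<Longrightarrow> \<phi> x z \<le> 1"
    "\<And>x z. x \<in> K \<Longrightarrow> z \<in> ball x (d x) \<Longrightarrow> \<phi> x z = 1"
    "\<And>x z. x \<in> K \<Longrightarrow> \<phi> x z \<noteq> 0 \<Longrightarrow> z \<in> cbox (x - (2 * d x) *\<^sub>R One) (x + (2 * d x) *\<^sub>R One)"
    using bspec[OF *] by blast+
  obtain C where C: "C \<subseteq> K" "finite C" "K \<subseteq> (\<Union>x\<in>C. ball x (d x))"
  proof (rule compactE_image[OF assms(1), of K "\<lambda>x. ball x (d x)"])
    show "K \<subseteq> (\<Union>x\<in>K. ball x (d x))" using d(1) by auto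
  qed (use that in auto)
  define \<psi> where "\<psi> z = 1 - (\<Prod>x\<in>C. 1 - \<phi> x z)" for z
  show thesis
  proof (rule that[of \<psi> "\<Union>x\<in>C. ball x (d x)"])
    define S where "S = (\<Union>x\<in>C. cbox (x - (2 * d x) *\<^sub>R One) (x + (2 * d x) *\<^sub>R One))"
    have "compact S"
      unfolding S_def by (intro compact_UN C compact_cbox)
    moreover have "S \<subseteq> U"
      unfolding S_def using d(2) C(1) by blast
    moreover have "\<psi> z = 0" if "z \<notin> S" for z
    proof -
      have "\<phi> x z = 0" if "x \<in> C" for x
        using \<phi>(5)[of x z] that \<open>z \<notin> S\<close> C(1) unfolding S_def by blast
      then show ?thesis by (simp add: \<psi>_def)
    qed
    moreover have "Ck k \<psi>" for k
      unfolding \<psi>_def using C(1) by (intro Ck_diff Ck_prod Ck_const \<phi>) auto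
    ultimately show "test_function U \<psi>"
      unfolding test_function_def by blast
    have "0 \<le> (\<Prod>x\<in>C. 1 - \<phi> x z)" "(\<Prod>x\<in>C. 1 - \<phi> x z) \<le> 1" for z
      using \<phi>(2,3) C(1) by (auto intro!: prod_nonneg prod_le_1)
    then show "0 \<le> \<psi> z" "\<psi> z \<le> 1" for z
      by (auto simp: \<psi>_def)
    show "\<psi> z = 1" if "z \<in> (\<Union>x\<in>C. ball x (d x))" for z
    proof -
      obtain x where "x \<in> C" "1 - \<phi> x z = 0"
        using \<open>z \<in> _\<close> \<phi>(4) C(1) by fastforce
      then have "(\<Prod>x\<in>C. 1 - \<phi> x z) = 0"
        using C(2) by (auto simp: prod_zero_iff)
      then show ?thesis by (simp add: \<psi>_def)
    qed
  qed (use C in auto)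
qed

section \<open>Integration by parts for Lipschitz functions\<close>

text \<open>The integral of each difference quotient vanishes by translation invariance of Lebesgue measure, and the
  Lipschitz constant dominates the quotients. Differentiability almost everywhere suffices for passing to the limit,
  which is why zigzag functions are covered.\<close>

lemma integral_directional_derivative_eq_0:
  fixes F :: "'a::euclidean_space \<Rightarrow> real" and b :: 'a
  assumes lip: "\<And>x y. \<bar>F x - F y\<bar> \<le> L * norm (x - y)"
    and supp: "compact K" "\<And>x. x \<notin> K \<Longrightarrow> F x = 0"
    and D: "D \<in> borel_measurable lebesgue"
    and lim: "AE x in lebesgue. ((\<lambda>h. F (x + h *\<^sub>R b)) has_real_derivative D x) (at 0)"
  shows "integrable lebesgue D" "(LINT x|lebesgue. D x) = 0"
proof -
  define h where "h n = 1 / real (Suc n)" for n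
  define s where "s n x = (F (x + h n *\<^sub>R b) - F x) / h n" for n x
  have h: "0 < h n" "h n \<le> 1" for n
    by (auto simp: h_def)
  have cont: "continuous_on UNIV F"
  proof (rule lipschitz_on_continuous_on)
    show "(max L 0)-lipschitz_on UNIV F"
    proof (rule lipschitz_onI)
      fix x y :: 'a
      have "L * norm (x - y) \<le> max L 0 * norm (x - y)"
        by (intro mult_right_mono) auto
      then show "dist (F x) (F y) \<le> max L 0 * dist x y"
        using lip[of x y] by (simp add: dist_norm)
    qed auto
  qed
  then have Fb [measurable]: "F \<in> borel_measurable borel"
    by (rule borel_measurable_continuous_onI)
  obtain R where R: "\<And>x. x \<in> K \<Longrightarrow> norm x \<le> R"
    using compact_imp_bounded[OF supp(1)] by (auto simp: bounded_iff)
  have "integrable lborel (\<lambda>x. indicator K x *\<^sub>R F x)"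
    using borel_integrable_compact[OF supp(1)] cont continuous_on_subset by blast
  moreover have "(\<lambda>x. indicator K x *\<^sub>R F x) = F"
    using supp(2) by (auto simp: indicator_def fun_eq_iff)
  ultimately have Fint: "integrable lborel F" by simp
  have shift: "integrable lborel (\<lambda>x. F (x + c))" "(LINT x|lborel. F (x + c)) = (LINT x|lborel. F x)" for c
    using integral_distr[of "(+) c" lborel borel F] integrable_distr_eq[of "(+) c" lborel borel F]
      lborel_distr_plus[of c] Fint by (auto simp: add.commute)
  have s_meas [measurable]: "s n \<in> borel_measurable borel" for n
    unfolding s_def by measurable
  have s_int: "(LINT x|lebesgue. s n x) = 0" for n
  proof -
    have "(LINT x|lebesgue. s n x) = (LINT x|lborel. s n x)"
      by (intro integral_completion) simp
    also have "\<dots> = 0"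
      unfolding s_def using shift Fint by simp
    finally show ?thesis .
  qed
  define w where "w x = (\<bar>L\<bar> * norm b) * indicator (cball 0 (R + norm b)) x" for x :: 'a
  have w_int: "integrable lebesgue w"
  proof -
    have "integrable lborel w"
      unfolding w_def by (intro integrable_mult_right integrable_real_indicator)
        (use emeasure_lborel_cball_finite[of 0 "R + norm b"] in auto)
    then show ?thesis
      by (subst integrable_completion) (auto simp: w_def)
  qed
  have s_bound: "norm (s n x) \<le> w x" for n x
  proof (cases "norm x \<le> R + norm b")
    case True
    have "\<bar>F (x + h n *\<^sub>R b) - F x\<bar> \<le> L * (h n * norm b)"
      using lip[of "x + h n *\<^sub>R b" x] h[of n] by simp
    also have "\<dots> \<le> \<bar>L\<bar> * (h n * norm b)"
      using h[of n] by (intro mult_right_mono) auto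
    finally show ?thesis
      using True h[of n] by (simp add: s_def w_def field_simps)
  next
    case False
    have "h n * norm b \<le> norm b"
      using h[of n] by (intro mult_left_le_one_le) auto
    moreover have "norm x \<le> norm (x + h n *\<^sub>R b) + norm (h n *\<^sub>R b)"
      using norm_triangle_ineq4[of "x + h n *\<^sub>R b" "h n *\<^sub>R b"] by simp
    ultimately have "R < norm (x + h n *\<^sub>R b)"
      using False h[of n] by simp
    moreover have "R < norm x"
      using False norm_ge_zero[of b] by linarith
    ultimately have "F (x + h n *\<^sub>R b) = 0" "F x = 0"
      using R supp(2) by (meson not_less)+
    then show ?thesis
      by (simp add: s_def w_def)
  qed
  have s_lim: "AE x in lebesgue. (\<lambda>n. s n x) \<longlonglongrightarrow> D x"
    using lim
  proof eventually_elim
    case (elim x)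
    have "(h \<longlongrightarrow> 0) sequentially"
      unfolding h_def by (rule LIMSEQ_Suc[OF lim_1_over_n])
    then have "filterlim h (at 0) sequentially"
      using h by (intro filterlim_atI) (auto intro!: always_eventually simp: less_imp_neq[symmetric])
    moreover have "((\<lambda>h. (F (x + h *\<^sub>R b) - F x) / h) \<longlongrightarrow> D x) (at 0)"
      using elim by (simp add: DERIV_def)
    ultimately show ?case
      unfolding s_def using filterlim_compose[of "\<lambda>h. (F (x + h *\<^sub>R b) - F x) / h" "nhds (D x)" "at 0" h]
      by simp
  qed
  have s_leb: "s n \<in> borel_measurable lebesgue" for n
    by (intro measurable_completion) simp
  have dom: "AE x in lebesgue. norm (s n x) \<le> w x" for n
    using s_bound by simp
  show "integrable lebesgue D"
    using integrable_dominated_convergence[OF D s_leb w_int s_lim dom] .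
  have "(\<lambda>n. LINT x|lebesgue. s n x) \<longlonglongrightarrow> (LINT x|lebesgue. D x)"
    using integral_dominated_convergence[OF D s_leb w_int s_lim dom] .
  then show "(LINT x|lebesgue. D x) = 0"
    using s_int LIMSEQ_unique tendsto_const by (metis (no_types, lifting) ext)
qed

lemma test_function_line_derivative:
  assumes "test_function \<Omega> \<psi>"
  shows "((\<lambda>h. \<psi> (x + h *\<^sub>R b)) has_real_derivative frechet_derivative \<psi> (at x) b) (at 0)"
proof -
  have "(\<psi> has_derivative frechet_derivative \<psi> (at x)) (at (x + 0 *\<^sub>R b))"
    using test_function_has_derivative[OF assms] by simp
  then have "((\<lambda>h. \<psi> (x + h *\<^sub>R b)) has_derivative (\<lambda>h. frechet_derivative \<psi> (at x) (h *\<^sub>R b))) (at 0)"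
    by (rule has_derivative_compose[rotated]) (auto intro!: derivative_eq_intros)
  moreover have lin: "linear (frechet_derivative \<psi> (at x))"
    using test_function_has_derivative[OF assms] has_derivative_linear by blast
  have "(\<lambda>h. frechet_derivative \<psi> (at x) (h *\<^sub>R b)) = (*) (frechet_derivative \<psi> (at x) b)"
    by (rule ext) (simp add: linear_scale[OF lin])
  ultimately show ?thesis
    by (simp add: has_field_derivative_def)
qed

lemma integral_test_function_derivative_eq_0:
  assumes \<psi>: "test_function \<Omega> \<psi>"
  shows "integrable lebesgue (\<lambda>x. frechet_derivative \<psi> (at x) b)"
    "(LINT x|lebesgue. frechet_derivative \<psi> (at x) b) = 0"
proof -
  let ?d = "\<lambda>x. frechet_derivative \<psi> (at x) b"
  obtain K where K: "compact K" "\<And>x. x \<notin> K \<Longrightarrow> \<psi> x = 0"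
    using test_functionE[OF \<psi>] by metis
  obtain L where L: "\<And>x y. \<bar>\<psi> x - \<psi> y\<bar> \<le> L * norm (x - y)"
    using test_function_lipschitz[OF \<psi>] by metis
  have meas: "?d \<in> borel_measurable lebesgue"
    using borel_measurable_continuous_onI[OF test_function_continuous_on(2)[OF \<psi>]]
    by (intro measurable_completion) simp
  have "AE x in lebesgue. ((\<lambda>h. \<psi> (x + h *\<^sub>R b)) has_real_derivative ?d x) (at 0)"
    using test_function_line_derivative[OF \<psi>] by simp
  note * = integral_directional_derivative_eq_0[OF L K meas this]
  show "integrable lebesgue ?d" "(LINT x|lebesgue. ?d x) = 0"
    using * by blast+
qed

lemma set_lebesgue_integral_eq_UNIV:
  fixes f :: "'a::euclidean_space \<Rightarrow> 'b::{banach, second_countable_topology}"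
  assumes "\<And>x. x \<notin> S \<Longrightarrow> f x = 0"
  shows "(LINT x:S|M. f x) = (LINT x|M. f x)"
  unfolding set_lebesgue_integral_def
  by (intro Bochner_Integration.integral_cong) (use assms in \<open>auto simp: indicator_def\<close>)

lemma integrable_lebesgue_compact_support:
  fixes f :: "'a::euclidean_space \<Rightarrow> real"
  assumes "continuous_on UNIV f" "compact K" "\<And>x. x \<notin> K \<Longrightarrow> f x = 0"
  shows "integrable lebesgue f"
proof -
  have "integrable lborel (\<lambda>x. indicator K x *\<^sub>R f x)"
    using borel_integrable_compact[OF assms(2)] assms(1) continuous_on_subset by blast
  moreover have "(\<lambda>x. indicator K x *\<^sub>R f x) = f"
    using assms(3) by (auto simp: indicator_def fun_eq_iff)
  moreover have "f \<in> borel_measurable borel"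
    by (rule borel_measurable_continuous_onI[OF assms(1)])
  ultimately show ?thesis
    by (simp add: integrable_completion)
qed

lemma set_integrable_bounded:
  fixes f :: "'a \<Rightarrow> 'b::{banach, second_countable_topology}"
  assumes "C \<in> fmeasurable M" "f \<in> borel_measurable M" "\<And>x. x \<in> C \<Longrightarrow> norm (f x) \<le> B"
  shows "set_integrable M C f"
proof -
  have C: "C \<in> sets M" "emeasure M C < \<infinity>"
    using assms(1) by (auto simp: fmeasurable_def)
  have "integrable M (\<lambda>x. B * indicator C x :: real)"
    using C by (intro integrable_mult_right integrable_real_indicator)
  moreover have "(\<lambda>x. indicator C x *\<^sub>R f x) \<in> borel_measurable M"
    using C(1) assms(2) by measurable
  moreover have "AE x in M. norm (indicator C x *\<^sub>R f x) \<le> norm (B * indicator C x :: real)"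
    using assms(3) by (intro AE_I2) (fastforce simp: indicator_def)
  ultimately show ?thesis
    unfolding set_integrable_def by (rule Bochner_Integration.integrable_bound)
qed

section \<open>Uniqueness and locality of weak gradients\<close>

lemma integrable_times_compact_support:
  fixes f \<theta> :: "'a::euclidean_space \<Rightarrow> real"
  assumes "locally_integrable_on f \<Omega>" "compact K" "K \<subseteq> \<Omega>"
    and \<theta>: "continuous_on UNIV \<theta>" "\<And>x. x \<notin> K \<Longrightarrow> \<theta> x = 0"
  shows "integrable lebesgue (\<lambda>x. f x * \<theta> x)"
proof -
  have int: "integrable lebesgue (\<lambda>x. indicator K x *\<^sub>R f x)"
    using assms(1-3) by (auto simp: locally_integrable_on_def set_integrable_def)
  have eq: "(\<lambda>x. f x * \<theta> x) = (\<lambda>x. (indicator K x *\<^sub>R f x) * \<theta> x)"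
    using \<theta>(2) by (auto simp: indicator_def fun_eq_iff)
  obtain B where B: "\<And>x. x \<in> K \<Longrightarrow> \<bar>\<theta> x\<bar> \<le> B" "0 < B"
  proof -
    have "bounded (\<theta> ` K)"
      using \<theta>(1) by (intro compact_imp_bounded compact_continuous_image assms)
        (auto intro: continuous_on_subset)
    then show thesis using that by (auto simp: bounded_pos)
  qed
  have "\<theta> \<in> borel_measurable lebesgue"
    using borel_measurable_continuous_onI[OF \<theta>(1)] by (intro measurable_completion) simp
  then have "(\<lambda>x. (indicator K x *\<^sub>R f x) * \<theta> x) \<in> borel_measurable lebesgue"
    by (intro borel_measurable_times borel_measurable_integrable[OF int])
  moreover have "AE x in lebesgue. norm ((indicator K x *\<^sub>R f x) * \<theta> x) \<le> norm (B * (indicator K x *\<^sub>R f x))"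
  proof (intro AE_I2)
    fix x
    show "norm ((indicator K x *\<^sub>R f x) * \<theta> x) \<le> norm (B * (indicator K x *\<^sub>R f x))"
    proof (cases "x \<in> K")
      case True
      then have "\<bar>f x\<bar> * \<bar>\<theta> x\<bar> \<le> \<bar>f x\<bar> * B"
        using B by (intro mult_left_mono) auto
      then show ?thesis using True B(2) by (simp add: abs_mult mult.commute)
    qed simp
  qed
  ultimately show ?thesis
    unfolding eq
    by (rule Bochner_Integration.integrable_bound[OF integrable_mult_right[OF int, of B]])
qed

text \<open>The indicator of \<open>C\<close> is the bounded pointwise limit of cut-offs supported in shrinking neighbourhoods
  of \<open>C\<close>.\<close>

lemma integral_compact_eq_0_of_test_functions:
  fixes h :: "'a::euclidean_space \<Rightarrow> real"
  assumes V: "open V" and h: "locally_integrable_on h V"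
    and 0: "\<And>\<psi>. test_function V \<psi> \<Longrightarrow> (LINT x|lebesgue. h x * \<psi> x) = 0"
    and C: "compact C" "C \<subseteq> V"
  shows "(LINT x:C|lebesgue. h x) = 0"
proof (cases "C = {}")
  case False
  obtain \<psi>0 W where W: "test_function V \<psi>0" "open W" "C \<subseteq> W" "\<And>z. z \<in> W \<Longrightarrow> \<psi>0 z = 1"
    using smooth_cutoff[OF C(1) V C(2)] by metis
  obtain K where K: "compact K" "K \<subseteq> V" "\<And>x. x \<notin> K \<Longrightarrow> \<psi>0 x = 0"
    using test_functionE[OF W(1)] by metis
  have WK: "W \<subseteq> K"
    using W(4) K(3) by (metis subsetI zero_neq_one)
  \<comment> \<open>The neighbourhoods are kept inside \<open>W\<close>, hence inside the compact set \<open>K\<close>, which provides an integrable majorant.\<close>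
  define U where "U n = W \<inter> {x. infdist x C < 1 / real (Suc n)}" for n
  have "open {x. infdist x C < e}" for e
    by (intro open_Collect_less continuous_intros)
  then have U: "open (U n)" "C \<subseteq> U n" for n
    using W by (auto simp: U_def)
  have "\<exists>\<psi>. test_function (U n) \<psi> \<and> (\<forall>z. 0 \<le> \<psi> z \<and> \<psi> z \<le> 1) \<and> (\<forall>z\<in>C. \<psi> z = 1)" for n
    using smooth_cutoff[OF C(1) U[of n]] by (metis subsetD)
  then obtain \<psi> where \<psi>: "\<And>n. test_function (U n) (\<psi> n)" "\<And>n z. 0 \<le> \<psi> n z" "\<And>n z. \<psi> n z \<le> 1"
    "\<And>n z. z \<in> C \<Longrightarrow> \<psi> n z = 1"
    by metis
  have \<psi>0: "\<psi> n z = 0" if "z \<notin> U n" for n z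
    using \<psi>(1)[of n] that unfolding test_function_def by blast
  have int: "integrable lebesgue (\<lambda>x. indicator K x *\<^sub>R h x)"
    using h K by (auto simp: locally_integrable_on_def set_integrable_def)
  have \<psi>_test: "test_function V (\<psi> n)" for n
    by (rule test_function_mono[OF \<psi>(1)]) (use WK K in \<open>auto simp: U_def\<close>)
  have "(\<lambda>n. LINT x|lebesgue. (indicator K x *\<^sub>R h x) * \<psi> n x) \<longlonglongrightarrow> (LINT x|lebesgue. indicator C x *\<^sub>R h x)"
  proof (rule integral_dominated_convergence[where w = "\<lambda>x. norm (indicator K x *\<^sub>R h x)"])
    have "set_integrable lebesgue C h"
      using h C by (auto simp: locally_integrable_on_def)
    then show "(\<lambda>x. indicator C x *\<^sub>R h x) \<in> borel_measurable lebesgue"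
      unfolding set_integrable_def by (rule borel_measurable_integrable)
    show "(\<lambda>x. (indicator K x *\<^sub>R h x) * \<psi> n x) \<in> borel_measurable lebesgue" for n
      by (intro borel_measurable_times borel_measurable_integrable[OF int] measurable_completion)
         (use borel_measurable_continuous_onI[OF test_function_continuous_on(1)[OF \<psi>_test]] in simp)
    show "integrable lebesgue (\<lambda>x. norm (indicator K x *\<^sub>R h x))"
      by (rule integrable_norm[OF int])
    show "AE x in lebesgue. norm ((indicator K x *\<^sub>R h x) * \<psi> n x) \<le> norm (indicator K x *\<^sub>R h x)" for n
      using \<psi>(2,3) by (intro AE_I2) (simp add: abs_mult mult_left_le)
    show "AE x in lebesgue. (\<lambda>n. (indicator K x *\<^sub>R h x) * \<psi> n x) \<longlonglongrightarrow> indicator C x *\<^sub>R h x"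
    proof (rule AE_I2)
      fix x
      show "(\<lambda>n. (indicator K x *\<^sub>R h x) * \<psi> n x) \<longlonglongrightarrow> indicator C x *\<^sub>R h x"
      proof (cases "x \<in> C")
        case True
        then show ?thesis using \<psi>(4) W(3) WK by (auto simp: indicator_def)
      next
        case False
        then have "0 < infdist x C"
          using \<open>C \<noteq> {}\<close> C(1) by (simp add: compact_imp_closed infdist_pos_not_in_closed)
        moreover have "(\<lambda>n. 1 / real (Suc n)) \<longlonglongrightarrow> 0"
          by (rule LIMSEQ_Suc[OF lim_1_over_n])
        ultimately have "eventually (\<lambda>n. 1 / real (Suc n) < infdist x C) sequentially"
          by (rule order_tendstoD(2)[rotated])
        then have "eventually (\<lambda>n. (indicator K x *\<^sub>R h x) * \<psi> n x = indicator C x *\<^sub>R h x) sequentially"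
          by eventually_elim (use False \<psi>0 in \<open>auto simp: U_def\<close>)
        then show ?thesis by (rule tendsto_eventually)
      qed
    qed
  qed
  moreover have "(LINT x|lebesgue. (indicator K x *\<^sub>R h x) * \<psi> n x) = 0" for n
  proof -
    have "(\<lambda>x. (indicator K x *\<^sub>R h x) * \<psi> n x) = (\<lambda>x. h x * \<psi> n x)"
    proof
      fix x show "(indicator K x *\<^sub>R h x) * \<psi> n x = h x * \<psi> n x"
      proof (cases "x \<in> K")
        case False
        then have "\<psi> n x = 0" using WK by (intro \<psi>0) (auto simp: U_def)
        then show ?thesis by simp
      qed simp
    qed
    then show ?thesis using 0[OF \<psi>_test, of n] by (simp only:)
  qed
  ultimately have "(\<lambda>n. 0) \<longlonglongrightarrow> (LINT x|lebesgue. indicator C x *\<^sub>R h x)"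
    by (simp only:)
  then show ?thesis
    unfolding set_lebesgue_integral_def by (rule LIMSEQ_unique[OF _ tendsto_const])
qed (simp add: set_lebesgue_integral_def)

text \<open>A set of positive measure on which \<open>h\<close> is positive would contain, by inner regularity, a compact set of
  positive measure, and the integral over that set could not vanish.\<close>

lemma AE_le_0_of_compact_integrals:
  fixes h :: "'a::euclidean_space \<Rightarrow> real"
  assumes K: "compact K" and h: "set_integrable lebesgue K h"
    and 0: "\<And>C. compact C \<Longrightarrow> C \<subseteq> K \<Longrightarrow> (LINT x:C|lebesgue. h x) = 0"
  shows "AE x in lebesgue. x \<in> K \<longrightarrow> h x \<le> 0"
proof -
  define P where "P = {x. 0 < indicator K x *\<^sub>R h x}"
  have "(\<lambda>x. indicator K x *\<^sub>R h x) \<in> borel_measurable lebesgue"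
    using h unfolding set_integrable_def by (rule borel_measurable_integrable)
  then have P: "P \<in> sets lebesgue"
    unfolding P_def using borel_measurable_less[of "\<lambda>x. 0" lebesgue "\<lambda>x. indicator K x *\<^sub>R h x"] by simp
  have "x \<in> K \<and> 0 < h x" if "x \<in> P" for x
    using that by (cases "x \<in> K") (simp_all add: P_def)
  then have PK: "P \<subseteq> K" "\<And>x. x \<in> P \<Longrightarrow> 0 < h x"
    by blast+
  have null: "T \<in> null_sets lebesgue" if T: "closed T" "T \<subseteq> P" for T
  proof -
    have comp: "compact T"
      using T PK K by (metis compact_Int_closed inf.absorb_iff2 order_trans)
    have Tint: "integrable lebesgue (\<lambda>x. indicator T x *\<^sub>R h x)"
      using set_integrable_subset[OF h, of T] T PK(1) unfolding set_integrable_def by auto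
    have "(LINT x|lebesgue. indicator T x *\<^sub>R h x) = 0"
      using 0[OF comp] T PK(1) by (auto simp: set_lebesgue_integral_def)
    moreover have "AE x in lebesgue. 0 \<le> indicator T x *\<^sub>R h x"
      using PK(2) T(2) by (intro AE_I2) (auto simp: indicator_def intro: less_imp_le)
    ultimately have "AE x in lebesgue. indicator T x *\<^sub>R h x = 0"
      using integral_nonneg_eq_0_iff_AE[OF Tint] by simp
    then have "AE x in lebesgue. x \<notin> T"
      by eventually_elim (use PK(2) T(2) in \<open>fastforce simp: indicator_def\<close>)
    then show ?thesis
      using AE_iff_null_sets[of T lebesgue] T(1) by (simp add: lmeasurable_compact)
  qed
  have "negligible P"
    unfolding negligible_outer
  proof (intro allI impI)
    fix e :: real assume "0 < e"
    obtain T where T: "closed T" "T \<subseteq> P" "P - T \<in> lmeasurable" "emeasure lebesgue (P - T) < ennreal e"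
      using sets_lebesgue_inner_closed[OF P \<open>0 < e\<close>] by metis
    have "measure lebesgue (P - T) < e"
      using T(3,4) \<open>0 < e\<close> by (simp add: emeasure_eq_measure2 ennreal_less_iff)
    moreover have "measure lebesgue ((P - T) \<union> T) = measure lebesgue (P - T)"
      using T(3) null[OF T(1,2)] by (intro measure_Un_null_set) auto
    moreover have "(P - T) \<union> T \<in> lmeasurable"
      using T(3) null[OF T(1,2)] by (intro fmeasurable.Un) (auto simp: fmeasurableI_null_sets)
    ultimately show "\<exists>T. P \<subseteq> T \<and> T \<in> lmeasurable \<and> measure lebesgue T < e"
      by (intro exI[of _ "(P - T) \<union> T"]) auto
  qed
  then have "AE x in lebesgue. x \<notin> P"
    by (simp add: negligible_iff_null_sets AE_not_in)
  then show ?thesis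
    by eventually_elim (auto simp: P_def indicator_def)
qed

text \<open>The fundamental lemma of the calculus of variations.\<close>

lemma AE_eq_0_of_test_functions:
  fixes h :: "'a::euclidean_space \<Rightarrow> real"
  assumes V: "open V" and h: "locally_integrable_on h V"
    and 0: "\<And>\<psi>. test_function V \<psi> \<Longrightarrow> (LINT x|lebesgue. h x * \<psi> x) = 0"
  shows "AE x in lebesgue. x \<in> V \<longrightarrow> h x = 0"
proof -
  have comp: "AE x in lebesgue. x \<in> K \<longrightarrow> h x = 0" if K: "compact K" "K \<subseteq> V" for K
  proof -
    have hK: "set_integrable lebesgue K h"
      using h K by (simp add: locally_integrable_on_def)
    have zero: "(LINT x:C|lebesgue. h x) = 0" if "compact C" "C \<subseteq> K" for C
      using integral_compact_eq_0_of_test_functions[OF V h 0] that K by blast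
    have "AE x in lebesgue. x \<in> K \<longrightarrow> h x \<le> 0"
      by (rule AE_le_0_of_compact_integrals[OF K(1) hK zero])
    moreover have "AE x in lebesgue. x \<in> K \<longrightarrow> - h x \<le> 0"
    proof (rule AE_le_0_of_compact_integrals[OF K(1)])
      show "set_integrable lebesgue K (\<lambda>x. - h x)"
        using hK by (simp add: set_integrable_def)
      show "(LINT x:C|lebesgue. - h x) = 0" if "compact C" "C \<subseteq> K" for C
        using zero[OF that] by (simp add: set_lebesgue_integral_def)
    qed
    ultimately show ?thesis by eventually_elim auto
  qed
  obtain \<D> where D: "countable \<D>" "\<And>X. X \<in> \<D> \<Longrightarrow> \<exists>a b. X = cbox a b" "\<Union>\<D> = V"
    using open_countable_Union_open_cbox[OF V] by metis
  have "compact X \<and> X \<subseteq> V" if "X \<in> \<D>" for X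
    using D(2)[OF that] D(3) that by auto
  then have "AE x in lebesgue. \<forall>X\<in>\<D>. x \<in> X \<longrightarrow> h x = 0"
    using D(1) by (intro AE_ball_countable' comp) simp_all
  then show ?thesis
    by eventually_elim (use D(3) in blast)
qed

text \<open>The two functions may live on different domains and are compared only on \<open>V\<close>: a test function on \<open>V\<close> is a
  test function on both. The additive constant drops out because derivatives of test functions have integral zero.\<close>

lemma weak_gradient_locally_determined:
  fixes u v :: "'a::euclidean_space \<Rightarrow> real"
  assumes u: "has_weak_gradient \<Omega> u g" and v: "has_weak_gradient \<Omega>' v h"
    and V: "open V" "V \<subseteq> \<Omega>" "V \<subseteq> \<Omega>'"
    and uv: "\<And>x. x \<in> V \<Longrightarrow> u x = s * v x + c"
  shows "AE x in lebesgue. x \<in> V \<longrightarrow> g x = s *\<^sub>R h x"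
proof -
  have "AE x in lebesgue. x \<in> V \<longrightarrow> (g x - s *\<^sub>R h x) \<bullet> b = 0" if b: "b \<in> Basis" for b
  proof (rule AE_eq_0_of_test_functions[OF V(1)])
    have gl: "locally_integrable_on (\<lambda>x. g x \<bullet> b) V"
      unfolding locally_integrable_on_def
    proof (intro allI impI absolutely_integrable_component)
      show "g absolutely_integrable_on K" if "compact K \<and> K \<subseteq> V" for K
        using u V(2) that unfolding has_weak_gradient_def locally_integrable_on_def by blast
    qed
    have hl: "locally_integrable_on (\<lambda>x. h x \<bullet> b) V"
      unfolding locally_integrable_on_def
    proof (intro allI impI absolutely_integrable_component)
      show "h absolutely_integrable_on K" if "compact K \<and> K \<subseteq> V" for K
        using v V(3) that unfolding has_weak_gradient_def locally_integrable_on_def by blast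
    qed
    have ul: "locally_integrable_on u V" and vl: "locally_integrable_on v V"
      using u v V unfolding has_weak_gradient_def locally_integrable_on_def
      by (meson order_trans)+
    show "locally_integrable_on (\<lambda>x. (g x - s *\<^sub>R h x) \<bullet> b) V"
      using gl hl unfolding locally_integrable_on_def inner_diff_left inner_scaleR_left
      by (auto intro!: set_integral_diff)
    fix \<psi> assume \<psi>: "test_function V \<psi>"
    obtain K where K: "compact K" "K \<subseteq> V" "\<And>x. x \<notin> K \<Longrightarrow> \<psi> x = 0"
      "\<And>x v. x \<notin> K \<Longrightarrow> frechet_derivative \<psi> (at x) v = 0"
      using test_functionE[OF \<psi>] by metis
    let ?d = "\<lambda>x. frechet_derivative \<psi> (at x) b"
    have int: "integrable lebesgue (\<lambda>x. v x * ?d x)"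
      "integrable lebesgue (\<lambda>x. (g x \<bullet> b) * \<psi> x)" "integrable lebesgue (\<lambda>x. (h x \<bullet> b) * \<psi> x)"
      using K by (auto intro!: integrable_times_compact_support[OF _ K(1,2)] vl gl hl
          test_function_continuous_on[OF \<psi>])
    have off: "\<psi> x = 0" "?d x = 0" if "x \<notin> V" for x
      using K that by blast+
    have d0: "integrable lebesgue ?d" "(LINT x|lebesgue. ?d x) = 0"
      using integral_test_function_derivative_eq_0[OF \<psi>] by auto
    have "(LINT x:\<Omega>|lebesgue. u x * ?d x) = - (LINT x:\<Omega>|lebesgue. (g x \<bullet> b) * \<psi> x)"
      using u test_function_mono[OF \<psi> V(2)] b unfolding has_weak_gradient_def by blast
    moreover have "(LINT x:\<Omega>|lebesgue. u x * ?d x) = (LINT x|lebesgue. u x * ?d x)"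
      "(LINT x:\<Omega>|lebesgue. (g x \<bullet> b) * \<psi> x) = (LINT x|lebesgue. (g x \<bullet> b) * \<psi> x)"
      by (rule set_lebesgue_integral_eq_UNIV, use off V(2) in fastforce)+
    moreover have "(LINT x:\<Omega>'|lebesgue. v x * ?d x) = - (LINT x:\<Omega>'|lebesgue. (h x \<bullet> b) * \<psi> x)"
      using v test_function_mono[OF \<psi> V(3)] b unfolding has_weak_gradient_def by blast
    moreover have "(LINT x:\<Omega>'|lebesgue. v x * ?d x) = (LINT x|lebesgue. v x * ?d x)"
      "(LINT x:\<Omega>'|lebesgue. (h x \<bullet> b) * \<psi> x) = (LINT x|lebesgue. (h x \<bullet> b) * \<psi> x)"
      by (rule set_lebesgue_integral_eq_UNIV, use off V(3) in fastforce)+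
    moreover have "(LINT x|lebesgue. u x * ?d x) = s * (LINT x|lebesgue. v x * ?d x)"
    proof -
      have "u x * ?d x = s * (v x * ?d x) + c * ?d x" for x
        using uv[of x] off(2)[of x] by (cases "x \<in> V") (auto simp: algebra_simps)
      then have "(LINT x|lebesgue. u x * ?d x) = (LINT x|lebesgue. s * (v x * ?d x) + c * ?d x)"
        by simp
      also have "\<dots> = s * (LINT x|lebesgue. v x * ?d x) + c * (LINT x|lebesgue. ?d x)"
        using int(1) d0(1) by simp
      finally show ?thesis using d0(2) by simp
    qed
    moreover have "(LINT x|lebesgue. (g x - s *\<^sub>R h x) \<bullet> b * \<psi> x)
        = (LINT x|lebesgue. (g x \<bullet> b) * \<psi> x) - s * (LINT x|lebesgue. (h x \<bullet> b) * \<psi> x)"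
      using int by (simp add: inner_diff_left left_diff_distrib mult.assoc)
    ultimately show "(LINT x|lebesgue. (g x - s *\<^sub>R h x) \<bullet> b * \<psi> x) = 0"
      by simp
  qed
  then have "AE x in lebesgue. \<forall>b\<in>Basis. x \<in> V \<longrightarrow> (g x - s *\<^sub>R h x) \<bullet> b = 0"
    by (intro AE_finite_allI) auto
  then show ?thesis
    by eventually_elim (metis eq_iff_diff_eq_0 euclidean_all_zero_iff)
qed

section \<open>Plane waves in the homogeneous Sobolev space\<close>

text \<open>The product rule for a profile \<open>\<zeta>\<close> in one coordinate, with countably many kinks, times a test function. The
  kinks lie on countably many hyperplanes, which are negligible; the function \<open>\<zeta> (x \<bullet> i) * \<theta> x\<close> with
  \<open>\<theta> = \<eta> * \<psi>\<close> is globally Lipschitz even if \<open>\<zeta>\<close> is unbounded, because \<open>\<theta>\<close> has compact support.\<close>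

lemma has_weak_gradient_plane_wave:
  fixes \<eta> :: "'a::euclidean_space \<Rightarrow> real"
  assumes i: "i \<in> Basis" and \<eta>: "test_function \<Omega> \<eta>"
    and \<zeta>_lip: "\<And>s t. \<bar>\<zeta> s - \<zeta> t\<bar> \<le> \<bar>s - t\<bar>"
    and \<zeta>': "\<zeta>' \<in> borel_measurable borel" "\<And>t. \<bar>\<zeta>' t\<bar> \<le> 1"
    and N: "countable N" "\<And>t. t \<notin> N \<Longrightarrow> (\<zeta> has_real_derivative \<zeta>' t) (at t)"
  shows "has_weak_gradient \<Omega> (\<lambda>y. \<zeta> (y \<bullet> i) * \<eta> y)
    (\<lambda>y. (\<zeta>' (y \<bullet> i) * \<eta> y) *\<^sub>R i + \<zeta> (y \<bullet> i) *\<^sub>R classical_gradient \<eta> y)"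
    (is "has_weak_gradient \<Omega> ?f ?g")
proof -
  have \<zeta>_cont: "continuous_on UNIV \<zeta>"
    by (rule lipschitz_on_continuous_on[of 1], rule lipschitz_onI)
       (use \<zeta>_lip in \<open>auto simp: dist_real_def\<close>)
  have \<zeta>i_cont: "continuous_on S (\<lambda>y. \<zeta> (y \<bullet> i))" for S
    by (rule continuous_on_compose2[OF \<zeta>_cont]) (auto intro!: continuous_intros)
  obtain K where K: "compact K" "K \<subseteq> \<Omega>" "\<And>x. x \<notin> K \<Longrightarrow> \<eta> x = 0"
    "\<And>x v. x \<notin> K \<Longrightarrow> frechet_derivative \<eta> (at x) v = 0"
    using test_functionE[OF \<eta>] by metis
  have \<eta>_cont: "continuous_on S \<eta>" "continuous_on S (classical_gradient \<eta>)" for S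
    using test_function_continuous_on[OF \<eta>] continuous_on_classical_gradient[OF \<eta>] by auto
  have f_cont: "continuous_on S ?f" for S
    by (intro continuous_intros \<zeta>i_cont \<eta>_cont)
  have g_meas: "?g \<in> borel_measurable borel"
    using borel_measurable_continuous_onI[OF \<eta>_cont(1)] borel_measurable_continuous_onI[OF \<eta>_cont(2)]
      borel_measurable_continuous_onI[OF \<zeta>i_cont] \<zeta>'(1) by measurable
  have f_loc: "locally_integrable_on ?f \<Omega>"
    unfolding locally_integrable_on_def
  proof (intro allI impI)
    fix C assume "compact C \<and> C \<subseteq> \<Omega>"
    then have "integrable lborel (\<lambda>x. indicator C x *\<^sub>R ?f x)"
      using borel_integrable_compact f_cont by blast
    moreover have "(\<lambda>x. indicator C x *\<^sub>R ?f x) \<in> borel_measurable borel"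
      using borel_measurable_continuous_onI[OF f_cont] \<open>compact C \<and> C \<subseteq> \<Omega>\<close>
      by (intro borel_measurable_scaleR borel_measurable_indicator) (auto intro: borel_compact)
    ultimately show "?f absolutely_integrable_on C"
      unfolding set_integrable_def by (simp add: integrable_completion)
  qed
  have g_loc: "locally_integrable_on ?g \<Omega>"
    unfolding locally_integrable_on_def
  proof (intro allI impI)
    fix C assume C: "compact C \<and> C \<subseteq> \<Omega>"
    have "bounded ((\<lambda>y. \<bar>\<eta> y\<bar> + \<bar>\<zeta> (y \<bullet> i)\<bar> * norm (classical_gradient \<eta> y)) ` C)"
      using C by (intro compact_imp_bounded compact_continuous_image continuous_intros \<zeta>i_cont \<eta>_cont) auto
    then obtain B where B: "\<And>y. y \<in> C \<Longrightarrow> \<bar>\<eta> y\<bar> + \<bar>\<zeta> (y \<bullet> i)\<bar> * norm (classical_gradient \<eta> y) \<le> B"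
      by (force simp: bounded_iff)
    have "norm (?g y) \<le> B" if "y \<in> C" for y
    proof -
      have "norm (?g y) \<le> \<bar>\<zeta>' (y \<bullet> i)\<bar> * \<bar>\<eta> y\<bar> + \<bar>\<zeta> (y \<bullet> i)\<bar> * norm (classical_gradient \<eta> y)"
        using norm_triangle_ineq[of "(\<zeta>' (y \<bullet> i) * \<eta> y) *\<^sub>R i" "\<zeta> (y \<bullet> i) *\<^sub>R classical_gradient \<eta> y"] i by (simp add: abs_mult)
      also have "\<dots> \<le> \<bar>\<eta> y\<bar> + \<bar>\<zeta> (y \<bullet> i)\<bar> * norm (classical_gradient \<eta> y)"
        using \<zeta>'(2) by (simp add: mult_left_le_one_le)
      finally show ?thesis using B[OF that] by linarith
    qed
    moreover have "C \<in> lmeasurable"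
      using C lmeasurable_compact by blast
    ultimately show "?g absolutely_integrable_on C"
      using g_meas by (intro set_integrable_bounded[where B = B]) (auto intro: measurable_completion)
  qed
  have "(LINT x:\<Omega>|lebesgue. ?f x * frechet_derivative \<psi> (at x) b)
          = - (LINT x:\<Omega>|lebesgue. (?g x \<bullet> b) * \<psi> x)"
    if \<psi>: "test_function \<Omega> \<psi>" and b: "b \<in> Basis" for \<psi> b
  proof -
    define \<theta> where "\<theta> x = \<eta> x * \<psi> x" for x
    have \<theta>: "test_function \<Omega> \<theta>"
      unfolding \<theta>_def by (rule test_function_mult[OF \<eta> \<psi>])
    obtain L where L: "\<And>x y. \<bar>\<theta> x - \<theta> y\<bar> \<le> L * norm (x - y)" "0 \<le> L"
      using test_function_lipschitz[OF \<theta>] by metis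
    obtain T where T: "\<And>x. \<bar>\<theta> x\<bar> \<le> T" "0 \<le> T"
      using test_function_bounded[OF \<theta>] by metis
    have \<theta>0: "\<theta> x = 0" if "x \<notin> K" for x
      using K(3)[OF that] by (simp add: \<theta>_def)
    obtain P where P: "compact P" "P \<subseteq> \<Omega>" "\<And>x. x \<notin> P \<Longrightarrow> \<psi> x = 0"
      "\<And>x v. x \<notin> P \<Longrightarrow> frechet_derivative \<psi> (at x) v = 0"
      using test_functionE[OF \<psi>] by metis
    have "bounded ((\<lambda>y. \<zeta> (y \<bullet> i)) ` K)"
      by (intro compact_imp_bounded compact_continuous_image \<zeta>i_cont K)
    then obtain m where m: "\<And>y. y \<in> K \<Longrightarrow> \<bar>\<zeta> (y \<bullet> i)\<bar> \<le> m" "0 < m"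
      by (auto simp: bounded_pos)
    define F where "F x = \<zeta> (x \<bullet> i) * \<theta> x" for x
    define D where "D x = ?f x * frechet_derivative \<psi> (at x) b + (?g x \<bullet> b) * \<psi> x" for x
    have one_sided: "\<bar>F x - F y\<bar> \<le> (T + m * L) * norm (x - y)" if "x \<in> K" for x y
    proof -
      have "F x - F y = (\<zeta> (x \<bullet> i) - \<zeta> (y \<bullet> i)) * \<theta> y + \<zeta> (x \<bullet> i) * (\<theta> x - \<theta> y)"
        by (simp add: F_def algebra_simps)
      also have "\<bar>\<dots>\<bar> \<le> \<bar>\<zeta> (x \<bullet> i) - \<zeta> (y \<bullet> i)\<bar> * \<bar>\<theta> y\<bar> + \<bar>\<zeta> (x \<bullet> i)\<bar> * \<bar>\<theta> x - \<theta> y\<bar>"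
        by (metis abs_mult abs_triangle_ineq)
      also have "\<dots> \<le> norm (x - y) * T + m * (L * norm (x - y))"
      proof (intro add_mono mult_mono m that L T)
        have "\<bar>\<zeta> (x \<bullet> i) - \<zeta> (y \<bullet> i)\<bar> \<le> \<bar>(x - y) \<bullet> i\<bar>"
          using \<zeta>_lip by (simp add: inner_diff_left)
        also have "\<dots> \<le> norm (x - y)"
          using i by (rule Basis_le_norm)
        finally show "\<bar>\<zeta> (x \<bullet> i) - \<zeta> (y \<bullet> i)\<bar> \<le> norm (x - y)" .
      qed (use m in auto)
      finally show ?thesis by (simp add: algebra_simps)
    qed
    have F_lip: "\<bar>F x - F y\<bar> \<le> (T + m * L) * norm (x - y)" for x y
    proof -
      consider "x \<in> K" | "y \<in> K" | "x \<notin> K" "y \<notin> K" by blast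
      then show ?thesis
      proof cases
        case 2
        then show ?thesis using one_sided[of y x] by (simp add: abs_minus_commute norm_minus_commute)
      next
        case 3
        then show ?thesis using \<theta>0 m T L by (simp add: F_def)
      qed (rule one_sided)
    qed
    have F0: "F x = 0" if "x \<notin> K" for x
      using \<theta>0[OF that] by (simp add: F_def)
    have D_meas: "D \<in> borel_measurable lebesgue"
    proof -
      have "D \<in> borel_measurable borel"
        unfolding D_def
        by (intro borel_measurable_add borel_measurable_times borel_measurable_inner borel_measurable_const
            g_meas borel_measurable_continuous_onI f_cont
            test_function_continuous_on[OF \<psi>])
      then show ?thesis by (intro measurable_completion) simp
    qed
    have D_deriv: "((\<lambda>h. F (x + h *\<^sub>R b)) has_real_derivative D x) (at 0)" if "x \<bullet> i \<notin> N" for x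
    proof -
      have line: "((\<lambda>h. x + h *\<^sub>R b) has_derivative (\<lambda>h. h *\<^sub>R b)) (at 0)"
        by (auto intro!: derivative_eq_intros)
      have "((\<lambda>y. \<zeta> (y \<bullet> i)) has_derivative (\<lambda>v. \<zeta>' (x \<bullet> i) * (v \<bullet> i))) (at x)"
        using N(2)[OF that] unfolding has_field_derivative_def
        by (rule has_derivative_compose[rotated]) (auto intro!: derivative_eq_intros)
      then have "(F has_derivative (\<lambda>v. \<zeta> (x \<bullet> i) * (\<eta> x * frechet_derivative \<psi> (at x) v
          + frechet_derivative \<eta> (at x) v * \<psi> x) + \<zeta>' (x \<bullet> i) * (v \<bullet> i) * \<theta> x)) (at x)"
        unfolding F_def \<theta>_def
        by (intro has_derivative_mult test_function_has_derivative[OF \<psi>] test_function_has_derivative[OF \<eta>])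
      then have "(F has_derivative (\<lambda>v. \<zeta> (x \<bullet> i) * (\<eta> x * frechet_derivative \<psi> (at x) v
          + frechet_derivative \<eta> (at x) v * \<psi> x) + \<zeta>' (x \<bullet> i) * (v \<bullet> i) * \<theta> x)) (at (x + 0 *\<^sub>R b))"
        by simp
      from has_derivative_compose[OF line this]
      have "((\<lambda>h. F (x + h *\<^sub>R b)) has_derivative
          (\<lambda>h. \<zeta> (x \<bullet> i) * (\<eta> x * frechet_derivative \<psi> (at x) (h *\<^sub>R b)
          + frechet_derivative \<eta> (at x) (h *\<^sub>R b) * \<psi> x) + \<zeta>' (x \<bullet> i) * (h *\<^sub>R b \<bullet> i) * \<theta> x)) (at 0)" .
      moreover have "(\<lambda>h. \<zeta> (x \<bullet> i) * (\<eta> x * frechet_derivative \<psi> (at x) (h *\<^sub>R b)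
          + frechet_derivative \<eta> (at x) (h *\<^sub>R b) * \<psi> x) + \<zeta>' (x \<bullet> i) * (h *\<^sub>R b \<bullet> i) * \<theta> x) = (*) (D x)"
      proof
        fix h
        have l: "linear (frechet_derivative \<psi> (at x))" "linear (frechet_derivative \<eta> (at x))"
          using test_function_has_derivative[OF \<psi>] test_function_has_derivative[OF \<eta>]
            has_derivative_linear by blast+
        show "\<zeta> (x \<bullet> i) * (\<eta> x * frechet_derivative \<psi> (at x) (h *\<^sub>R b)
          + frechet_derivative \<eta> (at x) (h *\<^sub>R b) * \<psi> x) + \<zeta>' (x \<bullet> i) * (h *\<^sub>R b \<bullet> i) * \<theta> x = D x * h"
          by (simp add: D_def linear_scale[OF l(1)] linear_scale[OF l(2)] inner_add_left
              classical_gradient_inner[OF \<eta>] \<theta>_def inner_commute[of i b] algebra_simps)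
      qed
      ultimately show ?thesis
        by (simp add: has_field_derivative_def)
    qed
    have "AE x in lebesgue. x \<bullet> i \<notin> N"
    proof -
      have "negligible (\<Union>a\<in>N. {x. x \<bullet> i = a})"
        using N(1) negligible_standard_hyperplane[OF i] by (intro negligible_countable_Union) auto
      then have "(\<Union>a\<in>N. {x. x \<bullet> i = a}) \<in> null_sets lebesgue"
        by (simp add: negligible_iff_null_sets)
      then show ?thesis
        by (rule AE_I') auto
    qed
    then have D_AE: "AE x in lebesgue. ((\<lambda>h. F (x + h *\<^sub>R b)) has_real_derivative D x) (at 0)"
      by eventually_elim (rule D_deriv)
    have D_int: "integrable lebesgue D" "(LINT x|lebesgue. D x) = 0"
      using integral_directional_derivative_eq_0[OF F_lip K(1) F0 D_meas D_AE] by auto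
    have f_int: "integrable lebesgue (\<lambda>x. ?f x * frechet_derivative \<psi> (at x) b)"
      by (rule integrable_lebesgue_compact_support[OF _ P(1)])
         (auto intro!: continuous_intros \<zeta>i_cont \<eta>_cont test_function_continuous_on[OF \<psi>] simp: P)
    have g_int: "integrable lebesgue (\<lambda>x. (?g x \<bullet> b) * \<psi> x)"
      using Bochner_Integration.integrable_diff[OF D_int(1) f_int] by (simp add: D_def)
    have "(LINT x|lebesgue. ?f x * frechet_derivative \<psi> (at x) b) + (LINT x|lebesgue. (?g x \<bullet> b) * \<psi> x) = 0"
      using D_int(2) Bochner_Integration.integral_add[OF f_int g_int] by (simp add: D_def)
    moreover have "(LINT x:\<Omega>|lebesgue. ?f x * frechet_derivative \<psi> (at x) b)
        = (LINT x|lebesgue. ?f x * frechet_derivative \<psi> (at x) b)"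
      using P by (intro set_lebesgue_integral_eq_UNIV) auto
    moreover have "(LINT x:\<Omega>|lebesgue. (?g x \<bullet> b) * \<psi> x) = (LINT x|lebesgue. (?g x \<bullet> b) * \<psi> x)"
      using P by (intro set_lebesgue_integral_eq_UNIV) auto
    ultimately show ?thesis by linarith
  qed
  then show ?thesis
    unfolding has_weak_gradient_def using f_loc g_loc by blast
qed

lemma sobolev_capacity_empty: "sobolev_capacity p {} = 0"
proof -
  have "has_weak_gradient UNIV (\<lambda>_. 0) (\<lambda>_. 0)"
    by (simp add: has_weak_gradient_def locally_integrable_on_def)
  then have "sobolev_capacity p {} \<le> (\<integral>\<^sup>+ x. ennreal (\<bar>0\<bar> powr p + norm (0 :: 'a) powr p) \<partial>(lebesgue :: 'a measure))"
    unfolding sobolev_capacity_def by (intro INF_lower2[of "(\<lambda>_. 0, \<lambda>_. 0)"]) auto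
  then show ?thesis by simp
qed

text \<open>The exceptional open set can be taken empty.\<close>

lemma continuous_on_imp_quasicontinuous_on: "continuous_on \<Omega> f \<Longrightarrow> quasicontinuous_on p \<Omega> f"
  unfolding quasicontinuous_on_def
  by (intro allI impI exI[of _ "{}"]) (simp add: sobolev_capacity_empty)

lemma has_weak_gradient_weak_gradient:
  "has_weak_gradient \<Omega> f g \<Longrightarrow> has_weak_gradient \<Omega> f (weak_gradient \<Omega> f)"
  unfolding weak_gradient_def by (rule someI[where P = "has_weak_gradient \<Omega> f"])

text \<open>The seminorm is defined through a chosen weak gradient; by uniqueness that choice agrees almost everywhere
  with the explicit gradient \<open>g\<close>.\<close>

lemma L1p_of_bounded_weak_gradient:
  fixes f :: "'a::euclidean_space \<Rightarrow> real"
  assumes \<Omega>: "open \<Omega>" and p: "0 < p" and f: "continuous_on \<Omega> f" "has_weak_gradient \<Omega> f g"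
    and A: "A \<in> lmeasurable" and g: "g \<in> borel_measurable borel"
    "\<And>x. norm (g x) \<le> B" "\<And>x. x \<notin> A \<Longrightarrow> g x = 0"
  shows "f \<in> L1p p \<Omega>" "L1p_seminorm p \<Omega> f \<le> B * measure lebesgue A powr (1 / p)"
proof -
  let ?w = "weak_gradient \<Omega> f"
  have w: "has_weak_gradient \<Omega> f ?w"
    using f(2) by (rule has_weak_gradient_weak_gradient)
  have "AE x in lebesgue. x \<in> \<Omega> \<longrightarrow> ?w x = 1 *\<^sub>R g x"
    by (rule weak_gradient_locally_determined[OF w f(2) \<Omega>, where c = 0]) auto
  then have AE: "AE x in lebesgue. indicator \<Omega> x *\<^sub>R (norm (g x) powr p) = indicator \<Omega> x *\<^sub>R (norm (?w x) powr p)"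
    by eventually_elim (auto simp: indicator_def)
  have g_meas: "(\<lambda>x. indicator \<Omega> x *\<^sub>R (norm (g x) powr p)) \<in> borel_measurable lebesgue"
  proof (rule measurable_completion)
    have "\<Omega> \<in> sets borel" using \<Omega> by simp
    then show "(\<lambda>x. indicator \<Omega> x *\<^sub>R (norm (g x) powr p)) \<in> lborel \<rightarrow>\<^sub>M borel"
      using g(1) by measurable
  qed
  have w_meas: "(\<lambda>x. indicator \<Omega> x *\<^sub>R (norm (?w x) powr p)) \<in> borel_measurable lebesgue"
    by (rule borel_measurable_AE[OF g_meas AE])
  have B: "0 \<le> B"
    using g(2)[of 0] norm_ge_zero order_trans by blast
  have bound_int: "integrable lebesgue (\<lambda>x. B powr p * indicator A x :: real)"
    using A by (intro integrable_mult_right integrable_real_indicator) (auto simp: fmeasurable_def)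
  have bound: "norm (indicator \<Omega> x *\<^sub>R (norm (g x) powr p)) \<le> B powr p * indicator A x" for x
    using g(2)[of x] g(3)[of x] p by (auto simp: indicator_def intro: powr_mono2)
  have "integrable lebesgue (\<lambda>x. indicator \<Omega> x *\<^sub>R (norm (g x) powr p))"
    using bound by (intro Bochner_Integration.integrable_bound[OF bound_int g_meas] AE_I2) fastforce
  then have int: "integrable lebesgue (\<lambda>x. indicator \<Omega> x *\<^sub>R (norm (?w x) powr p))"
    and gint: "integrable lebesgue (\<lambda>x. indicator \<Omega> x *\<^sub>R (norm (g x) powr p))"
    using integrable_cong_AE[OF g_meas w_meas AE] by auto
  show "f \<in> L1p p \<Omega>"
    unfolding L1p_def using f int continuous_on_imp_quasicontinuous_on
    by (auto simp: set_integrable_def)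
  have "(LINT x:\<Omega>|lebesgue. norm (?w x) powr p) = (LINT x:\<Omega>|lebesgue. norm (g x) powr p)"
    unfolding set_lebesgue_integral_def by (rule integral_cong_AE[OF g_meas w_meas AE, symmetric])
  also have "\<dots> \<le> (LINT x|lebesgue. B powr p * indicator A x)"
    unfolding set_lebesgue_integral_def
    using bound by (intro integral_mono gint bound_int) (auto simp: abs_le_iff)
  also have "\<dots> = B powr p * measure lebesgue A"
    using A by (simp add: fmeasurable_def)
  finally have "(LINT x:\<Omega>|lebesgue. norm (?w x) powr p) powr (1 / p) \<le> (B powr p * measure lebesgue A) powr (1 / p)"
    using p by (intro powr_mono2) (auto simp: set_lebesgue_integral_def)
  also have "\<dots> = B * measure lebesgue A powr (1 / p)"
    using B p by (simp add: powr_mult powr_powr)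
  finally show "L1p_seminorm p \<Omega> f \<le> B * measure lebesgue A powr (1 / p)"
    by (simp add: L1p_seminorm_def)
qed

text \<open>The norm involves only the measure of the set \<open>A\<close> that carries \<open>\<eta>\<close>, so it is small for small \<open>A\<close>
  no matter how steep \<open>\<eta>\<close> is, as long as the profile is correspondingly small.\<close>

lemma plane_wave_L1p:
  fixes \<eta> :: "'a::euclidean_space \<Rightarrow> real"
  assumes \<Omega>: "open \<Omega>" and p: "0 < p" and A: "A \<subseteq> \<Omega>" "A \<in> lmeasurable" and \<eta>: "test_function A \<eta>"
    and i: "i \<in> Basis"
    and \<zeta>_lip: "\<And>s t. \<bar>\<zeta> s - \<zeta> t\<bar> \<le> \<bar>s - t\<bar>"
    and \<zeta>': "\<zeta>' \<in> borel_measurable borel" "\<And>t. \<bar>\<zeta>' t\<bar> \<le> 1"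
    and N: "countable N" "\<And>t. t \<notin> N \<Longrightarrow> (\<zeta> has_real_derivative \<zeta>' t) (at t)"
    and B: "\<And>y. \<bar>\<eta> y\<bar> + \<bar>\<zeta> (y \<bullet> i)\<bar> * norm (classical_gradient \<eta> y) \<le> B"
  shows "(\<lambda>y. \<zeta> (y \<bullet> i) * \<eta> y) \<in> L1p p \<Omega>"
    "L1p_seminorm p \<Omega> (\<lambda>y. \<zeta> (y \<bullet> i) * \<eta> y) \<le> B * measure lebesgue A powr (1 / p)"
proof -
  let ?f = "\<lambda>y. \<zeta> (y \<bullet> i) * \<eta> y"
  let ?g = "\<lambda>y. (\<zeta>' (y \<bullet> i) * \<eta> y) *\<^sub>R i + \<zeta> (y \<bullet> i) *\<^sub>R classical_gradient \<eta> y"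
  have \<eta>': "test_function \<Omega> \<eta>"
    by (rule test_function_mono[OF \<eta> A(1)])
  have f: "has_weak_gradient \<Omega> ?f ?g"
    by (rule has_weak_gradient_plane_wave[OF i \<eta>' \<zeta>_lip \<zeta>' N])
  have "continuous_on UNIV \<zeta>"
    by (rule lipschitz_on_continuous_on[of 1], rule lipschitz_onI)
       (use \<zeta>_lip in \<open>auto simp: dist_real_def\<close>)
  then have \<zeta>i_cont: "continuous_on S (\<lambda>y. \<zeta> (y \<bullet> i))" for S
    by (rule continuous_on_compose2) (auto intro!: continuous_intros)
  have cont: "continuous_on S ?f" for S
    by (intro continuous_intros \<zeta>i_cont test_function_continuous_on[OF \<eta>])
  have g_meas: "?g \<in> borel_measurable borel"
    using borel_measurable_continuous_onI[OF test_function_continuous_on(1)[OF \<eta>]]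
      borel_measurable_continuous_onI[OF continuous_on_classical_gradient[OF \<eta>]]
      borel_measurable_continuous_onI[OF \<zeta>i_cont] \<zeta>'(1) by measurable
  have g_bound: "norm (?g y) \<le> B" for y
  proof -
    have "norm (?g y) \<le> \<bar>\<zeta>' (y \<bullet> i)\<bar> * \<bar>\<eta> y\<bar> + \<bar>\<zeta> (y \<bullet> i)\<bar> * norm (classical_gradient \<eta> y)"
      using norm_triangle_ineq[of "(\<zeta>' (y \<bullet> i) * \<eta> y) *\<^sub>R i" "\<zeta> (y \<bullet> i) *\<^sub>R classical_gradient \<eta> y"] i
      by (simp add: abs_mult)
    also have "\<dots> \<le> \<bar>\<eta> y\<bar> + \<bar>\<zeta> (y \<bullet> i)\<bar> * norm (classical_gradient \<eta> y)"
      using \<zeta>'(2) by (simp add: mult_left_le_one_le)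
    finally show ?thesis using B[of y] by linarith
  qed
  have g_0: "?g y = 0" if "y \<notin> A" for y
  proof -
    obtain K where "K \<subseteq> A" "\<And>x. x \<notin> K \<Longrightarrow> \<eta> x = 0" "\<And>x v. x \<notin> K \<Longrightarrow> frechet_derivative \<eta> (at x) v = 0"
      using test_functionE[OF \<eta>] by metis
    moreover from this have "y \<notin> K" using that by blast
    ultimately show ?thesis by (simp add: classical_gradient_def)
  qed
  show "?f \<in> L1p p \<Omega>" "L1p_seminorm p \<Omega> ?f \<le> B * measure lebesgue A powr (1 / p)"
    using L1p_of_bounded_weak_gradient[OF \<Omega> p cont f A(2) g_meas g_bound g_0] by blast+
qed

section \<open>Morrey's inequality\<close>

lemma integral_UNIV_eq_integral:
  fixes f :: "'a::euclidean_space \<Rightarrow> real"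
  assumes "\<And>z. z \<notin> Q \<Longrightarrow> f z = 0"
  shows "integral UNIV f = integral Q f"
proof -
  have "(\<lambda>z. if z \<in> Q then f z else 0) = f"
    using assms by auto
  then show ?thesis
    using integral_restrict_UNIV[of Q f] by simp
qed

text \<open>The kernels below are all built from one fixed smooth step \<open>\<sigma>\<close> with derivative \<open>\<rho>\<close>, so that every
  constant in Morrey's inequality depends only on the dimension and on \<open>p\<close>.\<close>

locale smooth_step =
  fixes \<sigma> \<rho> :: "real \<Rightarrow> real"
  assumes Ck_\<sigma>: "\<And>k. Ck k \<sigma>" and Ck_\<rho>: "\<And>k. Ck k \<rho>"
    and \<sigma>_deriv: "\<And>t. (\<sigma> has_real_derivative \<rho> t) (at t)"
    and \<rho>_nonneg: "\<And>t. 0 \<le> \<rho> t" and \<rho>_0: "\<And>t. 1 \<le> \<bar>t\<bar> \<Longrightarrow> \<rho> t = 0" and \<rho>_pos: "0 < \<rho> 0"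
    and \<sigma>_0: "\<And>t. t \<le> -1 \<Longrightarrow> \<sigma> t = 0" and \<sigma>_1: "\<And>t. 1 \<le> t \<Longrightarrow> \<sigma> t = 1"
    and \<sigma>_ge_0: "\<And>t. 0 \<le> \<sigma> t" and \<sigma>_le_1: "\<And>t. \<sigma> t \<le> 1"
begin

text \<open>The arguments are written as \<open>1 / \<delta> * t + - c / \<delta>\<close> rather than \<open>(t - c) / \<delta>\<close> to match
  \<open>Ck_compose_affine_coordinate\<close>.\<close>

definition bump :: "real \<Rightarrow> real \<Rightarrow> real \<Rightarrow> real" where
  "bump c \<delta> t = 1 / \<delta> * \<rho> (1 / \<delta> * t + - c / \<delta>)"

definition step :: "real \<Rightarrow> real \<Rightarrow> real \<Rightarrow> real" where
  "step c \<delta> t = \<sigma> (1 / \<delta> * t + - c / \<delta>)"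

text \<open>Intermediate kernels in the passage from the product kernel at \<open>y\<close> with scale \<open>\<delta>\<close> to the one at \<open>y'\<close> with scale
  \<open>\<delta>'\<close>: the coordinates in \<open>A\<close> have already been exchanged.\<close>

definition mixed_kernel :: "'a set \<Rightarrow> 'a \<Rightarrow> real \<Rightarrow> 'a \<Rightarrow> real \<Rightarrow> 'a::euclidean_space \<Rightarrow> real" where
  "mixed_kernel A y \<delta> y' \<delta>' z =
     (\<Prod>i\<in>Basis. if i \<in> A then bump (y' \<bullet> i) \<delta>' (z \<bullet> i) else bump (y \<bullet> i) \<delta> (z \<bullet> i))"

definition product_kernel :: "'a \<Rightarrow> real \<Rightarrow> 'a::euclidean_space \<Rightarrow> real" where
  "product_kernel y \<delta> z = (\<Prod>i\<in>Basis. bump (y \<bullet> i) \<delta> (z \<bullet> i))"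

definition \<rho>_max :: real where
  "\<rho>_max = (SUP t. \<rho> t)"

lemma \<rho>_le_max: "\<rho> t \<le> \<rho>_max"
proof -
  have "bounded (\<rho> ` {-1..1})"
    by (intro compact_imp_bounded compact_continuous_image Ck_imp_continuous_on[OF Ck_\<rho>[of 0]]) auto
  then obtain B where B: "0 < B" "\<forall>t\<in>{-1..1}. \<bar>\<rho> t\<bar> \<le> B"
    unfolding bounded_pos by auto
  have "\<rho> t \<le> B" for t
  proof (cases "1 \<le> \<bar>t\<bar>")
    case False
    then have "t \<in> {-1..1}" by auto
    with B(2) have "\<bar>\<rho> t\<bar> \<le> B" ..
    then show ?thesis by simp
  qed (use B(1) \<rho>_0 in simp)
  then have "bdd_above (range \<rho>)" by (intro bdd_aboveI[of _ B]) auto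
  then show ?thesis unfolding \<rho>_max_def by (rule cSUP_upper[rotated]) simp
qed

lemma \<rho>_max_pos: "0 < \<rho>_max"
  using \<rho>_pos \<rho>_le_max[of 0] by linarith

lemma bump_nonneg: "0 < \<delta> \<Longrightarrow> 0 \<le> bump c \<delta> t"
  by (simp add: bump_def \<rho>_nonneg)

lemma bump_le: "0 < d \<Longrightarrow> d \<le> \<delta> \<Longrightarrow> bump c \<delta> t \<le> \<rho>_max / d"
  unfolding bump_def using \<rho>_le_max \<rho>_nonneg \<rho>_max_pos
  by (simp add: frac_le)

lemma bump_eq_0: "0 < \<delta> \<Longrightarrow> \<delta> \<le> \<bar>t - c\<bar> \<Longrightarrow> bump c \<delta> t = 0"
proof -
  assume *: "0 < \<delta>" "\<delta> \<le> \<bar>t - c\<bar>"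
  have "1 / \<delta> * t + - c / \<delta> = (t - c) / \<delta>" by (simp add: diff_divide_distrib)
  moreover have "1 \<le> \<bar>(t - c) / \<delta>\<bar>" using * by simp
  ultimately show "bump c \<delta> t = 0" by (simp add: bump_def \<rho>_0)
qed

lemma step_deriv: "(step c \<delta> has_real_derivative bump c \<delta> t) (at t)"
proof -
  have "((\<lambda>t. 1 / \<delta> * t + - c / \<delta>) has_real_derivative 1 / \<delta>) (at t)"
    by (rule DERIV_cong[OF DERIV_add[OF DERIV_cmult_Id DERIV_const]]) simp
  from DERIV_chain2[OF \<sigma>_deriv this] show ?thesis
    by (simp add: step_def[abs_def] bump_def mult.commute)
qed

lemma step_left: "0 < \<delta> \<Longrightarrow> t \<le> c - \<delta> \<Longrightarrow> step c \<delta> t = 0"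
proof -
  assume *: "0 < \<delta>" "t \<le> c - \<delta>"
  have "1 / \<delta> * t + - c / \<delta> = (t - c) / \<delta>" by (simp add: diff_divide_distrib)
  moreover have "(t - c) / \<delta> \<le> -1" using * by (simp add: divide_le_eq)
  ultimately show "step c \<delta> t = 0" by (simp add: step_def \<sigma>_0)
qed

lemma step_right: "0 < \<delta> \<Longrightarrow> c + \<delta> \<le> t \<Longrightarrow> step c \<delta> t = 1"
proof -
  assume *: "0 < \<delta>" "c + \<delta> \<le> t"
  have "1 / \<delta> * t + - c / \<delta> = (t - c) / \<delta>" by (simp add: diff_divide_distrib)
  moreover have "1 \<le> (t - c) / \<delta>" using * by (simp add: le_divide_eq)
  ultimately show "step c \<delta> t = 1" by (simp add: step_def \<sigma>_1)
qed

lemma Ck_bump: "Ck k (\<lambda>z. bump c \<delta> (z \<bullet> i))" for i :: "'a::euclidean_space"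
  unfolding bump_def by (intro Ck_mult Ck_const Ck_compose_affine_coordinate Ck_\<rho>)

lemma Ck_step: "Ck k (\<lambda>z. step c \<delta> (z \<bullet> i))" for i :: "'a::euclidean_space"
  unfolding step_def by (intro Ck_compose_affine_coordinate Ck_\<sigma>)

lemma continuous_on_mixed_kernel: "continuous_on S (mixed_kernel A y \<delta> y' \<delta>')"
proof -
  have "Ck 0 (mixed_kernel A y \<delta> y' \<delta>')"
    unfolding mixed_kernel_def
  proof (intro Ck_prod)
    fix i :: 'a
    show "Ck 0 (\<lambda>z. if i \<in> A then bump (y' \<bullet> i) \<delta>' (z \<bullet> i) else bump (y \<bullet> i) \<delta> (z \<bullet> i))"
      by (cases "i \<in> A") (simp_all only: if_True if_False Ck_bump)
  qed
  then show ?thesis by (rule Ck_imp_continuous_on)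
qed

lemma mixed_kernel_ends:
  "mixed_kernel {} y \<delta> y' \<delta>' = product_kernel y \<delta>"
  "mixed_kernel Basis y \<delta> y' \<delta>' = product_kernel y' \<delta>'"
  by (auto simp: mixed_kernel_def product_kernel_def fun_eq_iff intro!: prod.cong)

lemma continuous_on_product_kernel: "continuous_on S (product_kernel y \<delta>)"
  using continuous_on_mixed_kernel[of S "{}" y \<delta>] by (simp add: mixed_kernel_ends)

lemma product_kernel_nonneg: "0 < \<delta> \<Longrightarrow> 0 \<le> product_kernel y \<delta> z"
  by (auto simp: product_kernel_def intro!: prod_nonneg bump_nonneg)

text \<open>The primitive of the difference of two bumps in the coordinate \<open>j\<close> is the difference of two steps. It vanishes
  to the left of both bumps, where both steps are 0, and to the right, where both are 1; multiplied by the other bumps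
  it is the required test function. Its size is that of \<open>DIM('a) - 1\<close> bumps, one factor \<open>1 / d\<close> less than
  that of a kernel; this gain drives the chain argument.\<close>

lemma mixed_kernel_exchange:
  fixes y y' l w :: "'a::euclidean_space"
  assumes j: "j \<in> Basis" "j \<notin> A" and d: "0 < d" "d \<le> \<delta>" "d \<le> \<delta>'"
    and box: "\<And>i. i \<in> Basis \<Longrightarrow> l \<bullet> i \<le> y \<bullet> i - \<delta>" "\<And>i. i \<in> Basis \<Longrightarrow> y \<bullet> i + \<delta> \<le> w \<bullet> i"
      "\<And>i. i \<in> Basis \<Longrightarrow> l \<bullet> i \<le> y' \<bullet> i - \<delta>'" "\<And>i. i \<in> Basis \<Longrightarrow> y' \<bullet> i + \<delta>' \<le> w \<bullet> i"
  obtains \<psi> where "test_function UNIV \<psi>" "\<And>z. z \<notin> cbox l w \<Longrightarrow> \<psi> z = 0"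
    "\<And>z. \<bar>\<psi> z\<bar> \<le> (\<rho>_max / d) ^ (DIM('a) - 1)"
    "\<And>z. frechet_derivative \<psi> (at z) j
        = mixed_kernel (insert j A) y \<delta> y' \<delta>' z - mixed_kernel A y \<delta> y' \<delta>' z"
proof -
  have pos: "0 < \<delta>" "0 < \<delta>'" using d by auto
  define g where "g i z = (if i \<in> A then bump (y' \<bullet> i) \<delta>' (z \<bullet> i) else bump (y \<bullet> i) \<delta> (z \<bullet> i))" for i z
  define Q where "Q z = (\<Prod>i\<in>Basis - {j}. g i z)" for z
  define \<psi> where "\<psi> z = (step (y' \<bullet> j) \<delta>' (z \<bullet> j) - step (y \<bullet> j) \<delta> (z \<bullet> j)) * Q z" for z
  have g: "0 \<le> g i z" "g i z \<le> \<rho>_max / d" for i z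
    using d pos by (auto simp: g_def bump_nonneg bump_le)
  have Q: "0 \<le> Q z" "Q z \<le> (\<rho>_max / d) ^ (DIM('a) - 1)" for z
  proof -
    show "0 \<le> Q z" unfolding Q_def by (intro prod_nonneg) (simp add: g)
    have "Q z \<le> (\<Prod>i\<in>Basis - {j}. \<rho>_max / d)"
      unfolding Q_def by (intro prod_mono) (simp add: g)
    then show "Q z \<le> (\<rho>_max / d) ^ (DIM('a) - 1)"
      using j(1) by (simp add: card_Diff_singleton)
  qed
  have zero: "\<psi> z = 0" if out: "z \<notin> cbox l w" for z
  proof -
    obtain i where i: "i \<in> Basis" "z \<bullet> i < l \<bullet> i \<or> w \<bullet> i < z \<bullet> i"
      using out by (auto simp: mem_box not_le)
    show ?thesis
    proof (cases "i = j")
      case True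
      from i(2) show ?thesis
      proof
        assume "z \<bullet> i < l \<bullet> i"
        then have "z \<bullet> j \<le> y \<bullet> j - \<delta>" "z \<bullet> j \<le> y' \<bullet> j - \<delta>'"
          using True box(1,3)[of j] j(1) by auto
        then show ?thesis using pos by (simp add: \<psi>_def step_left)
      next
        assume "w \<bullet> i < z \<bullet> i"
        then have "y \<bullet> j + \<delta> \<le> z \<bullet> j" "y' \<bullet> j + \<delta>' \<le> z \<bullet> j"
          using True box(2,4)[of j] j(1) by auto
        then show ?thesis using pos by (simp add: \<psi>_def step_right)
      qed
    next
      case False
      have "\<delta> \<le> \<bar>z \<bullet> i - y \<bullet> i\<bar>" "\<delta>' \<le> \<bar>z \<bullet> i - y' \<bullet> i\<bar>"
        using i box[of i] by auto
      then have "g i z = 0"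
        using pos by (auto simp: g_def intro!: bump_eq_0)
      then have "Q z = 0"
        unfolding Q_def using i(1) False by (auto simp: prod_zero_iff)
      then show ?thesis by (simp add: \<psi>_def)
    qed
  qed
  have "Ck k (g i)" for k i
    unfolding g_def by (cases "i \<in> A") (simp_all only: if_True if_False Ck_bump)
  then have "Ck k \<psi>" for k
    unfolding \<psi>_def Q_def by (intro Ck_mult Ck_diff Ck_step Ck_prod)
  then have test: "test_function UNIV \<psi>"
    unfolding test_function_def using zero compact_cbox by blast
  show thesis
  proof (rule that[OF test zero])
    show "\<bar>\<psi> z\<bar> \<le> (\<rho>_max / d) ^ (DIM('a) - 1)" for z
    proof -
      have "\<bar>step (y' \<bullet> j) \<delta>' (z \<bullet> j) - step (y \<bullet> j) \<delta> (z \<bullet> j)\<bar> \<le> 1"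
        using \<sigma>_ge_0 \<sigma>_le_1 unfolding step_def by (smt (verit))
      then have "\<bar>\<psi> z\<bar> \<le> 1 * Q z"
        unfolding \<psi>_def abs_mult using Q(1)[of z] by (intro mult_mono) auto
      then show ?thesis using Q(2)[of z] by linarith
    qed
    show "frechet_derivative \<psi> (at z) j
        = mixed_kernel (insert j A) y \<delta> y' \<delta>' z - mixed_kernel A y \<delta> y' \<delta>' z" for z
    proof -
      \<comment> \<open>The remaining factors do not depend on the coordinate \<open>j\<close>, so along the line only the steps vary.\<close>
      have Qc: "Q (z + h *\<^sub>R j) = Q z" for h
        unfolding Q_def g_def using j(1)
        by (intro prod.cong) (auto simp: inner_add_left inner_not_same_Basis)
      have S: "((\<lambda>h. step c e ((z + h *\<^sub>R j) \<bullet> j)) has_real_derivative bump c e (z \<bullet> j)) (at 0)" for c e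
      proof -
        have "((\<lambda>h. (z + h *\<^sub>R j) \<bullet> j) has_real_derivative 1) (at 0)"
          using j(1) by (auto intro!: derivative_eq_intros simp: inner_add_left)
        moreover have "(step c e has_real_derivative bump c e (z \<bullet> j)) (at ((z + 0 *\<^sub>R j) \<bullet> j))"
          using step_deriv by simp
        ultimately show ?thesis
          using DERIV_chain2 by fastforce
      qed
      have "((\<lambda>h. \<psi> (z + h *\<^sub>R j)) has_real_derivative
          (bump (y' \<bullet> j) \<delta>' (z \<bullet> j) - bump (y \<bullet> j) \<delta> (z \<bullet> j)) * Q z) (at 0)"
        unfolding \<psi>_def Qc by (intro DERIV_cmult_right DERIV_diff S)
      then have "frechet_derivative \<psi> (at z) j = (bump (y' \<bullet> j) \<delta>' (z \<bullet> j) - bump (y \<bullet> j) \<delta> (z \<bullet> j)) * Q z"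
        using test_function_line_derivative[OF test] DERIV_unique by blast
      moreover have "mixed_kernel A y \<delta> y' \<delta>' z = bump (y \<bullet> j) \<delta> (z \<bullet> j) * Q z"
        unfolding mixed_kernel_def Q_def g_def using j by (subst prod.remove[of _ j]) auto
      moreover have "mixed_kernel (insert j A) y \<delta> y' \<delta>' z = bump (y' \<bullet> j) \<delta>' (z \<bullet> j) * Q z"
        unfolding mixed_kernel_def Q_def g_def using j by (subst prod.remove[of _ j]) (auto intro!: prod.cong)
      ultimately show ?thesis by (simp add: left_diff_distrib)
    qed
  qed
qed

lemma product_kernel_eq_0:
  assumes "0 < \<delta>" "\<And>i. i \<in> Basis \<Longrightarrow> l \<bullet> i \<le> y \<bullet> i - \<delta>" "\<And>i. i \<in> Basis \<Longrightarrow> y \<bullet> i + \<delta> \<le> w \<bullet> i"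
    "z \<notin> cbox l w"
  shows "product_kernel y \<delta> z = 0"
proof -
  obtain i where i: "i \<in> Basis" "z \<bullet> i < l \<bullet> i \<or> w \<bullet> i < z \<bullet> i"
    using assms(4) by (auto simp: mem_box not_le)
  then have "\<delta> \<le> \<bar>z \<bullet> i - y \<bullet> i\<bar>"
    using assms(2,3)[of i] by auto
  then have "bump (y \<bullet> i) \<delta> (z \<bullet> i) = 0"
    by (rule bump_eq_0[OF assms(1)])
  then show ?thesis
    unfolding product_kernel_def using i(1) by (auto simp: prod_zero_iff)
qed

text \<open>All coordinates are exchanged one after the other.\<close>

lemma product_kernel_change:
  fixes y y' l w :: "'a::euclidean_space" and u :: "'a \<Rightarrow> real" and E :: real
  assumes d: "0 < d" "d \<le> \<delta>" "d \<le> \<delta>'"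
    and box: "\<And>i. i \<in> Basis \<Longrightarrow> l \<bullet> i \<le> y \<bullet> i - \<delta>" "\<And>i. i \<in> Basis \<Longrightarrow> y \<bullet> i + \<delta> \<le> w \<bullet> i"
      "\<And>i. i \<in> Basis \<Longrightarrow> l \<bullet> i \<le> y' \<bullet> i - \<delta>'" "\<And>i. i \<in> Basis \<Longrightarrow> y' \<bullet> i + \<delta>' \<le> w \<bullet> i"
    and u: "continuous_on (cbox l w) u"
    and E: "\<And>\<psi> j. j \<in> Basis \<Longrightarrow> test_function UNIV \<psi> \<Longrightarrow> (\<And>z. z \<notin> cbox l w \<Longrightarrow> \<psi> z = 0) \<Longrightarrow>
       (\<And>z. \<bar>\<psi> z\<bar> \<le> (\<rho>_max / d) ^ (DIM('a) - 1)) \<Longrightarrow>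
       \<bar>integral (cbox l w) (\<lambda>z. u z * frechet_derivative \<psi> (at z) j)\<bar> \<le> E"
  shows "\<bar>integral UNIV (\<lambda>z. u z * product_kernel y' \<delta>' z) - integral UNIV (\<lambda>z. u z * product_kernel y \<delta> z)\<bar>
    \<le> real DIM('a) * E"
proof -
  have int: "(\<lambda>z. u z * mixed_kernel A y \<delta> y' \<delta>' z) integrable_on cbox l w" for A
    by (intro integrable_continuous continuous_intros u continuous_on_mixed_kernel)
  have "\<bar>integral (cbox l w) (\<lambda>z. u z * mixed_kernel A y \<delta> y' \<delta>' z)
      - integral (cbox l w) (\<lambda>z. u z * mixed_kernel {} y \<delta> y' \<delta>' z)\<bar> \<le> real (card A) * E" if "A \<subseteq> Basis" for A
  proof -
    have "finite A" using that finite_Basis finite_subset by blast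
    then show ?thesis using that
    proof (induction A rule: finite_induct)
      case (insert j A)
      then have j: "j \<in> Basis" "j \<notin> A" by auto
      obtain \<psi> where \<psi>: "test_function UNIV \<psi>" "\<And>z. z \<notin> cbox l w \<Longrightarrow> \<psi> z = 0"
        "\<And>z. \<bar>\<psi> z\<bar> \<le> (\<rho>_max / d) ^ (DIM('a) - 1)"
        "\<And>z. frechet_derivative \<psi> (at z) j
            = mixed_kernel (insert j A) y \<delta> y' \<delta>' z - mixed_kernel A y \<delta> y' \<delta>' z"
        using mixed_kernel_exchange[OF j d box] by metis
      have "integral (cbox l w) (\<lambda>z. u z * mixed_kernel (insert j A) y \<delta> y' \<delta>' z)
          - integral (cbox l w) (\<lambda>z. u z * mixed_kernel A y \<delta> y' \<delta>' z)
          = integral (cbox l w) (\<lambda>z. u z * frechet_derivative \<psi> (at z) j)"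
        by (subst Henstock_Kurzweil_Integration.integral_diff[OF int int, symmetric])
           (simp add: \<psi>(4) right_diff_distrib)
      moreover have "\<bar>integral (cbox l w) (\<lambda>z. u z * frechet_derivative \<psi> (at z) j)\<bar> \<le> E"
        by (rule E[OF j(1) \<psi>(1-3)])
      moreover have "real (card (insert j A)) * E = real (card A) * E + E"
        using insert.hyps by (simp add: algebra_simps)
      moreover have "A \<subseteq> Basis" using insert.prems by simp
      note insert.IH[OF this]
      ultimately show ?case by linarith
    qed simp
  qed
  from this[of Basis] have "\<bar>integral (cbox l w) (\<lambda>z. u z * product_kernel y' \<delta>' z)
      - integral (cbox l w) (\<lambda>z. u z * product_kernel y \<delta> z)\<bar> \<le> real DIM('a) * E"
    by (simp add: mixed_kernel_ends)
  moreover have "integral UNIV (\<lambda>z. u z * product_kernel y' \<delta>' z) = integral (cbox l w) (\<lambda>z. u z * product_kernel y' \<delta>' z)"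
    using product_kernel_eq_0[of \<delta>' l y' w] d box(3,4) by (intro integral_UNIV_eq_integral) auto
  moreover have "integral UNIV (\<lambda>z. u z * product_kernel y \<delta> z) = integral (cbox l w) (\<lambda>z. u z * product_kernel y \<delta> z)"
    using product_kernel_eq_0[of \<delta> l y w] d box(1,2) by (intro integral_UNIV_eq_integral) auto
  ultimately show ?thesis by simp
qed

text \<open>The kernels are not normalised. Their common mass need not be computed; it is enough that it is positive and does not
  depend on centre and scale.\<close>

definition kernel_mass :: "'a::euclidean_space itself \<Rightarrow> real" where
  "kernel_mass _ = integral UNIV (product_kernel (0::'a) 1)"

text \<open>Exchanging kernels against the constant function 1 costs nothing, since partial derivatives of test functions have
  integral zero. So all kernels have the same mass, without an appeal to Fubini's theorem.\<close>

lemma integral_product_kernel: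
  fixes y :: "'a::euclidean_space"
  assumes "0 < \<delta>"
  shows "integral UNIV (product_kernel y \<delta>) = kernel_mass TYPE('a)"
proof -
  define B where "B = (\<Sum>i\<in>Basis. \<bar>y \<bullet> i\<bar>) + \<delta> + 1"
  have "\<bar>y \<bullet> i\<bar> \<le> (\<Sum>i\<in>Basis. \<bar>y \<bullet> i\<bar>)" if "i \<in> Basis" for i
    by (rule member_le_sum[OF that]) auto
  moreover have "0 \<le> (\<Sum>i\<in>Basis. \<bar>y \<bullet> i\<bar>)" by (simp add: sum_nonneg)
  ultimately have B: "\<bar>y \<bullet> i\<bar> + \<delta> \<le> B" "1 \<le> B" if "i \<in> Basis" for i
    using that assms by (force simp: B_def)+
  have "\<bar>integral UNIV (\<lambda>z. 1 * product_kernel (0::'a) 1 z) - integral UNIV (\<lambda>z. 1 * product_kernel y \<delta> z)\<bar>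
      \<le> real DIM('a) * 0"
  proof (rule product_kernel_change[where d = "min 1 \<delta>" and l = "- B *\<^sub>R One :: 'a" and w = "B *\<^sub>R One" and u = "\<lambda>_. 1"])
    fix \<psi> :: "'a \<Rightarrow> real" and j :: 'a
    assume *: "j \<in> Basis" "test_function UNIV \<psi>" "\<And>z. z \<notin> cbox (- B *\<^sub>R One) (B *\<^sub>R One) \<Longrightarrow> \<psi> z = 0"
    let ?K = "cbox (- B *\<^sub>R One) (B *\<^sub>R One) :: 'a set"
    have t: "test_function ?K \<psi>"
      using *(2,3) compact_cbox unfolding test_function_def by blast
    have off: "frechet_derivative \<psi> (at z) j = 0" if "z \<notin> ?K" for z
      using test_functionE[OF t] that by (metis subsetD)
    have "integral UNIV (\<lambda>z. frechet_derivative \<psi> (at z) j) = 0"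
      using integral_lebesgue[OF integral_test_function_derivative_eq_0(1)[OF t]]
        integral_test_function_derivative_eq_0(2)[OF t] by simp
    then show "\<bar>integral ?K (\<lambda>z. 1 * frechet_derivative \<psi> (at z) j)\<bar> \<le> 0"
      using integral_UNIV_eq_integral[of ?K "\<lambda>z. frechet_derivative \<psi> (at z) j"] off by simp
  qed (use assms B in \<open>auto simp: abs_le_iff\<close>, (smt (verit) B)+)
  then show ?thesis by (simp add: kernel_mass_def)
qed

lemma kernel_mass_pos: "0 < kernel_mass TYPE('a::euclidean_space)"
proof -
  let ?K = "cbox (- One) One :: 'a set"
  let ?f = "product_kernel (0::'a) 1"
  have eq: "kernel_mass TYPE('a) = integral ?K ?f"
    unfolding kernel_mass_def
    using product_kernel_eq_0[of 1 "- One" 0 "One :: 'a"] by (intro integral_UNIV_eq_integral) auto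
  have int: "?f integrable_on ?K"
    by (intro integrable_continuous continuous_on_product_kernel)
  have "0 \<le> integral ?K ?f"
    by (intro Henstock_Kurzweil_Integration.integral_nonneg int product_kernel_nonneg) simp
  moreover have "integral ?K ?f \<noteq> 0"
  proof
    assume "integral ?K ?f = 0"
    then have "(?f has_integral 0) ?K" using int by (metis integrable_integral)
    then have "?f 0 = 0"
      by (rule has_integral_0_cbox_imp_0[OF continuous_on_product_kernel, rotated])
         (auto simp: product_kernel_nonneg box_ne_empty mem_box)
    then show False
      using \<rho>_pos by (simp add: product_kernel_def bump_def)
  qed
  ultimately show ?thesis using eq by linarith
qed

end

text \<open>A form of the bound \<open>\<parallel>\<nabla>u\<parallel> \<le> M\<close> for the \<open>L\<^sub>p\<close> norm over \<open>U\<close>: the weak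
  gradient is replaced by its pairings with test functions, estimated by Hoelder's inequality on the supporting box.
  Nothing but these pairings enters Morrey's inequality.\<close>

definition box_gradient_bound :: "real \<Rightarrow> 'a::euclidean_space set \<Rightarrow> ('a \<Rightarrow> real) \<Rightarrow> real \<Rightarrow> bool" where
  "box_gradient_bound p U u M \<longleftrightarrow>
     (\<forall>l w \<psi> S j. cbox l w \<subseteq> U \<longrightarrow> box l w \<noteq> {} \<longrightarrow> j \<in> Basis \<longrightarrow> test_function UNIV \<psi> \<longrightarrow>
        (\<forall>z. z \<notin> cbox l w \<longrightarrow> \<psi> z = 0) \<longrightarrow> (\<forall>z. \<bar>\<psi> z\<bar> \<le> S) \<longrightarrow>
        \<bar>integral (cbox l w) (\<lambda>z. u z * frechet_derivative \<psi> (at z) j)\<bar>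
          \<le> M * S * measure lebesgue (cbox l w) powr (1 - 1 / p))"

context smooth_step
begin

text \<open>The power of \<open>\<delta>\<close> comes from the size \<open>\<delta> powr (1 - n)\<close> of the test functions and the factor
  \<open>(\<delta> powr n) powr (1 - 1 / p)\<close> from the measure of the box, where \<open>n\<close> is the dimension.\<close>

lemma product_kernel_change_scaled:
  fixes u :: "'a::euclidean_space \<Rightarrow> real"
  assumes p: "0 < p" and M: "0 \<le> M" and u: "continuous_on U u" "box_gradient_bound p U u M"
    and \<delta>: "0 < \<delta>" and q: "0 < q" "q \<le> 1"
    and y': "norm (y' - y) \<le> \<delta>"
    and U: "cbox (y - (2 * \<delta>) *\<^sub>R One) (y + (2 * \<delta>) *\<^sub>R One) \<subseteq> U"
  shows "\<bar>integral UNIV (\<lambda>z. u z * product_kernel y' (q * \<delta>) z) - integral UNIV (\<lambda>z. u z * product_kernel y \<delta> z)\<bar>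
    \<le> real DIM('a) * (M * ((\<rho>_max / q) ^ (DIM('a) - 1) * 4 powr (real DIM('a) * (1 - 1 / p)) * \<delta> powr (1 - real DIM('a) / p)))"
proof (rule product_kernel_change[where d = "q * \<delta>" and l = "y - (2 * \<delta>) *\<^sub>R One"
      and w = "y + (2 * \<delta>) *\<^sub>R One"])
  let ?l = "y - (2 * \<delta>) *\<^sub>R One" and ?w = "y + (2 * \<delta>) *\<^sub>R One"
  let ?n = "real DIM('a)"
  have q\<delta>: "q * \<delta> \<le> \<delta>" using q \<delta> by simp
  then show "q * \<delta> \<le> \<delta>" .
  have i: "\<bar>y' \<bullet> i - y \<bullet> i\<bar> \<le> \<delta>" if "i \<in> Basis" for i
    using Basis_le_norm[OF that, of "y' - y"] y' by (simp add: inner_diff_left)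
  show "?l \<bullet> i \<le> y \<bullet> i - \<delta>" "y \<bullet> i + \<delta> \<le> ?w \<bullet> i" if "i \<in> Basis" for i
    using that \<delta> by (auto simp: inner_diff_left inner_add_left)
  show "?l \<bullet> i \<le> y' \<bullet> i - q * \<delta>" "y' \<bullet> i + q * \<delta> \<le> ?w \<bullet> i" if "i \<in> Basis" for i
    using i[OF that] that q\<delta> by (auto simp: inner_diff_left inner_add_left)
  show "continuous_on (cbox ?l ?w) u"
    using u(1) U continuous_on_subset by blast
  fix \<psi> :: "'a \<Rightarrow> real" and j :: 'a
  assume \<psi>: "j \<in> Basis" "test_function UNIV \<psi>" "\<And>z. z \<notin> cbox ?l ?w \<Longrightarrow> \<psi> z = 0"
    "\<And>z. \<bar>\<psi> z\<bar> \<le> (\<rho>_max / (q * \<delta>)) ^ (DIM('a) - 1)"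
  have ne: "box ?l ?w \<noteq> {}"
    using \<delta> by (auto simp: box_ne_empty inner_diff_left inner_add_left)
  have "measure lebesgue (cbox ?l ?w) = (\<Prod>i\<in>(Basis::'a set). ?w \<bullet> i - ?l \<bullet> i)"
    using \<delta> by (subst content_cbox[symmetric]) (auto simp: inner_diff_left inner_add_left)
  also have "\<dots> = (4 * \<delta>) ^ DIM('a)"
    by (simp add: inner_diff_left inner_add_left)
  finally have content: "measure lebesgue (cbox ?l ?w) = (4 * \<delta>) ^ DIM('a)" .
  have "\<bar>integral (cbox ?l ?w) (\<lambda>z. u z * frechet_derivative \<psi> (at z) j)\<bar>
      \<le> M * (\<rho>_max / (q * \<delta>)) ^ (DIM('a) - 1) * measure lebesgue (cbox ?l ?w) powr (1 - 1 / p)"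
    using u(2) U ne \<psi> unfolding box_gradient_bound_def by blast
  also have "\<dots> = M * ((\<rho>_max / q) ^ (DIM('a) - 1) * 4 powr (?n * (1 - 1 / p)) * \<delta> powr (1 - ?n / p))"
  proof -
    have 1: "(\<rho>_max / (q * \<delta>)) ^ (DIM('a) - 1) = (\<rho>_max / q) ^ (DIM('a) - 1) * \<delta> powr (1 - ?n)"
    proof -
      have "\<delta> ^ (DIM('a) - 1) = \<delta> powr (?n - 1)"
        using \<delta> by (simp add: powr_realpow[symmetric] of_nat_diff)
      moreover have "\<delta> powr (1 - ?n) = 1 / \<delta> powr (?n - 1)"
        using powr_minus_divide[of \<delta> "?n - 1"] by simp
      ultimately show ?thesis by (simp add: power_divide power_mult_distrib)
    qed
    have 2: "((4 * \<delta>) ^ DIM('a)) powr (1 - 1 / p) = 4 powr (?n * (1 - 1 / p)) * \<delta> powr (?n * (1 - 1 / p))"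
      using \<delta> by (simp add: powr_realpow[symmetric] powr_powr powr_mult)
    have "1 - ?n + ?n * (1 - 1 / p) = 1 - ?n / p"
      by (simp add: algebra_simps)
    then have 3: "\<delta> powr (1 - ?n) * \<delta> powr (?n * (1 - 1 / p)) = \<delta> powr (1 - ?n / p)"
      by (simp only: powr_add[symmetric])
    show ?thesis
      unfolding content 1 2 3[symmetric] by (simp add: mult_ac)
  qed
  finally show "\<bar>integral (cbox ?l ?w) (\<lambda>z. u z * frechet_derivative \<psi> (at z) j)\<bar>
    \<le> M * ((\<rho>_max / q) ^ (DIM('a) - 1) * 4 powr (?n * (1 - 1 / p)) * \<delta> powr (1 - ?n / p))" .
qed (use \<delta> q in auto)

lemma integral_product_kernel_near:
  fixes u :: "'a::euclidean_space \<Rightarrow> real"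
  assumes \<delta>: "0 < \<delta>" and K: "cbox (y - (2 * \<delta>) *\<^sub>R One) (y + (2 * \<delta>) *\<^sub>R One) \<subseteq> U"
    and u: "continuous_on U u" and close: "\<And>z. z \<in> U \<Longrightarrow> \<bar>u z - a\<bar> \<le> e"
  shows "\<bar>integral UNIV (\<lambda>z. u z * product_kernel y \<delta> z) - a * kernel_mass TYPE('a)\<bar>
    \<le> e * kernel_mass TYPE('a)"
proof -
  let ?K = "cbox (y - (2 * \<delta>) *\<^sub>R One) (y + (2 * \<delta>) *\<^sub>R One)"
  let ?k = "product_kernel y \<delta>"
  have off: "?k z = 0" if "z \<notin> ?K" for z
    using that \<delta> by (intro product_kernel_eq_0[of \<delta> _ y]) (auto simp: inner_diff_left inner_add_left)
  have uK: "continuous_on ?K u"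
    using u K continuous_on_subset by blast
  have int: "(\<lambda>z. u z * ?k z) integrable_on ?K" "(\<lambda>z. c * ?k z) integrable_on ?K" for c
    by (intro integrable_continuous continuous_intros continuous_on_product_kernel uK)+
  have mass: "integral ?K (\<lambda>z. c * ?k z) = c * kernel_mass TYPE('a)" for c
    using integral_UNIV_eq_integral[of ?K ?k] off integral_product_kernel[OF \<delta>, of y] by simp
  have "integral UNIV (\<lambda>z. u z * ?k z) - a * kernel_mass TYPE('a)
      = integral ?K (\<lambda>z. u z * ?k z) - integral ?K (\<lambda>z. a * ?k z)"
  proof -
    have "integral UNIV (\<lambda>z. u z * ?k z) = integral ?K (\<lambda>z. u z * ?k z)"
      by (intro integral_UNIV_eq_integral) (simp add: off)
    then show ?thesis by (simp only: mass)
  qed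
  also have "\<dots> = integral ?K (\<lambda>z. u z * ?k z - a * ?k z)"
    by (rule Henstock_Kurzweil_Integration.integral_diff[OF int, symmetric])
  finally have "norm (integral UNIV (\<lambda>z. u z * ?k z) - a * kernel_mass TYPE('a))
      = norm (integral ?K (\<lambda>z. u z * ?k z - a * ?k z))" by simp
  also have "\<dots> \<le> integral ?K (\<lambda>z. e * ?k z)"
  proof (rule integral_norm_bound_integral)
    show "(\<lambda>z. u z * ?k z - a * ?k z) integrable_on ?K"
      by (intro integrable_diff int)
    show "norm (u z * ?k z - a * ?k z) \<le> e * ?k z" if "z \<in> ?K" for z
    proof -
      have "norm (u z * ?k z - a * ?k z) = \<bar>u z - a\<bar> * ?k z"
        using product_kernel_nonneg[OF \<delta>, of y z] by (simp add: left_diff_distrib[symmetric] abs_mult)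
      also have "\<dots> \<le> e * ?k z"
        using close K that product_kernel_nonneg[OF \<delta>] by (intro mult_right_mono) auto
      finally show ?thesis .
    qed
  qed (rule int)
  finally show ?thesis by (simp only: mass real_norm_def)
qed

text \<open>The centres \<open>x0 + (1 - q ^ k) *\<^sub>R (y - x0)\<close> move from \<open>x0\<close> to \<open>y\<close> while the scales \<open>c * r * q ^ k\<close> shrink. The
  distance of the \<open>k\<close>-th centre from the sphere is at least \<open>q ^ k * r\<close>, also when \<open>y\<close> lies on the sphere;
  \<open>c = 1 / (4 * n)\<close> makes the box of half side \<open>2 * c * r * q ^ k\<close> fit into the ball, and \<open>q = 1 - c\<close> makes each
  step of the centre no longer than the current scale.\<close>

lemma kernel_chain:
  fixes u :: "'a::euclidean_space \<Rightarrow> real"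
  defines "n \<equiv> real DIM('a)"
  defines "c \<equiv> 1 / (4 * n)"
  defines "q \<equiv> 1 - c"
  assumes p: "n < p" and r: "0 < r" and y: "y \<in> cball x0 r"
    and u: "continuous_on (cball x0 r) u" and M: "0 \<le> M" "box_gradient_bound p (ball x0 r) u M"
  shows "\<bar>u y * kernel_mass TYPE('a) - integral UNIV (\<lambda>z. u z * product_kernel x0 (c * r) z)\<bar>
    \<le> n * ((\<rho>_max / q) ^ (DIM('a) - 1) * 4 powr (n * (1 - 1 / p))) * c powr (1 - n / p) / (1 - q powr (1 - n / p))
        * M * r powr (1 - n / p)"
proof -
  define \<alpha> where "\<alpha> = 1 - n / p"
  define D where "D = n * ((\<rho>_max / q) ^ (DIM('a) - 1) * 4 powr (n * (1 - 1 / p)))"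
  have n: "1 \<le> n" by (simp add: n_def DIM_positive Suc_leI)
  have c: "0 < c" "c \<le> 1 / 4" using n by (auto simp: c_def field_simps)
  have q: "0 < q" "q < 1" "1 - q = c" using c by (auto simp: q_def)
  have \<alpha>: "0 < \<alpha>" using n p by (auto simp: \<alpha>_def field_simps)
  have q\<alpha>: "0 < q powr \<alpha>" "q powr \<alpha> < 1"
    using q \<alpha> powr_less_mono2[of \<alpha> q 1] by auto
  have D: "0 \<le> D" using n q \<rho>_max_pos by (auto simp: D_def)
  define c' where "c' k = x0 + (1 - q ^ k) *\<^sub>R (y - x0)" for k :: nat
  define \<delta> where "\<delta> k = c * r * q ^ k" for k :: nat
  define T where "T k = integral UNIV (\<lambda>z. u z * product_kernel (c' k) (\<delta> k) z)" for k
  have \<delta>: "0 < \<delta> k" for k using c r q by (simp add: \<delta>_def)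
  have yx: "norm (y - x0) \<le> r"
    using y by (simp add: dist_norm norm_minus_commute)
  have qk: "0 < q ^ k" "q ^ k \<le> 1" for k
    using q by (auto simp: power_le_one)
  let ?Q = "\<lambda>k. cbox (c' k - (2 * \<delta> k) *\<^sub>R One) (c' k + (2 * \<delta> k) *\<^sub>R One)"
  have near: "norm (z - c' k) \<le> q ^ k * r / 2" if "z \<in> ?Q k" for z k
  proof -
    have "norm (z - c' k) \<le> (\<Sum>i\<in>Basis. \<bar>(z - c' k) \<bullet> i\<bar>)"
      by (rule norm_le_l1)
    also have "\<dots> \<le> (\<Sum>i\<in>(Basis::'a set). 2 * \<delta> k)"
      using that by (intro sum_mono) (fastforce simp: mem_box inner_diff_left inner_add_left abs_le_iff)
    also have "\<dots> = q ^ k * r / 2"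
      using n by (simp add: \<delta>_def c_def n_def)
    finally show ?thesis .
  qed
  have sub: "?Q k \<subseteq> ball x0 r" for k
  proof
    fix z assume "z \<in> ?Q k"
    have "norm (z - x0) \<le> norm (z - c' k) + norm (c' k - x0)"
      using norm_triangle_ineq[of "z - c' k" "c' k - x0"] by simp
    also have "norm (c' k - x0) \<le> (1 - q ^ k) * r"
      using qk[of k] yx by (simp add: c'_def mult_left_mono)
    also have "norm (z - c' k) + (1 - q ^ k) * r < r"
      unfolding left_diff_distrib
      using near[OF \<open>z \<in> ?Q k\<close>] mult_pos_pos[OF qk(1)[of k] r] by linarith
    finally show "z \<in> ball x0 r" by (simp add: dist_norm norm_minus_commute)
  qed
  have step: "\<bar>T (Suc k) - T k\<bar> \<le> D * M * (c * r) powr \<alpha> * (q powr \<alpha>) ^ k" for k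
  proof -
    have eq: "\<delta> (Suc k) = q * \<delta> k" by (simp add: \<delta>_def)
    have close: "norm (c' (Suc k) - c' k) \<le> \<delta> k"
    proof -
      have "c' (Suc k) - c' k = (c * q ^ k) *\<^sub>R (y - x0)"
      proof -
        have "c' (Suc k) - c' k = ((1 - q ^ Suc k) - (1 - q ^ k)) *\<^sub>R (y - x0)"
          by (simp only: c'_def scaleR_left_diff_distrib add_diff_cancel_left)
        also have "(1 - q ^ Suc k) - (1 - q ^ k) = c * q ^ k"
          unfolding q(3)[symmetric] by (simp add: left_diff_distrib)
        finally show ?thesis .
      qed
      then have "norm (c' (Suc k) - c' k) = c * q ^ k * norm (y - x0)"
        using c qk[of k] by simp
      also have "\<dots> \<le> c * q ^ k * r"
        using c qk[of k] yx by (intro mult_left_mono) auto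
      finally show ?thesis by (simp add: \<delta>_def mult_ac)
    qed
    have cont: "continuous_on (ball x0 r) u"
      using ball_subset_cball by (rule continuous_on_subset[OF u])
    have "0 < p" using n p by linarith
    then have "\<bar>T (Suc k) - T k\<bar> \<le> real DIM('a) * (M * ((\<rho>_max / q) ^ (DIM('a) - 1)
        * 4 powr (real DIM('a) * (1 - 1 / p)) * \<delta> k powr (1 - real DIM('a) / p)))"
      unfolding T_def eq
      by (rule product_kernel_change_scaled[OF _ M(1) cont M(2) \<delta> q(1) less_imp_le[OF q(2)] close sub])
    also have "\<dots> = D * M * \<delta> k powr \<alpha>"
      by (simp add: D_def n_def \<alpha>_def mult_ac)
    also have "\<delta> k powr \<alpha> = (c * r) powr \<alpha> * (q powr \<alpha>) ^ k"
    proof -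
      have "(q ^ k) powr \<alpha> = (q powr \<alpha>) ^ k"
        by (simp only: powr_realpow[OF q(1), symmetric] powr_realpow[OF q\<alpha>(1), symmetric]
            powr_powr mult.commute)
      then show ?thesis
        using c r qk(1)[of k] by (simp only: \<delta>_def powr_mult)
    qed
    finally show ?thesis by (simp add: mult_ac)
  qed
  let ?G = "D * M * (c * r) powr \<alpha> / (1 - q powr \<alpha>)"
  have total: "\<bar>T k - T 0\<bar> \<le> ?G" for k
  proof -
    have "T k - T 0 = (\<Sum>i<k. T (Suc i) - T i)"
      by (simp add: sum_lessThan_telescope)
    also have "\<bar>\<dots>\<bar> \<le> (\<Sum>i<k. \<bar>T (Suc i) - T i\<bar>)"
      by (rule sum_abs)
    also have "\<dots> \<le> (\<Sum>i<k. D * M * (c * r) powr \<alpha> * (q powr \<alpha>) ^ i)"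
      by (intro sum_mono step)
    also have "\<dots> = D * M * (c * r) powr \<alpha> * (\<Sum>i<k. (q powr \<alpha>) ^ i)"
      by (simp add: sum_distrib_left)
    also have "\<dots> \<le> D * M * (c * r) powr \<alpha> * (1 / (1 - q powr \<alpha>))"
    proof (intro mult_left_mono)
      have "(\<Sum>i<k. (q powr \<alpha>) ^ i) = (1 - (q powr \<alpha>) ^ k) / (1 - q powr \<alpha>)"
        using q\<alpha> by (simp add: sum_gp_strict)
      also have "\<dots> \<le> 1 / (1 - q powr \<alpha>)"
        using q\<alpha> by (intro divide_right_mono) auto
      finally show "(\<Sum>i<k. (q powr \<alpha>) ^ i) \<le> 1 / (1 - q powr \<alpha>)" .
    qed (use D M in auto)
    finally show ?thesis by simp
  qed
  have "T \<longlonglongrightarrow> u y * kernel_mass TYPE('a)"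
  proof (rule LIMSEQ_I)
    fix e :: real assume "0 < e"
    define e' where "e' = e / (2 * kernel_mass TYPE('a))"
    have mass: "0 < kernel_mass TYPE('a)" by (rule kernel_mass_pos)
    have e': "0 < e'" using \<open>0 < e\<close> mass by (simp add: e'_def)
    obtain d where d: "0 < d" "\<And>z. z \<in> cball x0 r \<Longrightarrow> dist z y < d \<Longrightarrow> dist (u z) (u y) < e'"
      using u y e' unfolding continuous_on_iff by blast
    obtain N where N: "q ^ N < d / (2 * r)"
      using real_arch_pow_inv[of "d / (2 * r)" q] d r q by auto
    have "norm (T k - u y * kernel_mass TYPE('a)) < e" if "k \<ge> N" for k
    proof -
      have "q ^ k \<le> q ^ N"
        using that q by (intro power_decreasing) auto
      then have "q ^ k < d / (2 * r)" using N by linarith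
      then have qd: "q ^ k * (2 * r) < d"
        using r by (simp add: pos_less_divide_eq)
      have "\<bar>u z - u y\<bar> \<le> e'" if z: "z \<in> ?Q k" for z
      proof -
        have "z \<in> cball x0 r"
          using sub[of k] z ball_subset_cball by blast
        moreover have "dist z y < d"
        proof -
          have "norm (c' k - y) = q ^ k * norm (y - x0)"
          proof -
            have "c' k - y = (- (q ^ k)) *\<^sub>R (y - x0)"
              by (simp add: c'_def algebra_simps)
            then show ?thesis using qk[of k] by simp
          qed
          also have "\<dots> \<le> q ^ k * r"
            using qk[of k] yx by (intro mult_left_mono) auto
          finally have "norm (c' k - y) \<le> q ^ k * r" .
          moreover have "norm (z - y) \<le> norm (z - c' k) + norm (c' k - y)"
            using norm_triangle_ineq[of "z - c' k" "c' k - y"] by simp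
          ultimately have "norm (z - y) \<le> q ^ k * r / 2 + q ^ k * r"
            using near[OF z] by linarith
          then have "norm (z - y) < d"
            using qd mult_pos_pos[OF qk(1)[of k] r] by linarith
          then show ?thesis
            by (simp add: dist_norm)
        qed
        ultimately show ?thesis using d(2)[of z] by (simp add: dist_real_def)
      qed
      then have "\<bar>T k - u y * kernel_mass TYPE('a)\<bar> \<le> e' * kernel_mass TYPE('a)"
        unfolding T_def
        by (rule integral_product_kernel_near[OF \<delta> order_refl
            continuous_on_subset[OF u order_trans[OF sub ball_subset_cball]]])
      also have "\<dots> < e"
        using \<open>0 < e\<close> mass by (simp add: e'_def)
      finally show ?thesis by simp
    qed
    then show "\<exists>N. \<forall>k\<ge>N. norm (T k - u y * kernel_mass TYPE('a)) < e" by blast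
  qed
  then have "(\<lambda>k. \<bar>T k - T 0\<bar>) \<longlonglongrightarrow> \<bar>u y * kernel_mass TYPE('a) - T 0\<bar>"
    by (intro tendsto_intros)
  then have "\<bar>u y * kernel_mass TYPE('a) - T 0\<bar> \<le> ?G"
    using total by (intro LIMSEQ_le_const2) auto
  moreover have "T 0 = integral UNIV (\<lambda>z. u z * product_kernel x0 (c * r) z)"
    by (simp add: T_def c'_def \<delta>_def)
  moreover have "?G = D * c powr \<alpha> / (1 - q powr \<alpha>) * M * r powr \<alpha>"
  proof -
    have "(c * r) powr \<alpha> = c powr \<alpha> * r powr \<alpha>"
      using c r by (simp add: powr_mult)
    then show ?thesis by (simp add: mult_ac)
  qed
  ultimately have "\<bar>u y * kernel_mass TYPE('a) - integral UNIV (\<lambda>z. u z * product_kernel x0 (c * r) z)\<bar>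
      \<le> D * c powr \<alpha> / (1 - q powr \<alpha>) * M * r powr \<alpha>"
    by (simp only:)
  then show ?thesis
    unfolding D_def \<alpha>_def .
qed

end

text \<open>All chains starting at \<open>x0\<close> begin with the same average, so the estimates for \<open>y\<close> and for \<open>x0\<close> itself can be
  subtracted.\<close>

theorem morrey_inequality:
  assumes p: "real DIM('a::euclidean_space) < p"
  obtains C where "0 \<le> C"
    "\<And>(u :: 'a \<Rightarrow> real) x0 r y M. 0 < r \<Longrightarrow> y \<in> cball x0 r \<Longrightarrow> continuous_on (cball x0 r) u \<Longrightarrow> 0 \<le> M \<Longrightarrow>
       box_gradient_bound p (ball x0 r) u M \<Longrightarrow> \<bar>u y - u x0\<bar> \<le> C * M * r powr (1 - real DIM('a) / p)"
proof -
  obtain \<sigma> \<rho> where "smooth_step \<sigma> \<rho>"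
    by (rule smooth_step_exists) (auto simp: smooth_step_def)
  then interpret smooth_step \<sigma> \<rho> .
  let ?n = "real DIM('a)" and ?J = "kernel_mass TYPE('a)"
  define c where "c = 1 / (4 * ?n)"
  define q where "q = 1 - c"
  define E where "E = ?n * ((\<rho>_max / q) ^ (DIM('a) - 1) * 4 powr (?n * (1 - 1 / p))) * c powr (1 - ?n / p) / (1 - q powr (1 - ?n / p))"
  have J: "0 < ?J" by (rule kernel_mass_pos)
  show thesis
  proof (rule that[of "\<bar>2 * E / ?J\<bar>"])
    fix u :: "'a \<Rightarrow> real" and x0 y :: 'a and r M :: real
    assume *: "0 < r" "y \<in> cball x0 r" "continuous_on (cball x0 r) u" "0 \<le> M"
      "box_gradient_bound p (ball x0 r) u M"
    have chain: "\<bar>u z * ?J - integral UNIV (\<lambda>z. u z * product_kernel x0 (c * r) z)\<bar> \<le> E * M * r powr (1 - ?n / p)"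
      if "z \<in> cball x0 r" for z
      unfolding E_def q_def c_def by (rule kernel_chain[OF p *(1) that *(3-5)])
    have "x0 \<in> cball x0 r" using *(1) by simp
    from chain[OF this] chain[OF *(2)] have "\<bar>u y * ?J - u x0 * ?J\<bar> \<le> 2 * (E * M * r powr (1 - ?n / p))"
      by linarith
    also have "\<bar>u y * ?J - u x0 * ?J\<bar> = \<bar>u y - u x0\<bar> * ?J"
      using J by (simp add: left_diff_distrib[symmetric] abs_mult)
    finally have "\<bar>u y - u x0\<bar> \<le> 2 * E / ?J * M * r powr (1 - ?n / p)"
      using J by (simp add: field_simps)
    also have "\<dots> \<le> \<bar>2 * E / ?J\<bar> * M * r powr (1 - ?n / p)"
      by (intro mult_right_mono abs_ge_self *(4) powr_ge_zero)
    finally show "\<bar>u y - u x0\<bar> \<le> \<bar>2 * E / ?J\<bar> * M * r powr (1 - ?n / p)" .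
  qed simp
qed

section \<open>Zigzag functions\<close>

text \<open>The distance of \<open>t + s\<close> from the lattice of multiples of \<open>2 * \<epsilon>\<close>. It has slopes \<open>\<plusminus>1\<close>, amplitude \<open>\<epsilon>\<close>, and kinks
  exactly where \<open>t + s\<close> is a multiple of \<open>\<epsilon>\<close>.\<close>

definition zigzag :: "real \<Rightarrow> real \<Rightarrow> real \<Rightarrow> real" where
  "zigzag \<epsilon> s t = \<bar>t + s - 2 * \<epsilon> * of_int (round ((t + s) / (2 * \<epsilon>)))\<bar>"

definition zigzag_slope :: "real \<Rightarrow> real \<Rightarrow> real \<Rightarrow> real" where
  "zigzag_slope \<epsilon> s t = (if even \<lfloor>(t + s) / \<epsilon>\<rfloor> then 1 else -1)"

lemma zigzag_minimal:
  assumes "0 < \<epsilon>"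
  shows "zigzag \<epsilon> s t \<le> \<bar>t + s - 2 * \<epsilon> * of_int m\<bar>"
proof -
  have *: "\<bar>t + s - 2 * \<epsilon> * of_int k\<bar> = 2 * \<epsilon> * \<bar>(t + s) / (2 * \<epsilon>) - of_int k\<bar>" for k :: int
  proof -
    have "t + s - 2 * \<epsilon> * of_int k = 2 * \<epsilon> * ((t + s) / (2 * \<epsilon>) - of_int k)"
      using assms by (simp add: field_simps)
    then show ?thesis using assms by (simp add: abs_mult)
  qed
  show ?thesis
    unfolding zigzag_def * using assms round_diff_minimal by (intro mult_left_mono) auto
qed

lemma zigzag_lipschitz:
  assumes "0 < \<epsilon>"
  shows "\<bar>zigzag \<epsilon> s t - zigzag \<epsilon> s t'\<bar> \<le> \<bar>t - t'\<bar>"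
proof -
  have "zigzag \<epsilon> s a \<le> \<bar>a - b\<bar> + zigzag \<epsilon> s b" for a b
    using zigzag_minimal[OF assms, of s a "round ((b + s) / (2 * \<epsilon>))"] unfolding zigzag_def[of _ _ b]
    by linarith
  from this[of t t'] this[of t' t] show ?thesis by linarith
qed

lemma zigzag_bounded:
  assumes "0 < \<epsilon>"
  shows "\<bar>zigzag \<epsilon> s t\<bar> \<le> \<epsilon>"
proof -
  have "zigzag \<epsilon> s t = 2 * \<epsilon> * \<bar>(t + s) / (2 * \<epsilon>) - of_int (round ((t + s) / (2 * \<epsilon>)))\<bar>"
  proof -
    have "t + s - 2 * \<epsilon> * k = 2 * \<epsilon> * ((t + s) / (2 * \<epsilon>) - k)" for k
      using assms by (simp add: field_simps)
    then show ?thesis using assms by (simp add: zigzag_def abs_mult)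
  qed
  also have "\<dots> \<le> 2 * \<epsilon> * (1 / 2)"
    using assms of_int_round_abs_le[of "(t + s) / (2 * \<epsilon>)"]
    by (intro mult_left_mono) (auto simp: abs_minus_commute)
  finally show ?thesis by (simp add: zigzag_def)
qed

lemma zigzag_affine:
  assumes "0 < \<epsilon>" "of_int k * \<epsilon> < t + s" "t + s < (of_int k + 1) * \<epsilon>"
  shows "zigzag \<epsilon> s t = (if even k then t + (s - of_int k * \<epsilon>) else - t + ((of_int k + 1) * \<epsilon> - s))"
proof (cases "even k")
  case True
  then obtain m where m: "k = 2 * m" by blast
  have "round ((t + s) / (2 * \<epsilon>)) = m"
  proof (rule round_unique)
    show "(t + s) / (2 * \<epsilon>) - 1 / 2 < of_int m" "of_int m \<le> (t + s) / (2 * \<epsilon>) + 1 / 2"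
      using assms by (auto simp: m field_simps)
  qed
  then show ?thesis using True assms(2) by (simp add: zigzag_def m algebra_simps)
next
  case False
  then obtain m where m: "k = 2 * m + 1" by (blast elim: oddE)
  have "round ((t + s) / (2 * \<epsilon>)) = m + 1"
  proof (rule round_unique)
    show "(t + s) / (2 * \<epsilon>) - 1 / 2 < of_int (m + 1)" "of_int (m + 1) \<le> (t + s) / (2 * \<epsilon>) + 1 / 2"
      using assms by (auto simp: m field_simps)
  qed
  then show ?thesis using False assms(3) by (simp add: zigzag_def m algebra_simps)
qed

lemma floor_strip:
  fixes x :: real
  assumes "0 < \<epsilon>" "\<And>k :: int. x \<noteq> of_int k * \<epsilon>"
  shows "of_int \<lfloor>x / \<epsilon>\<rfloor> * \<epsilon> < x" "x < (of_int \<lfloor>x / \<epsilon>\<rfloor> + 1) * \<epsilon>"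
proof -
  have "of_int \<lfloor>x / \<epsilon>\<rfloor> \<le> x / \<epsilon>" "x / \<epsilon> < of_int \<lfloor>x / \<epsilon>\<rfloor> + 1"
    by linarith+
  then have "of_int \<lfloor>x / \<epsilon>\<rfloor> * \<epsilon> \<le> x" "x < (of_int \<lfloor>x / \<epsilon>\<rfloor> + 1) * \<epsilon>"
    by (simp_all only: pos_le_divide_eq[OF assms(1)] pos_divide_less_eq[OF assms(1)])
  then show "of_int \<lfloor>x / \<epsilon>\<rfloor> * \<epsilon> < x" "x < (of_int \<lfloor>x / \<epsilon>\<rfloor> + 1) * \<epsilon>"
    using assms(2)[of "\<lfloor>x / \<epsilon>\<rfloor>"] by linarith+
qed

lemma zigzag_deriv:
  assumes "0 < \<epsilon>" "\<And>k :: int. t + s \<noteq> of_int k * \<epsilon>"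
  shows "(zigzag \<epsilon> s has_real_derivative zigzag_slope \<epsilon> s t) (at t)"
proof -
  define k where "k = \<lfloor>(t + s) / \<epsilon>\<rfloor>"
  define I where "I = {of_int k * \<epsilon> - s<..<(of_int k + 1) * \<epsilon> - s}"
  have t: "t \<in> I"
    using floor_strip[OF assms] by (simp add: I_def k_def algebra_simps)
  have "((\<lambda>t. if even k then t + (s - of_int k * \<epsilon>) else - t + ((of_int k + 1) * \<epsilon> - s))
      has_real_derivative zigzag_slope \<epsilon> s t) (at t)"
    by (cases "even k") (auto simp: zigzag_slope_def k_def[symmetric] intro!: derivative_eq_intros)
  then show ?thesis
  proof (rule has_field_derivative_transform_within_open[where S = I])
    show "(if even k then x + (s - of_int k * \<epsilon>) else - x + ((of_int k + 1) * \<epsilon> - s)) = zigzag \<epsilon> s x"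
      if "x \<in> I" for x
      using zigzag_affine[OF assms(1), of k x s] that by (simp add: I_def algebra_simps)
  qed (use t in \<open>auto simp: I_def\<close>)
qed

lemma zigzag_slope_measurable: "zigzag_slope \<epsilon> s \<in> borel_measurable borel"
  unfolding zigzag_slope_def[abs_def] by measurable

section \<open>The local energy bound\<close>

text \<open>The seminorm bound in terms of integrals. The constant is made positive because the elementary form of Hoelder's
  inequality below divides by it.\<close>

lemma bounded_composition_operator_gradient_estimate:
  fixes \<phi> :: "'a::euclidean_space \<Rightarrow> 'a"
  assumes "bounded_composition_operator p p \<Omega> \<Omega>' \<phi>" and p: "0 < p"
  obtains K where "0 < K"
    "\<And>f M. f \<in> L1p p \<Omega>' \<Longrightarrow> L1p_seminorm p \<Omega>' f \<le> M \<Longrightarrow>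
       \<exists>G. has_weak_gradient \<Omega> (f \<circ> \<phi>) G
         \<and> (\<lambda>x. norm (G x) powr p) absolutely_integrable_on \<Omega>
         \<and> (LINT x:\<Omega>|lebesgue. norm (G x) powr p) \<le> (K * M) powr p"
proof -
  obtain K where K: "\<And>f. f \<in> L1p p \<Omega>' \<Longrightarrow> f \<circ> \<phi> \<in> L1p p \<Omega>"
    "\<And>f. f \<in> L1p p \<Omega>' \<Longrightarrow> L1p_seminorm p \<Omega> (f \<circ> \<phi>) \<le> K * L1p_seminorm p \<Omega>' f"
    using assms(1) unfolding bounded_composition_operator_def by blast
  show thesis
  proof (rule that[of "max K 1"])
    fix f M assume f: "f \<in> L1p p \<Omega>'" "L1p_seminorm p \<Omega>' f \<le> M"
    let ?G = "weak_gradient \<Omega> (f \<circ> \<phi>)"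
    have "\<exists>G. has_weak_gradient \<Omega> (f \<circ> \<phi>) G" "(\<lambda>x. norm (?G x) powr p) absolutely_integrable_on \<Omega>"
      using K(1)[OF f(1)] by (auto simp: L1p_def)
    then have G: "has_weak_gradient \<Omega> (f \<circ> \<phi>) ?G" "(\<lambda>x. norm (?G x) powr p) absolutely_integrable_on \<Omega>"
      using has_weak_gradient_weak_gradient by blast+
    let ?I = "LINT x:\<Omega>|lebesgue. norm (?G x) powr p"
    have I: "0 \<le> ?I"
      by (simp add: set_lebesgue_integral_def)
    have "0 \<le> L1p_seminorm p \<Omega>' f"
      by (simp add: L1p_seminorm_def)
    then have "K * L1p_seminorm p \<Omega>' f \<le> max K 1 * M"
      using f(2) by (intro mult_mono) auto
    then have "?I powr (1 / p) \<le> max K 1 * M"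
      using K(2)[OF f(1)] unfolding L1p_seminorm_def by linarith
    then have "(?I powr (1 / p)) powr p \<le> (max K 1 * M) powr p"
      using p by (intro powr_mono2) auto
    then have "?I \<le> (max K 1 * M) powr p"
      using I p by (simp add: powr_powr)
    then show "\<exists>G. has_weak_gradient \<Omega> (f \<circ> \<phi>) G
         \<and> (\<lambda>x. norm (G x) powr p) absolutely_integrable_on \<Omega>
         \<and> (LINT x:\<Omega>|lebesgue. norm (G x) powr p) \<le> (max K 1 * M) powr p"
      using G by blast
  qed auto
qed

text \<open>Hoelder's inequality up to the factor 2, from the elementary bound \<open>a \<le> \<mu> + \<mu> powr (1 - p) * a powr p\<close>, which
  holds because either \<open>a \<le> \<mu>\<close> or \<open>1 \<le> (a / \<mu>) powr (p - 1)\<close>.\<close>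

lemma integral_norm_le_of_Lp:
  fixes G :: "'a::euclidean_space \<Rightarrow> 'b::euclidean_space"
  assumes p: "1 \<le> p" and m: "0 < m" and Q: "Q \<in> lmeasurable" "0 < measure lebesgue Q" "Q \<subseteq> \<Omega>"
    and G: "set_integrable lebesgue Q G"
    and Gp: "(\<lambda>x. norm (G x) powr p) absolutely_integrable_on \<Omega>"
      "(LINT x:\<Omega>|lebesgue. norm (G x) powr p) \<le> m powr p"
  shows "(LINT x:Q|lebesgue. norm (G x)) \<le> 2 * m * measure lebesgue Q powr (1 - 1 / p)"
proof -
  let ?Q = "measure lebesgue Q"
  \<comment> \<open>The value that balances the two terms of the elementary bound after integration.\<close>
  define \<mu> where "\<mu> = m * ?Q powr (- (1 / p))"
  have \<mu>: "0 < \<mu>" using m Q by (simp add: \<mu>_def)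
  have young: "a \<le> \<mu> + \<mu> powr (1 - p) * a powr p" if "0 \<le> a" for a
  proof (cases "a \<le> \<mu>")
    case False
    then have a: "0 < a" "\<mu> \<le> a" using \<mu> by auto
    have "a = a powr (1 - p) * a powr p"
      using a by (simp add: powr_add[symmetric])
    also have "\<dots> \<le> \<mu> powr (1 - p) * a powr p"
      using a \<mu> p by (intro mult_right_mono powr_mono2') auto
    finally show ?thesis using \<mu> by linarith
  qed (use \<mu> in \<open>simp add: add_increasing2\<close>)
  have intQ: "integrable lebesgue (\<lambda>x. indicator Q x *\<^sub>R norm (G x))"
    using integrable_norm[OF G[unfolded set_integrable_def]] by simp
  have int\<Omega>: "integrable lebesgue (\<lambda>x. indicator \<Omega> x *\<^sub>R (norm (G x) powr p))"
    using Gp(1) by (simp add: set_integrable_def)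
  have ind: "integrable lebesgue (\<lambda>x. \<mu> * indicator Q x :: real)"
    using Q(1) by (intro integrable_mult_right integrable_real_indicator) (auto simp: fmeasurable_def)
  have "(LINT x:Q|lebesgue. norm (G x))
      \<le> (LINT x|lebesgue. \<mu> * indicator Q x + \<mu> powr (1 - p) * (indicator \<Omega> x *\<^sub>R (norm (G x) powr p)))"
    unfolding set_lebesgue_integral_def
  proof (intro integral_mono intQ Bochner_Integration.integrable_add ind integrable_mult_right int\<Omega>)
    show "indicator Q x *\<^sub>R norm (G x)
        \<le> \<mu> * indicator Q x + \<mu> powr (1 - p) * (indicator \<Omega> x *\<^sub>R (norm (G x) powr p))" for x
      using young[of "norm (G x)"] Q(3) by (cases "x \<in> Q") auto
  qed
  also have "\<dots> = \<mu> * ?Q + \<mu> powr (1 - p) * (LINT x:\<Omega>|lebesgue. norm (G x) powr p)"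
    using ind int\<Omega> Q(1) by (simp add: set_lebesgue_integral_def fmeasurable_def)
  also have "\<dots> \<le> \<mu> * ?Q + \<mu> powr (1 - p) * m powr p"
    using Gp(2) by (intro add_left_mono mult_left_mono) auto
  also have "\<mu> * ?Q = m * ?Q powr (1 - 1 / p)"
    using Q(2) powr_add[of ?Q "- (1 / p)" 1] by (simp add: \<mu>_def)
  also have "\<mu> powr (1 - p) * m powr p = m * ?Q powr (1 - 1 / p)"
  proof -
    have e: "- (1 / p) * (1 - p) = 1 - 1 / p"
      using p by (simp add: field_simps)
    have "\<mu> powr (1 - p) = m powr (1 - p) * ?Q powr (- (1 / p) * (1 - p))"
      using m Q(2) by (simp add: \<mu>_def powr_mult powr_powr)
    then have "\<mu> powr (1 - p) * m powr p = (m powr (1 - p) * m powr p) * ?Q powr (1 - 1 / p)"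
      unfolding e by (simp only: mult_ac)
    moreover have "m powr (1 - p) * m powr p = m"
      using m by (simp add: powr_add[symmetric])
    ultimately show ?thesis by (simp only:)
  qed
  finally show ?thesis by simp
qed

text \<open>The open strips between consecutive kinks are countably many, and on the preimage of each of them the two functions
  differ by a sign and a constant.\<close>

lemma AE_norm_gradient_eq_zigzag_gradient:
  fixes \<phi> :: "'a::euclidean_space \<Rightarrow> 'a"
  assumes \<Omega>: "open \<Omega>" "continuous_on \<Omega> \<phi>" and \<epsilon>: "0 < \<epsilon>"
    and W: "open W" "\<And>y. y \<in> W \<Longrightarrow> \<eta> y = 1"
    and G: "has_weak_gradient \<Omega> (\<lambda>x. (\<phi> x \<bullet> i) * \<eta> (\<phi> x)) G"
    and G': "has_weak_gradient \<Omega> (\<lambda>x. zigzag \<epsilon> s (\<phi> x \<bullet> i) * \<eta> (\<phi> x)) G'"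
  shows "AE x in lebesgue. x \<in> \<Omega> \<and> \<phi> x \<in> W \<and> (\<forall>k :: int. \<phi> x \<bullet> i + s \<noteq> of_int k * \<epsilon>) \<longrightarrow> norm (G' x) = norm (G x)"
proof -
  define T where "T k = W \<inter> {y. of_int k * \<epsilon> < y \<bullet> i + s} \<inter> {y. y \<bullet> i + s < (of_int k + 1) * \<epsilon>}" for k :: int
  have "open (T k)" for k
    unfolding T_def by (intro open_Int W open_Collect_less continuous_intros)
  then have V: "open (\<Omega> \<inter> \<phi> -` T k)" for k
    by (rule continuous_open_preimage[OF \<Omega>(2,1)])
  have "AE x in lebesgue. x \<in> \<Omega> \<inter> \<phi> -` T k \<longrightarrow> G' x = (if even k then 1 else - 1) *\<^sub>R G x" for k
  proof (rule weak_gradient_locally_determined[OF G' G V])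
    fix x assume "x \<in> \<Omega> \<inter> \<phi> -` T k"
    then show "zigzag \<epsilon> s (\<phi> x \<bullet> i) * \<eta> (\<phi> x) = (if even k then 1 else - 1) * ((\<phi> x \<bullet> i) * \<eta> (\<phi> x))
        + (if even k then s - of_int k * \<epsilon> else (of_int k + 1) * \<epsilon> - s)"
      using zigzag_affine[OF \<epsilon>, of k "\<phi> x \<bullet> i" s] W(2)[of "\<phi> x"] by (simp add: T_def)
  qed auto
  then have "AE x in lebesgue. \<forall>k\<in>(UNIV :: int set). x \<in> \<Omega> \<inter> \<phi> -` T k \<longrightarrow> G' x = (if even k then 1 else - 1) *\<^sub>R G x"
    by (intro AE_ball_countable') auto
  then show ?thesis
  proof eventually_elim
    case (elim x)
    show ?case
    proof
      assume x: "x \<in> \<Omega> \<and> \<phi> x \<in> W \<and> (\<forall>k :: int. \<phi> x \<bullet> i + s \<noteq> of_int k * \<epsilon>)"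
      then have "x \<in> \<Omega> \<inter> \<phi> -` T \<lfloor>(\<phi> x \<bullet> i + s) / \<epsilon>\<rfloor>"
        using floor_strip[OF \<epsilon>, of "\<phi> x \<bullet> i + s"] by (simp add: T_def)
      then have "G' x = (if even \<lfloor>(\<phi> x \<bullet> i + s) / \<epsilon>\<rfloor> then 1 else - 1) *\<^sub>R G x"
        using elim by blast
      then show "norm (G' x) = norm (G x)" by simp
    qed
  qed
qed

text \<open>Zigzags with shifts 0 and \<open>\<epsilon> / 2\<close> have no kink in common.\<close>

lemma not_both_multiples:
  fixes t :: real
  assumes "0 < \<epsilon>"
  shows "(\<forall>k :: int. t + 0 \<noteq> of_int k * \<epsilon>) \<or> (\<forall>k :: int. t + \<epsilon> / 2 \<noteq> of_int k * \<epsilon>)"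
proof (rule ccontr)
  assume "\<not> ?thesis"
  then obtain k m :: int where "t + 0 = of_int k * \<epsilon>" "t + \<epsilon> / 2 = of_int m * \<epsilon>" by blast
  then have "(2 * (of_int m - of_int k) - 1) * \<epsilon> = 0" by (simp add: algebra_simps)
  then have "real_of_int (2 * (m - k)) = real_of_int 1" using assms by simp
  then have "2 * (m - k) = 1" by (simp only: of_int_eq_iff)
  then show False by presburger
qed

text \<open>The local energy bound in the form required by Morrey's inequality. The cut-off \<open>\<eta>\<close> and the amplitude
  \<open>\<epsilon>\<close> depend on the box, but the resulting estimate does not. The constant is \<open>8 = 2 * 2 * 2\<close>: two zigzags, the bound 2
  for the gradient of each of them, and the factor 2 in \<open>integral_norm_le_of_Lp\<close>.\<close>

lemma box_gradient_bound_component: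
  fixes \<phi> :: "'a::euclidean_space \<Rightarrow> 'a"
  assumes \<Omega>: "open \<Omega>" "continuous_on \<Omega> \<phi>" and \<Omega>': "open \<Omega>'" and p: "1 \<le> p" and K: "0 < K"
    and op: "\<And>f M. f \<in> L1p p \<Omega>' \<Longrightarrow> L1p_seminorm p \<Omega>' f \<le> M \<Longrightarrow>
       \<exists>G. has_weak_gradient \<Omega> (f \<circ> \<phi>) G
         \<and> (\<lambda>x. norm (G x) powr p) absolutely_integrable_on \<Omega>
         \<and> (LINT x:\<Omega>|lebesgue. norm (G x) powr p) \<le> (K * M) powr p"
    and U: "U \<subseteq> \<Omega>" "open (\<phi> ` U)" "\<phi> ` U \<subseteq> \<Omega>'" "\<phi> ` U \<in> lmeasurable" and i: "i \<in> Basis"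
  shows "box_gradient_bound p U (\<lambda>x. \<phi> x \<bullet> i) (8 * K * measure lebesgue (\<phi> ` U) powr (1 / p))"
  unfolding box_gradient_bound_def
proof (intro allI impI)
  fix l w j :: 'a and \<psi> :: "'a \<Rightarrow> real" and S :: real
  let ?Q = "cbox l w"
  let ?A = "\<phi> ` U"
  let ?d = "\<lambda>x. frechet_derivative \<psi> (at x) j"
  assume Q: "?Q \<subseteq> U" "box l w \<noteq> {}" and j: "j \<in> Basis" and \<psi>_UNIV: "test_function UNIV \<psi>"
    and \<psi>0: "\<forall>z. z \<notin> ?Q \<longrightarrow> \<psi> z = 0" and S: "\<forall>z. \<bar>\<psi> z\<bar> \<le> S"
  have \<psi>Q: "test_function ?Q \<psi>"
    unfolding test_function_def
  proof (intro conjI exI[of _ ?Q] compact_cbox subset_refl \<psi>0)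
    show "\<forall>k. Ck k \<psi>" using \<psi>_UNIV by (simp add: test_function_def)
  qed
  have Q\<Omega>: "?Q \<subseteq> \<Omega>" using Q(1) U(1) by blast
  have \<psi>: "test_function \<Omega> \<psi>"
    by (rule test_function_mono[OF \<psi>Q Q\<Omega>])
  have d0: "?d x = 0" if "x \<notin> ?Q" for x
  proof -
    obtain P where P: "P \<subseteq> ?Q" "\<And>x v. x \<notin> P \<Longrightarrow> frechet_derivative \<psi> (at x) v = 0"
      by (rule test_functionE[OF \<psi>Q]) (rule that)
    have "x \<notin> P" using P(1) that by blast
    then show ?thesis by (rule P(2))
  qed
  have S0: "0 \<le> S" using spec[OF S, of 0] abs_ge_zero[of "\<psi> 0"] by linarith
  have Q_pos: "0 < measure lebesgue ?Q"
  proof -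
    have "0 < measure lborel ?Q"
      using Q(2) content_pos_lt[of l w] unfolding box_ne_empty by blast
    then show ?thesis by simp
  qed
  have A_pos: "0 < measure lebesgue ?A"
  proof -
    have "?Q \<noteq> {}" using Q(2) box_subset_cbox[of l w] by blast
    then have "?A \<noteq> {}" using Q(1) by blast
    then have "\<not> negligible ?A" by (rule open_not_negligible[OF U(2)])
    then have "measure lebesgue ?A \<noteq> 0" using U(4) by (auto simp only: negligible_iff_measure)
    then show ?thesis by (simp only: zero_less_measure_iff) simp
  qed
  define a where "a = measure lebesgue ?A powr (1 / p)"
  have a: "0 < a" using A_pos by (simp add: a_def)
  have comp: "compact (\<phi> ` ?Q)"
    by (intro compact_continuous_image continuous_on_subset[OF \<Omega>(2) Q\<Omega>] compact_cbox)
  obtain \<eta> W where \<eta>: "test_function ?A \<eta>" "\<And>z. 0 \<le> \<eta> z" "\<And>z. \<eta> z \<le> 1"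
    and W: "open W" "\<phi> ` ?Q \<subseteq> W" "\<And>z. z \<in> W \<Longrightarrow> \<eta> z = 1"
    by (rule smooth_cutoff[OF comp U(2) image_mono[OF Q(1)]]) (rule that)
  have p0: "0 < p" using p by simp
  obtain C where C: "0 \<le> C" "\<And>y. norm (classical_gradient \<eta> y) \<le> C"
    using test_function_bounded_gradient[OF \<eta>(1)] by metis
  \<comment> \<open>The amplitude is chosen so small that folding outweighs the gradient of the cut-off.\<close>
  define \<epsilon> where "\<epsilon> = 1 / (C + 1)"
  have \<epsilon>: "0 < \<epsilon>" "\<epsilon> * C \<le> 1" using C by (auto simp: \<epsilon>_def field_simps)
  have "\<forall>s. \<exists>G. has_weak_gradient \<Omega> (\<lambda>x. zigzag \<epsilon> s (\<phi> x \<bullet> i) * \<eta> (\<phi> x)) G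
      \<and> (\<lambda>x. norm (G x) powr p) absolutely_integrable_on \<Omega>
      \<and> (LINT x:\<Omega>|lebesgue. norm (G x) powr p) \<le> (K * (2 * a)) powr p"
  proof
    fix s
    have slope: "\<bar>zigzag_slope \<epsilon> s t\<bar> \<le> 1" for t by (simp add: zigzag_slope_def)
    have N: "countable (range (\<lambda>k :: int. of_int k * \<epsilon> - s))" by simp
    have deriv: "(zigzag \<epsilon> s has_real_derivative zigzag_slope \<epsilon> s t) (at t)"
      if "t \<notin> range (\<lambda>k :: int. of_int k * \<epsilon> - s)" for t
      using that by (intro zigzag_deriv[OF \<epsilon>(1)]) (auto simp: image_iff algebra_simps)
    have bnd: "\<bar>\<eta> y\<bar> + \<bar>zigzag \<epsilon> s (y \<bullet> i)\<bar> * norm (classical_gradient \<eta> y) \<le> 2" for y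
    proof -
      have "\<bar>zigzag \<epsilon> s (y \<bullet> i)\<bar> * norm (classical_gradient \<eta> y) \<le> \<epsilon> * C"
        using \<epsilon>(1) C by (intro mult_mono zigzag_bounded) auto
      then show ?thesis using \<epsilon>(2) \<eta>(2,3)[of y] by linarith
    qed
    have "(\<lambda>y. zigzag \<epsilon> s (y \<bullet> i) * \<eta> y) \<in> L1p p \<Omega>'"
      by (rule plane_wave_L1p(1)[OF \<Omega>' p0 U(3,4) \<eta>(1) i zigzag_lipschitz[OF \<epsilon>(1)]
          zigzag_slope_measurable slope N deriv bnd])
    moreover have "L1p_seminorm p \<Omega>' (\<lambda>y. zigzag \<epsilon> s (y \<bullet> i) * \<eta> y) \<le> 2 * a"
      unfolding a_def
      by (rule plane_wave_L1p(2)[OF \<Omega>' p0 U(3,4) \<eta>(1) i zigzag_lipschitz[OF \<epsilon>(1)]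
          zigzag_slope_measurable slope N deriv bnd])
    ultimately have "\<exists>G. has_weak_gradient \<Omega> ((\<lambda>y. zigzag \<epsilon> s (y \<bullet> i) * \<eta> y) \<circ> \<phi>) G
      \<and> (\<lambda>x. norm (G x) powr p) absolutely_integrable_on \<Omega>
      \<and> (LINT x:\<Omega>|lebesgue. norm (G x) powr p) \<le> (K * (2 * a)) powr p"
      by (rule op)
    then
    show "\<exists>G. has_weak_gradient \<Omega> (\<lambda>x. zigzag \<epsilon> s (\<phi> x \<bullet> i) * \<eta> (\<phi> x)) G
      \<and> (\<lambda>x. norm (G x) powr p) absolutely_integrable_on \<Omega>
      \<and> (LINT x:\<Omega>|lebesgue. norm (G x) powr p) \<le> (K * (2 * a)) powr p"
      by (simp only: o_def)
  qed
  from choice[OF this] obtain G' where *: "\<forall>s. has_weak_gradient \<Omega> (\<lambda>x. zigzag \<epsilon> s (\<phi> x \<bullet> i) * \<eta> (\<phi> x)) (G' s)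
      \<and> (\<lambda>x. norm (G' s x) powr p) absolutely_integrable_on \<Omega>
      \<and> (LINT x:\<Omega>|lebesgue. norm (G' s x) powr p) \<le> (K * (2 * a)) powr p" ..
  have G': "\<And>s. has_weak_gradient \<Omega> (\<lambda>x. zigzag \<epsilon> s (\<phi> x \<bullet> i) * \<eta> (\<phi> x)) (G' s)"
      "\<And>s. (\<lambda>x. norm (G' s x) powr p) absolutely_integrable_on \<Omega>"
      "\<And>s. (LINT x:\<Omega>|lebesgue. norm (G' s x) powr p) \<le> (K * (2 * a)) powr p"
    using spec[OF *] by blast+
  \<comment> \<open>The same cut-off serves for the unfolded coordinate; only the existence of the weak gradient of \<open>(\<phi> \<bullet> i) * (\<eta> \<circ> \<phi>)\<close> matters here, not its norm.\<close>
  obtain G where G: "has_weak_gradient \<Omega> (\<lambda>x. (\<phi> x \<bullet> i) * \<eta> (\<phi> x)) G"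
  proof -
    obtain P where P: "compact P" "\<And>x. x \<notin> P \<Longrightarrow> \<eta> x = 0" "\<And>x v. x \<notin> P \<Longrightarrow> frechet_derivative \<eta> (at x) v = 0"
      using test_functionE[OF \<eta>(1)] by metis
    have "bounded ((\<lambda>y. y \<bullet> i) ` P)"
      by (intro compact_imp_bounded compact_continuous_image P continuous_intros)
    then obtain b where b: "0 < b" "\<forall>y\<in>P. \<bar>y \<bullet> i\<bar> \<le> b"
      unfolding bounded_pos by auto
    have "\<bar>\<eta> y\<bar> + \<bar>y \<bullet> i\<bar> * norm (classical_gradient \<eta> y) \<le> 1 + b * C" for y
    proof (cases "y \<in> P")
      case True
      then have "\<bar>y \<bullet> i\<bar> * norm (classical_gradient \<eta> y) \<le> b * C"
        using b C by (intro mult_mono) auto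
      then show ?thesis using \<eta>(2,3)[of y] by linarith
    next
      case False
      then have "\<eta> y = 0" "classical_gradient \<eta> y = 0"
        using P by (auto simp: classical_gradient_def)
      then show ?thesis using b(1) C(1) by simp
    qed
    then have "(\<lambda>y. (y \<bullet> i) * \<eta> y) \<in> L1p p \<Omega>'"
      by (intro plane_wave_L1p(1)[OF \<Omega>' p0 U(3,4) \<eta>(1) i, where \<zeta> = "\<lambda>t. t" and \<zeta>' = "\<lambda>_. 1" and N = "{}"]) auto
    from op[OF this order_refl] show thesis using that by (auto simp: o_def)
  qed
  have loc: "set_integrable lebesgue ?Q (G' s)" for s
    using G'(1)[of s] Q\<Omega> by (auto simp: has_weak_gradient_def locally_integrable_on_def)
  have intG': "integrable lebesgue (\<lambda>x. indicator ?Q x *\<^sub>R norm (G' s x))" for s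
    using integrable_norm[OF loc[unfolded set_integrable_def]] by simp
  have AE_eq: "AE x in lebesgue. x \<in> \<Omega> \<and> \<phi> x \<in> W \<and> (\<forall>k :: int. \<phi> x \<bullet> i + s \<noteq> of_int k * \<epsilon>)
      \<longrightarrow> norm (G' s x) = norm (G x)" for s
    by (rule AE_norm_gradient_eq_zigzag_gradient[OF \<Omega> \<epsilon>(1) W(1,3) G G'(1)])
  have AE: "AE x in lebesgue. x \<in> ?Q \<longrightarrow> norm (G x) \<le> norm (G' 0 x) + norm (G' (\<epsilon> / 2) x)"
    using AE_eq[of 0] AE_eq[of "\<epsilon> / 2"]
  proof eventually_elim
    case (elim x)
    show ?case
    proof
      assume "x \<in> ?Q"
      then have x: "x \<in> \<Omega>" "\<phi> x \<in> W" using Q\<Omega> W(2) by auto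
      from not_both_multiples[OF \<epsilon>(1), of "\<phi> x \<bullet> i"]
      show "norm (G x) \<le> norm (G' 0 x) + norm (G' (\<epsilon> / 2) x)"
      proof
        assume "\<forall>k :: int. \<phi> x \<bullet> i + 0 \<noteq> of_int k * \<epsilon>"
        then have "norm (G' 0 x) = norm (G x)" using elim(1) x by blast
        then show ?thesis by simp
      next
        assume "\<forall>k :: int. \<phi> x \<bullet> i + \<epsilon> / 2 \<noteq> of_int k * \<epsilon>"
        then have "norm (G' (\<epsilon> / 2) x) = norm (G x)" using elim(2) x by blast
        then show ?thesis by simp
      qed
    qed
  qed
  let ?v = "\<lambda>x. (\<phi> x \<bullet> i) * \<eta> (\<phi> x)"
  have "integral ?Q (\<lambda>x. (\<phi> x \<bullet> i) * ?d x) = integral ?Q (\<lambda>x. ?v x * ?d x)"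
    by (intro Henstock_Kurzweil_Integration.integral_cong) (use W in auto)
  also have "\<dots> = integral UNIV (\<lambda>x. ?v x * ?d x)"
    by (intro integral_UNIV_eq_integral[symmetric]) (simp add: d0)
  also have "\<dots> = (LINT x|lebesgue. ?v x * ?d x)"
  proof (intro integral_lebesgue integrable_times_compact_support[OF _ compact_cbox Q\<Omega>])
    show "locally_integrable_on ?v \<Omega>" using G by (simp add: has_weak_gradient_def)
  qed (use d0 test_function_continuous_on(2)[OF \<psi>] in auto)
  also have "\<dots> = (LINT x:\<Omega>|lebesgue. ?v x * ?d x)"
  proof (intro set_lebesgue_integral_eq_UNIV[symmetric])
    show "?v x * ?d x = 0" if "x \<notin> \<Omega>" for x
      using d0[of x] that Q\<Omega> by auto
  qed
  also have "\<dots> = - (LINT x:\<Omega>|lebesgue. (G x \<bullet> j) * \<psi> x)"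
    using G \<psi> j unfolding has_weak_gradient_def by blast
  also have "(LINT x:\<Omega>|lebesgue. (G x \<bullet> j) * \<psi> x) = (LINT x|lebesgue. (G x \<bullet> j) * \<psi> x)"
  proof (intro set_lebesgue_integral_eq_UNIV)
    show "(G x \<bullet> j) * \<psi> x = 0" if "x \<notin> \<Omega>" for x
      using \<psi>0 that Q\<Omega> by auto
  qed
  finally have "\<bar>integral ?Q (\<lambda>x. (\<phi> x \<bullet> i) * ?d x)\<bar> = \<bar>LINT x|lebesgue. (G x \<bullet> j) * \<psi> x\<bar>"
    by simp
  also have "\<dots> \<le> (LINT x|lebesgue. norm ((G x \<bullet> j) * \<psi> x))"
    using integral_norm_bound[of lebesgue "\<lambda>x. (G x \<bullet> j) * \<psi> x"] by simp
  also have "\<dots> \<le> (LINT x|lebesgue. S * (indicator ?Q x *\<^sub>R norm (G' 0 x) + indicator ?Q x *\<^sub>R norm (G' (\<epsilon> / 2) x)))"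
  proof (intro intG' integral_mono_AE integrable_norm integrable_mult_right Bochner_Integration.integrable_add)
    have "locally_integrable_on (\<lambda>x. G x \<bullet> j) \<Omega>"
      unfolding locally_integrable_on_def
    proof (intro allI impI absolutely_integrable_component)
      show "G absolutely_integrable_on P" if "compact P \<and> P \<subseteq> \<Omega>" for P
        using G that unfolding has_weak_gradient_def locally_integrable_on_def by blast
    qed
    then show "integrable lebesgue (\<lambda>x. (G x \<bullet> j) * \<psi> x)"
      using \<psi>0 by (intro integrable_times_compact_support[OF _ compact_cbox Q\<Omega>]
          test_function_continuous_on(1)[OF \<psi>]) auto
    show "AE x in lebesgue. norm ((G x \<bullet> j) * \<psi> x)
        \<le> S * (indicator ?Q x *\<^sub>R norm (G' 0 x) + indicator ?Q x *\<^sub>R norm (G' (\<epsilon> / 2) x))"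
      using AE
    proof eventually_elim
      case (elim x)
      show ?case
      proof (cases "x \<in> ?Q")
        case True
        have "norm ((G x \<bullet> j) * \<psi> x) \<le> norm (G x) * S"
          unfolding norm_mult using S Basis_le_norm[OF j, of "G x"] by (intro mult_mono) auto
        also have "\<dots> \<le> (norm (G' 0 x) + norm (G' (\<epsilon> / 2) x)) * S"
          using elim True S0 by (intro mult_right_mono) auto
        finally show ?thesis using True by (simp add: mult.commute)
      qed (use \<psi>0 in auto)
    qed
  qed
  also have "\<dots> = S * ((LINT x:?Q|lebesgue. norm (G' 0 x)) + (LINT x:?Q|lebesgue. norm (G' (\<epsilon> / 2) x)))"
    unfolding set_lebesgue_integral_def integral_mult_right_zero Bochner_Integration.integral_add[OF intG' intG'] ..
  also have "\<dots> \<le> S * (2 * (K * (2 * a)) * measure lebesgue ?Q powr (1 - 1 / p)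
      + 2 * (K * (2 * a)) * measure lebesgue ?Q powr (1 - 1 / p))"
    using K a by (intro mult_left_mono[OF _ S0] add_mono
        integral_norm_le_of_Lp[OF p _ _ Q_pos Q\<Omega> loc G'(2,3)]) auto
  also have "\<dots> = 8 * K * measure lebesgue ?A powr (1 / p) * S * measure lebesgue ?Q powr (1 - 1 / p)"
    by (simp add: a_def)
  finally show "\<bar>integral ?Q (\<lambda>x. (\<phi> x \<bullet> i) * ?d x)\<bar>
      \<le> 8 * K * measure lebesgue ?A powr (1 / p) * S * measure lebesgue ?Q powr (1 - 1 / p)" .
qed

section \<open>The dilatation estimate\<close>

text \<open>Summing the oscillation bounds of the components gives
  \<open>max_dilation \<phi> x0 r \<le> D * |\<phi> ` ball x0 r| powr (1 / p) * r powr (1 - n / p)\<close> with \<open>D\<close> independent of \<open>x0\<close> and \<open>r\<close>,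
  for every closed ball inside \<open>\<Omega>\<close>.\<close>

theorem theorem3p4:
  fixes \<Omega> \<Omega>' :: "(real ^ 'n) set" and \<phi> \<phi>inv :: "real ^ 'n \<Rightarrow> real ^ 'n" and p :: real
  assumes "open \<Omega>" "connected \<Omega>" "\<Omega> \<noteq> {}"
    and "open \<Omega>'" "connected \<Omega>'" "\<Omega>' \<noteq> {}"
    and "real CARD('n) < p"
    and "homeomorphism \<Omega> \<Omega>' \<phi> \<phi>inv"
    and "bounded_composition_operator p p \<Omega> \<Omega>' \<phi>"
  shows "\<exists>H :: real. \<forall>x0 \<in> \<Omega>.
           Limsup (at_right 0)
             (\<lambda>r. ereal (max_dilation \<phi> x0 r powr p * r powr (real CARD('n) - p)
                          / measure lebesgue (\<phi> ` ball x0 r))) \<le> ereal H"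
proof -
  let ?n = "real CARD('n)"
  have n: "1 \<le> ?n" by (simp add: Suc_leI)
  have p: "1 \<le> p" "0 < p" using n assms(7) by linarith+
  have cont: "continuous_on \<Omega> \<phi>" "continuous_on \<Omega>' \<phi>inv"
    using assms(8) by (auto simp: homeomorphism_def)
  obtain K where K: "0 < K"
    "\<And>f M. f \<in> L1p p \<Omega>' \<Longrightarrow> L1p_seminorm p \<Omega>' f \<le> M \<Longrightarrow>
       \<exists>G. has_weak_gradient \<Omega> (f \<circ> \<phi>) G
         \<and> (\<lambda>x. norm (G x) powr p) absolutely_integrable_on \<Omega>
         \<and> (LINT x:\<Omega>|lebesgue. norm (G x) powr p) \<le> (K * M) powr p"
    using bounded_composition_operator_gradient_estimate[OF assms(9) p(2)] by metis
  have dim: "real DIM(real ^ 'n) < p" using assms(7) by simp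
  obtain C where C: "0 \<le> C"
    "\<And>(u :: real ^ 'n \<Rightarrow> real) x0 r y M. 0 < r \<Longrightarrow> y \<in> cball x0 r \<Longrightarrow> continuous_on (cball x0 r) u \<Longrightarrow> 0 \<le> M \<Longrightarrow>
       box_gradient_bound p (ball x0 r) u M \<Longrightarrow> \<bar>u y - u x0\<bar> \<le> C * M * r powr (1 - real DIM(real ^ 'n) / p)"
    using morrey_inequality[OF dim] by metis
  define D where "D = ?n * (C * (8 * K))"
  have D: "0 \<le> D" using C K by (simp add: D_def)
  have bound: "max_dilation \<phi> x0 r powr p * r powr (?n - p) / measure lebesgue (\<phi> ` ball x0 r) \<le> D powr p"
    if r: "0 < r" "cball x0 r \<subseteq> \<Omega>" for x0 r
  proof -
    let ?A = "\<phi> ` ball x0 r"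
    let ?a = "measure lebesgue ?A"
    have ball: "ball x0 r \<subseteq> \<Omega>" using r(2) ball_subset_cball by blast
    have sub: "?A \<subseteq> \<Omega>'"
      using assms(8) ball unfolding homeomorphism_def by blast
    have "?A = \<Omega>' \<inter> \<phi>inv -` ball x0 r"
      using assms(8) ball unfolding homeomorphism_def by force
    then have op: "open ?A"
      using continuous_open_preimage[OF cont(2) assms(4) open_ball] by simp
    have "compact (\<phi> ` cball x0 r)"
      by (intro compact_continuous_image continuous_on_subset[OF cont(1) r(2)] compact_cball)
    then have "bounded ?A"
      using compact_imp_bounded bounded_subset ball_subset_cball by (metis image_mono)
    then have meas: "?A \<in> lmeasurable"
      using op lmeasurable_open by blast
    have R: "norm (\<phi> x0 - \<phi> y) \<le> D * ?a powr (1 / p) * r powr (1 - ?n / p)" if y: "y \<in> cball x0 r" for y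
    proof -
      have "\<bar>\<phi> y \<bullet> i - \<phi> x0 \<bullet> i\<bar> \<le> C * (8 * K * ?a powr (1 / p)) * r powr (1 - ?n / p)" if i: "i \<in> Basis" for i
      proof -
        have "continuous_on (cball x0 r) (\<lambda>x. \<phi> x \<bullet> i)"
          by (intro continuous_intros continuous_on_subset[OF cont(1) r(2)])
        moreover have "box_gradient_bound p (ball x0 r) (\<lambda>x. \<phi> x \<bullet> i) (8 * K * ?a powr (1 / p))"
          by (rule box_gradient_bound_component[OF assms(1) cont(1) assms(4) p(1) K ball op sub meas i])
        ultimately show ?thesis
          using C(2)[OF r(1) y, of "\<lambda>x. \<phi> x \<bullet> i" "8 * K * ?a powr (1 / p)"] K(1) by simp
      qed
      then have "(\<Sum>i\<in>Basis. \<bar>(\<phi> y - \<phi> x0) \<bullet> i\<bar>)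
          \<le> (\<Sum>i\<in>(Basis :: (real ^ 'n) set). C * (8 * K * ?a powr (1 / p)) * r powr (1 - ?n / p))"
        by (intro sum_mono) (simp add: inner_diff_left)
      also have "\<dots> = D * ?a powr (1 / p) * r powr (1 - ?n / p)"
        by (simp add: D_def)
      finally show ?thesis
        using norm_le_l1[of "\<phi> y - \<phi> x0"] by (simp add: norm_minus_commute)
    qed
    have ne: "sphere x0 r \<noteq> {}"
      using r(1) by simp
    have le: "max_dilation \<phi> x0 r \<le> D * ?a powr (1 / p) * r powr (1 - ?n / p)"
      unfolding max_dilation_def using R by (intro cSUP_least ne) auto
    have ge: "0 \<le> max_dilation \<phi> x0 r"
    proof -
      obtain y where y: "y \<in> sphere x0 r" using ne by blast
      have "bdd_above ((\<lambda>y. norm (\<phi> x0 - \<phi> y)) ` sphere x0 r)"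
        using R by (intro bdd_aboveI2[where M = "D * ?a powr (1 / p) * r powr (1 - ?n / p)"]) auto
      then have "norm (\<phi> x0 - \<phi> y) \<le> max_dilation \<phi> x0 r"
        unfolding max_dilation_def by (rule cSUP_upper[OF y])
      then show ?thesis using norm_ge_zero[of "\<phi> x0 - \<phi> y"] by linarith
    qed
    have "max_dilation \<phi> x0 r powr p \<le> (D * ?a powr (1 / p) * r powr (1 - ?n / p)) powr p"
      using p by (intro powr_mono2 ge le) auto
    also have "\<dots> = D powr p * ?a * r powr (p - ?n)"
    proof -
      have "(1 - ?n / p) * p = p - ?n" using p by (simp add: field_simps)
      then show ?thesis using D p by (simp add: powr_mult powr_powr)
    qed
    finally have "max_dilation \<phi> x0 r powr p * r powr (?n - p) \<le> D powr p * ?a * r powr (p - ?n) * r powr (?n - p)"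
      by (intro mult_right_mono) auto
    also have "\<dots> = D powr p * ?a"
      using r(1) by (simp add: powr_add[symmetric])
    finally have *: "max_dilation \<phi> x0 r powr p * r powr (?n - p) \<le> D powr p * ?a" .
    show ?thesis
    proof (cases "?a = 0")
      case False
      then have "0 < ?a" using measure_nonneg[of lebesgue ?A] by linarith
      then show ?thesis using * by (simp add: pos_divide_le_eq)
    qed simp
  qed
  show ?thesis
  proof (intro exI[of _ "D powr p"] ballI Limsup_bounded)
    fix x0 assume "x0 \<in> \<Omega>"
    then obtain e where e: "0 < e" "cball x0 e \<subseteq> \<Omega>"
      using assms(1) open_contains_cball by blast
    have "eventually (\<lambda>r. r \<in> {0<..<e}) (at_right (0::real))"
      using e(1) eventually_at_right_real by blast
    then show "eventually (\<lambda>r. ereal (max_dilation \<phi> x0 r powr p * r powr (?n - p)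
        / measure lebesgue (\<phi> ` ball x0 r)) \<le> ereal (D powr p)) (at_right 0)"
    proof eventually_elim
      case (elim r)
      then have "cball x0 r \<subseteq> \<Omega>" using e(2) subset_cball[of r e x0] by auto
      then show ?case using bound[of r x0] elim by simp
    qed
  qed
qed

end
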